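(* Let $G=(V,E)$ be a connected, undirected, unweighted graph on $n$ nodes with diameter $D$. Then a $(+8)$-all-pairs spanner of $G$ with $O\!\left(n^{15/11}\log^{10/11} n\right)$ edges can be constructed in $O\!\left(n^{7/11}\log^{1/11} n + D\right)$ rounds in the CONGEST model, with high probability.
   Context: $\delta_H(u,v)$ denotes the distance between $u$ and $v$ in a graph $H$. A subgraph $H$ of $G$ (on the same node set) is a $(+8)$-all-pairs spanner if $\delta_H(u,v)\le\delta_G(u,v)+8$ for all $(u,v)\in V\times V$. CONGEST model: the nodes of $G$ are processors with unique $O(\log n)$-bit identifiers; computation proceeds in synchronous rounds, in each of which every node may send an $O(\log n)$-bit message to each of its neighbors in $G$, followed by unbounded local computation. Initially each node knows its identifier and its neighbors' identifiers; at the end each node must know which of its incident edges belong to $H$. "With high probability" means with probability at least $1-n^{-c}$ for an arbitrarily chosen constant $c$. *)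

theory Defs
  imports "HOL-Probability.Probability" "HOL-Library.Log_Nat" "HOL-Library.Extended_Nat"
begin

text \<open>A graph is given by a node set and a set of two-element edges. Nodes are identified with
  their identifiers, which are natural numbers.\<close>

definition simple_graph :: "nat set \<Rightarrow> nat set set \<Rightarrow> bool" where
  "simple_graph V E \<longleftrightarrow> finite V \<and> (\<forall>e\<in>E. e \<subseteq> V \<and> card e = 2)"

definition arcs :: "nat set set \<Rightarrow> (nat \<times> nat) set" where
  "arcs E = {(u, v). {u, v} \<in> E}"

definition neighbors :: "nat set set \<Rightarrow> nat \<Rightarrow> nat set" where
  "neighbors E v = {u. {u, v} \<in> E}"

text \<open>The pairs in \<open>arcs E ^^ k\<close> are those joined by a walk with \<open>k\<close> edges; nodes that are not
  joined by any walk are at distance \<open>\<infinity>\<close>.\<close>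

definition gdist :: "nat set set \<Rightarrow> nat \<Rightarrow> nat \<Rightarrow> enat" where
  "gdist E u v = Inf (enat ` {k. (u, v) \<in> arcs E ^^ k})"

definition connected_graph :: "nat set \<Rightarrow> nat set set \<Rightarrow> bool" where
  "connected_graph V E \<longleftrightarrow>
     simple_graph V E \<and> V \<noteq> {} \<and> (\<forall>u\<in>V. \<forall>v\<in>V. (u, v) \<in> (arcs E)\<^sup>*)"

definition graph_diameter :: "nat set \<Rightarrow> nat set set \<Rightarrow> enat" where
  "graph_diameter V E = (SUP u\<in>V. SUP v\<in>V. gdist E u v)"

definition additive_spanner :: "nat set \<Rightarrow> nat set set \<Rightarrow> nat \<Rightarrow> nat set set \<Rightarrow> bool" where
  "additive_spanner V E k H \<longleftrightarrow>
     H \<subseteq> E \<and> (\<forall>u\<in>V. \<forall>v\<in>V. gdist H u v \<le> gdist E u v + enat k)"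


text \<open>All nodes run the same program. A node starts in a state that depends (randomly) only on its
  own identifier and the identifiers of its neighbors; in particular it knows neither the number of
  nodes nor the diameter. In a round, a node in state \<open>s\<close> sends \<open>send alg s u\<close> to each
  neighbor \<open>u\<close> and then draws its next state from \<open>next_state alg s inbox\<close>. Local computation is
  unrestricted, so these are arbitrary functions. A state with \<open>result alg s = Some S\<close> is final;
  \<open>S\<close> is then the set of those neighbors to which the node claims an edge of the constructed
  subgraph.\<close>

record 's congest_algorithm =
  init_state :: "nat \<Rightarrow> nat set \<Rightarrow> 's pmf"
  send :: "'s \<Rightarrow> nat \<Rightarrow> bool list"
  next_state :: "'s \<Rightarrow> (nat \<Rightarrow> bool list) \<Rightarrow> 's pmf"
  result :: "'s \<Rightarrow> nat set option"

text \<open>A node that has reached a final state stays in it and falls silent; silence is the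
  empty message.\<close>

definition message :: "'s congest_algorithm \<Rightarrow> 's \<Rightarrow> nat \<Rightarrow> bool list" where
  "message alg s u = (if result alg s = None then send alg s u else [])"

definition inbox ::
  "'s congest_algorithm \<Rightarrow> nat set set \<Rightarrow> (nat \<Rightarrow> 's) \<Rightarrow> nat \<Rightarrow> nat \<Rightarrow> bool list" where
  "inbox alg E \<sigma> v = (\<lambda>u. if u \<in> neighbors E v then message alg (\<sigma> u) v else [])"

definition update ::
  "'s congest_algorithm \<Rightarrow> 's \<Rightarrow> (nat \<Rightarrow> bool list) \<Rightarrow> 's pmf" where
  "update alg s m = (if result alg s = None then next_state alg s m else return_pmf s)"

text \<open>The distribution of the global configuration after \<open>r\<close> rounds. The nodes use
  independent private randomness, whence the product distributions.\<close>

primrec config ::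
  "'s congest_algorithm \<Rightarrow> nat set \<Rightarrow> nat set set \<Rightarrow> nat \<Rightarrow> (nat \<Rightarrow> 's) pmf" where
  "config alg V E 0 = Pi_pmf V undefined (\<lambda>v. init_state alg v (neighbors E v))"
| "config alg V E (Suc r) =
     bind_pmf (config alg V E r)
       (\<lambda>\<sigma>. Pi_pmf V undefined (\<lambda>v. update alg (\<sigma> v) (inbox alg E \<sigma> v)))"

definition respects_bandwidth ::
  "'s congest_algorithm \<Rightarrow> nat set \<Rightarrow> nat set set \<Rightarrow> nat \<Rightarrow> bool" where
  "respects_bandwidth alg V E b \<longleftrightarrow>
     (\<forall>r. \<forall>\<sigma>\<in>set_pmf (config alg V E r). \<forall>v\<in>V. \<forall>u\<in>neighbors E v.
        length (message alg (\<sigma> v) u) \<le> b)"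

definition outputs_subgraph ::
  "'s congest_algorithm \<Rightarrow> nat set \<Rightarrow> (nat \<Rightarrow> 's) \<Rightarrow> nat set set \<Rightarrow> bool" where
  "outputs_subgraph alg V \<sigma> H \<longleftrightarrow> (\<forall>v\<in>V. result alg (\<sigma> v) = Some (neighbors H v))"

end

theory Submission
  imports Defs "HOL-Library.List_Lexorder"
begin

text \<open>Write \<open>L\<close> for the bit length of \<open>n\<close>, let \<open>2 ^ \<theta>\<close> be about \<open>(n ^ 4 / L) powr (1/11)\<close>, \<open>h = M * L * 2 ^ \<theta>\<close>
  for a constant \<open>M\<close>, and \<open>q\<close> about \<open>n powr (1/11)\<close>. Nodes of degree at least \<open>h\<close> are heavy, and so are
  the edges that join them. All light edges are kept. Sets \<open>R i\<close>, for \<open>i < 7\<close>, are sampled with rate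
  \<open>2 powr (-\<theta>) / q ^ i\<close>. The members of \<open>R 0\<close> serve as centers: every heavy node keeps an edge to a center.
  For each \<open>r \<in> R i\<close> consider a tree of lightest paths from \<open>r\<close>, where a light edge weighs
  \<open>b = q ^ (i + 1)\<close> and a heavy one \<open>b + 1\<close>; the path from \<open>r\<close> to a center is kept
  if it has at most \<open>6 * b\<close> heavy edges.

  If a shortest path from \<open>u\<close> to \<open>v\<close> has \<open>k\<close> heavy edges, where \<open>q ^ i \<le> k < q ^ (i + 1)\<close>, then its heavy nodes have
  at least \<open>k * h / 3\<close> neighbors, and with high probability one of these, \<open>r\<close>, is in \<open>R i\<close>; say it is a
  neighbor of \<open>x\<close>. Let \<open>y\<close> and \<open>y'\<close> be the first and the last node on a heavy edge of the path and \<open>s\<close>, \<open>s'\<close> their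
  centers. The walk from \<open>r\<close> via \<open>x\<close> and \<open>y\<close> to \<open>s\<close> has length \<open>d(x, y) + 2\<close> and at most \<open>k + 2\<close> heavy edges,
  hence a lightest path from \<open>r\<close> to \<open>s\<close> has length at most \<open>d(x, y) + 3\<close> and at most \<open>6 * b\<close> heavy
  edges. Going from \<open>y\<close> via \<open>s\<close>, \<open>r\<close> and \<open>s'\<close> to \<open>y'\<close> thus costs at most \<open>8\<close> more than the shortest path.

  The seven families of trees are built one after the other by pipelined source detection in
  \<open>O(card (R i) + D)\<close> rounds each. Replaying the same schedule backwards tells every node
  which of its tree edges lead to a center.\<close>

section \<open>Algorithms given by functions of the local history\<close>

text \<open>The exponents balance three costs. Light edges number at most \<open>n * h\<close>,
  about \<open>n powr (15/11) * L powr (10/11)\<close>. A shortest path has at most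
  \<open>3 * n / h\<close> heavy edges, which is below \<open>q ^ 7\<close>; hence seven levels.
  Level \<open>i\<close> keeps at most \<open>card (R i) * card (R 0) * 6 * q ^ (i + 1)\<close>
  heavy edges; the sampling rate loses a factor \<open>q\<close> per level while the allowance gains
  one, so each level costs about \<open>q\<close> times the square of
  \<open>n / 2 ^ \<theta>\<close>. The number \<open>n / 2 ^ \<theta>\<close> itself is the round
  bound apart from \<open>D\<close>. The weights reconcile two aims: unweighted shortest paths may
  be heavy throughout, paths with few heavy edges may be long. As \<open>b\<close> exceeds the heavy
  count of the path at hand, minimising \<open>b * length + heavy\<close> loses little length and
  still caps the heavy edges. Nodes know neither \<open>n\<close> nor \<open>D\<close> but must
  begin each stage together, so they first agree on a round and count \<open>n\<close>. Rates are
  powers of two because thresholds on one geometric variable then serve all levels, with nested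
  samples. Bandwidth must hold with certainty, so all round counts depend on the graph and not on
  the sample.\<close>

fun encode_nat :: "nat \<Rightarrow> bool list" where
  "encode_nat x = (if x = 0 then [False] else True # odd x # encode_nat (x div 2))"

declare encode_nat.simps [simp del]

primrec encode :: "nat list \<Rightarrow> bool list" where
  "encode [] = []"
| "encode (x # xs) = encode_nat x @ encode xs"

text \<open>Local computation is unrestricted, so a non-constructive inverse is enough. Silence is
  the code of the empty list.\<close>

definition decode :: "bool list \<Rightarrow> nat list" where
  "decode = inv encode"

text \<open>Every binary digit is announced by \<open>True\<close> and the end is marked by
  \<open>False\<close>, so the code is self-delimiting and concatenated numbers can be separated
  again.\<close>

lemma encode_nat_append_inj:
  "encode_nat x @ r = encode_nat y @ s \<Longrightarrow> x = y \<and> r = s"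
proof (induction x arbitrary: y rule: encode_nat.induct)
  case (1 x)
  note eq = 1(2)
  show ?case
  proof (cases "x = 0 \<or> y = 0")
    case True
    then show ?thesis
      using eq by (auto simp: encode_nat.simps[of x] encode_nat.simps[of y] split: if_splits)
  next
    case False
    then have "odd x = odd y" and "encode_nat (x div 2) @ r = encode_nat (y div 2) @ s"
      using eq by (simp_all add: encode_nat.simps[of x] encode_nat.simps[of y])
    moreover from this have "x div 2 = y div 2 \<and> r = s"
      using 1(1) False by blast
    ultimately show ?thesis
      by (metis div_mult_mod_eq mod2_eq_if)
  qed
qed

lemma encode_nat_neq_Nil: "encode_nat x \<noteq> []"
  by (simp add: encode_nat.simps)

lemma inj_encode: "inj encode"
proof (rule injI)
  show "encode xs = encode ys \<Longrightarrow> xs = ys" for xs ys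
  proof (induction xs arbitrary: ys)
    case Nil
    then show ?case by (cases ys) (auto simp: encode_nat_neq_Nil)
  next
    case (Cons x xs)
    then show ?case
      by (cases ys) (auto simp: encode_nat_neq_Nil dest!: encode_nat_append_inj)
  qed
qed

lemma decode_encode [simp]: "decode (encode xs) = xs"
  by (simp add: decode_def inj_encode)

lemma length_encode_nat: "length (encode_nat x) = 2 * floorlog 2 x + 1"
proof (induction x rule: encode_nat.induct)
  case (1 x)
  then show ?case
    by (subst encode_nat.simps) (auto simp: compute_floorlog)
qed

lemma length_encode: "length (encode xs) = (\<Sum>x\<leftarrow>xs. 2 * floorlog 2 x + 1)"
  by (induction xs) (auto simp: length_encode_nat)

text \<open>Nodes remember everything they receive. Here \<open>I k u\<close> is the message received from \<open>u\<close> in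
  round \<open>k\<close>; the arguments of a local function are the identifier, the neighbors, the random
  number drawn initially, \<open>I\<close>, and the number of elapsed rounds.\<close>

type_synonym inputs = "nat \<Rightarrow> nat \<Rightarrow> nat list"
type_synonym 'b local_fun = "nat \<Rightarrow> nat set \<Rightarrow> nat \<Rightarrow> inputs \<Rightarrow> nat \<Rightarrow> 'b"

text \<open>Neighbor sets and received messages are stored as finite lists so that node states form
  a countable type, which \<open>to_nat\<close> turns into the state type
  \<open>nat\<close>.\<close>

type_synonym history = "(nat \<times> bool list) list list"
type_synonym node_state = "nat \<times> nat list \<times> nat \<times> history"

definition inputs_of :: "history \<Rightarrow> inputs" where
  "inputs_of hs k u =
     (if k < length hs then (case map_of (hs ! k) u of None \<Rightarrow> [] | Some m \<Rightarrow> decode m) else [])"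

definition view_algorithm ::
  "(nat \<Rightarrow> nat list) local_fun \<Rightarrow> nat set option local_fun \<Rightarrow> nat congest_algorithm" where
  "view_algorithm P Res = \<lparr>
     init_state = (\<lambda>v N. map_pmf (\<lambda>x. to_nat (v, sorted_list_of_set N, x, [] :: history))
                          (geometric_pmf (1/2))),
     send = (\<lambda>s u. case from_nat s :: node_state of (v, ns, x, hs) \<Rightarrow>
               encode (P v (set ns) x (inputs_of hs) (length hs) u)),
     next_state = (\<lambda>s m. case from_nat s :: node_state of (v, ns, x, hs) \<Rightarrow>
               return_pmf (to_nat (v, ns, x, hs @ [map (\<lambda>u. (u, m u)) ns]))),
     result = (\<lambda>s. case from_nat s :: node_state of (v, ns, x, hs) \<Rightarrow>
               Res v (set ns) x (inputs_of hs) (length hs)) \<rparr>"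

text \<open>The execution for fixed random numbers \<open>X\<close>. The recursion is on time
  because a message may depend on everything received before; rounds still to come read as
  \<open>[]\<close>, as they do in \<open>inputs_of\<close>.\<close>

primrec received ::
  "(nat \<Rightarrow> nat list) local_fun \<Rightarrow> nat set set \<Rightarrow> (nat \<Rightarrow> nat) \<Rightarrow> nat \<Rightarrow> nat \<Rightarrow> inputs" where
  "received P E X 0 = (\<lambda>v k u. [])"
| "received P E X (Suc t) = (\<lambda>v k u.
     if k = t then (if u \<in> neighbors E v
                    then P u (neighbors E u) (X u) (received P E X t u) t v else [])
     else received P E X t v k u)"

definition sent ::
  "(nat \<Rightarrow> nat list) local_fun \<Rightarrow> nat set set \<Rightarrow> (nat \<Rightarrow> nat) \<Rightarrow> nat \<Rightarrow> nat \<Rightarrow> nat \<Rightarrow> nat list" where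
  "sent P E X t v u = P v (neighbors E v) (X v) (received P E X t v) t u"

lemma received_eq:
  "received P E X T v k u = (if k < T \<and> u \<in> neighbors E v then sent P E X k u v else [])"
  by (induction T) (auto simp: sent_def less_Suc_eq)

definition history_of ::
  "(nat \<Rightarrow> nat list) local_fun \<Rightarrow> nat set set \<Rightarrow> (nat \<Rightarrow> nat) \<Rightarrow> nat \<Rightarrow> nat \<Rightarrow> history" where
  "history_of P E X T v = map (\<lambda>k. map (\<lambda>u. (u, encode (sent P E X k u v)))
     (sorted_list_of_set (neighbors E v))) [0..<T]"

lemma inputs_of_history_of:
  assumes "finite (neighbors E v)"
  shows "inputs_of (history_of P E X T v) = received P E X T v"
proof (intro ext)
  fix k u
  have *: "map_of (map (\<lambda>u. (u, f u)) xs) u = (if u \<in> set xs then Some (f u) else None)"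
    for f :: "nat \<Rightarrow> bool list" and xs
    by (induction xs) auto
  show "inputs_of (history_of P E X T v) k u = received P E X T v k u"
    using assms by (auto simp: inputs_of_def history_of_def received_eq *)
qed

lemma length_history_of [simp]: "length (history_of P E X T v) = T"
  by (simp add: history_of_def)

definition state_of ::
  "(nat \<Rightarrow> nat list) local_fun \<Rightarrow> nat set set \<Rightarrow> (nat \<Rightarrow> nat) \<Rightarrow> nat \<Rightarrow> nat \<Rightarrow> nat" where
  "state_of P E X T v =
     to_nat (v, sorted_list_of_set (neighbors E v), X v, history_of P E X T v)"

definition result_at ::
  "nat set option local_fun \<Rightarrow> (nat \<Rightarrow> nat list) local_fun \<Rightarrow> nat set set \<Rightarrow> (nat \<Rightarrow> nat) \<Rightarrow>
   nat \<Rightarrow> nat \<Rightarrow> nat set option" where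
  "result_at Res P E X T v = Res v (neighbors E v) (X v) (received P E X T v) T"

lemma result_state_of:
  assumes "finite (neighbors E v)"
  shows "result (view_algorithm P Res) (state_of P E X T v) = result_at Res P E X T v"
  using assms by (simp add: view_algorithm_def state_of_def inputs_of_history_of result_at_def)

lemma send_state_of:
  assumes "finite (neighbors E v)"
  shows "send (view_algorithm P Res) (state_of P E X T v) u = encode (sent P E X T v u)"
  using assms by (simp add: view_algorithm_def state_of_def inputs_of_history_of sent_def)

definition config_of ::
  "(nat \<Rightarrow> nat list) local_fun \<Rightarrow> nat set \<Rightarrow> nat set set \<Rightarrow> nat \<Rightarrow> (nat \<Rightarrow> nat) \<Rightarrow> nat \<Rightarrow> nat" where
  "config_of P V E T X = (\<lambda>v. if v \<in> V then state_of P E X T v else undefined)"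

definition samples :: "nat set \<Rightarrow> (nat \<Rightarrow> nat) pmf" where
  "samples V = Pi_pmf V 0 (\<lambda>_. geometric_pmf (1/2))"

text \<open>All randomness is drawn at the start, so configurations are distributed as the image of
  \<open>samples V\<close> under a deterministic map. No node may be final before round
  \<open>T\<close>, because final nodes fall silent and \<open>sent\<close> does not model
  that.\<close>

lemma config_view_algorithm:
  assumes fin: "finite V" and nb: "\<And>v. v \<in> V \<Longrightarrow> neighbors E v \<subseteq> V"
    and run: "\<And>t v X. t < T \<Longrightarrow> v \<in> V \<Longrightarrow> result_at Res P E X t v = None"
  shows "config (view_algorithm P Res) V E T = map_pmf (config_of P V E T) (samples V)"
  using run
proof (induction T)
  case 0
  have "Pi_pmf V undefined (\<lambda>v. map_pmf
            (\<lambda>x. to_nat (v, sorted_list_of_set (neighbors E v), x, [] :: history)) (geometric_pmf (1/2)))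
        = map_pmf (\<lambda>X v. if v \<in> V then to_nat (v, sorted_list_of_set (neighbors E v), X v, [] :: history)
                   else undefined) (samples V)"
    (is "?l = ?r")
  proof -
    let ?f = "\<lambda>v. \<lambda>x. to_nat (v, sorted_list_of_set (neighbors E v), x, [] :: history)"
    have "?l = Pi_pmf V undefined (\<lambda>v. bind_pmf (geometric_pmf (1/2)) (\<lambda>x. return_pmf (?f v x)))"
      by (simp add: map_pmf_def)
    also have "\<dots> = bind_pmf (samples V)
        (\<lambda>X. Pi_pmf V undefined (\<lambda>v. return_pmf (?f v (X v))))"
      unfolding samples_def by (rule Pi_pmf_bind) (rule fin)
    also have "\<dots> = ?r"
      using fin by (simp add: map_pmf_def)
    finally show ?thesis .
  qed
  moreover have "config_of P V E 0 = (\<lambda>X v. if v \<in> V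
      then to_nat (v, sorted_list_of_set (neighbors E v), X v, [] :: history) else undefined)"
    by (auto simp: fun_eq_iff config_of_def state_of_def history_of_def)
  ultimately show ?case
    by (simp add: view_algorithm_def)
next
  case (Suc T)
  let ?A = "view_algorithm P Res"
  have finN: "finite (neighbors E v)" if "v \<in> V" for v
    using nb fin that finite_subset by blast
  have step: "update ?A (config_of P V E T X v) (inbox ?A E (config_of P V E T X) v) =
      return_pmf (state_of P E X (Suc T) v)" if v: "v \<in> V" for v X
  proof -
    have msg: "message ?A (config_of P V E T X u) v = encode (sent P E X T u v)"
      if "u \<in> neighbors E v" for u
    proof -
      have u: "u \<in> V" using nb v that by blast
      then show ?thesis
        using Suc.prems[of T u X] finN[OF u]
        by (simp add: message_def config_of_def result_state_of send_state_of)
    qed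
    have "map (\<lambda>u. (u, inbox ?A E (config_of P V E T X) v u)) (sorted_list_of_set (neighbors E v)) =
        map (\<lambda>u. (u, encode (sent P E X T u v))) (sorted_list_of_set (neighbors E v))"
      by (rule map_cong) (use finN[OF v] msg in \<open>auto simp: inbox_def\<close>)
    then have "next_state ?A (state_of P E X T v) (inbox ?A E (config_of P V E T X) v) =
        return_pmf (state_of P E X (Suc T) v)"
      by (simp add: view_algorithm_def state_of_def history_of_def)
    moreover have "result ?A (state_of P E X T v) = None"
      using Suc.prems[of T v X] finN[OF v] v by (simp add: result_state_of)
    ultimately show ?thesis
      using v by (simp add: update_def config_of_def)
  qed
  have "config ?A V E T = map_pmf (config_of P V E T) (samples V)"
    using Suc.prems by (intro Suc.IH) auto
  then have "config ?A V E (Suc T) = bind_pmf (samples V) (\<lambda>X.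
      Pi_pmf V undefined (\<lambda>v. update ?A (config_of P V E T X v) (inbox ?A E (config_of P V E T X) v)))"
    by (simp add: bind_map_pmf)
  also have "\<dots> = bind_pmf (samples V) (\<lambda>X.
      Pi_pmf V undefined (\<lambda>v. return_pmf (state_of P E X (Suc T) v)))"
    using step fin by (intro bind_pmf_cong refl Pi_pmf_cong) auto
  also have "\<dots> = map_pmf (config_of P V E (Suc T)) (samples V)"
    using fin by (simp add: map_pmf_def config_of_def[abs_def])
  finally show ?case .
qed

lemma config_stable:
  assumes fin: "finite V"
    and final: "\<And>\<sigma> v. \<sigma> \<in> set_pmf (config alg V E T) \<Longrightarrow> v \<in> V \<Longrightarrow> result alg (\<sigma> v) \<noteq> None"
  shows "config alg V E (T + k) = config alg V E T"
proof (induction k)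
  case (Suc k)
  \<comment> \<open>Equality of configurations as functions also concerns arguments outside
    \<open>V\<close>, where the product distributions fix the default.\<close>
  have dflt: "\<sigma> v = undefined" if "\<sigma> \<in> set_pmf (config alg V E r)" "v \<notin> V" for \<sigma> v r
    using that set_Pi_pmf_subset[OF fin] by (cases r) fastforce+
  have "config alg V E (T + Suc k) = bind_pmf (config alg V E T)
       (\<lambda>\<sigma>. Pi_pmf V undefined (\<lambda>v. update alg (\<sigma> v) (inbox alg E \<sigma> v)))"
    using Suc by simp
  also have "\<dots> = bind_pmf (config alg V E T) return_pmf"
  proof (rule bind_pmf_cong[OF refl])
    fix \<sigma> assume \<sigma>: "\<sigma> \<in> set_pmf (config alg V E T)"
    have "Pi_pmf V undefined (\<lambda>v. update alg (\<sigma> v) (inbox alg E \<sigma> v)) =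
        Pi_pmf V undefined (\<lambda>v. return_pmf (\<sigma> v))"
      using final[OF \<sigma>] by (intro Pi_pmf_cong refl) (simp_all add: update_def del: not_None_eq)
    also have "\<dots> = return_pmf (\<lambda>v. if v \<in> V then \<sigma> v else undefined)"
      using fin by simp
    also have "(\<lambda>v. if v \<in> V then \<sigma> v else undefined) = \<sigma>"
      using dflt[OF \<sigma>] by auto
    finally show "Pi_pmf V undefined (\<lambda>v. update alg (\<sigma> v) (inbox alg E \<sigma> v)) = return_pmf \<sigma>" .
  qed
  finally show ?case by (simp add: bind_return_pmf')
qed simp

text \<open>Before round \<open>T\<close> the length bound applies for every \<open>X\<close>; from
  \<open>T\<close> on the configuration is stable and all nodes send the empty message.\<close>

lemma respects_bandwidth_view_algorithm:
  assumes fin: "finite V" and nb: "\<And>v. v \<in> V \<Longrightarrow> neighbors E v \<subseteq> V"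
    and run: "\<And>t v X. t < T \<Longrightarrow> v \<in> V \<Longrightarrow> result_at Res P E X t v = None"
    and final: "\<And>v X. v \<in> V \<Longrightarrow> result_at Res P E X T v \<noteq> None"
    and len: "\<And>t v u X. t < T \<Longrightarrow> v \<in> V \<Longrightarrow> u \<in> neighbors E v \<Longrightarrow>
                length (encode (sent P E X t v u)) \<le> b"
  shows "respects_bandwidth (view_algorithm P Res) V E b"
  unfolding respects_bandwidth_def
proof (intro allI ballI)
  fix r \<sigma> v u
  let ?A = "view_algorithm P Res"
  assume \<sigma>: "\<sigma> \<in> set_pmf (config ?A V E r)" and v: "v \<in> V" and u: "u \<in> neighbors E v"
  have finN: "finite (neighbors E v)" if "v \<in> V" for v
    using nb fin that finite_subset by blast
  show "length (message ?A (\<sigma> v) u) \<le> b"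
  proof (cases "r < T")
    case True
    then have "config ?A V E r = map_pmf (config_of P V E r) (samples V)"
      using run by (intro config_view_algorithm fin nb) auto
    with \<sigma> obtain X where "\<sigma> = config_of P V E r X" by auto
    then show ?thesis
      using len[OF True v u, of X] v finN[OF v]
      by (simp add: message_def config_of_def send_state_of)
  next
    case False
    have T: "config ?A V E T = map_pmf (config_of P V E T) (samples V)"
      using run by (intro config_view_algorithm fin nb) auto
    have res: "result ?A (\<sigma> v) \<noteq> None" if "\<sigma> \<in> set_pmf (config ?A V E T)" "v \<in> V" for \<sigma> v
      using that final finN unfolding T by (auto simp: config_of_def result_state_of)
    have "config ?A V E (T + (r - T)) = config ?A V E T"
      by (rule config_stable[OF fin]) (use res in auto)
    then have "\<sigma> \<in> set_pmf (config ?A V E T)"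
      using \<sigma> False by simp
    then show ?thesis
      using res[of \<sigma> v] v by (simp add: message_def del: not_None_eq)
  qed
qed

text \<open>A phase of the algorithm is a synchronous state machine: \<open>local_run\<close> is what a node can
  compute of it from the messages received since round \<open>s\<close>, \<open>global_run\<close> is the joint evolution.\<close>

primrec local_run ::
  "'a \<Rightarrow> (nat \<Rightarrow> 'a \<Rightarrow> (nat \<Rightarrow> nat list) \<Rightarrow> 'a) \<Rightarrow> inputs \<Rightarrow> nat \<Rightarrow> nat \<Rightarrow> 'a" where
  "local_run a f I s 0 = a"
| "local_run a f I s (Suc t) = f t (local_run a f I s t) (I (s + t))"

primrec global_run ::
  "nat set set \<Rightarrow> (nat \<Rightarrow> 'a) \<Rightarrow> (nat \<Rightarrow> nat \<Rightarrow> 'a \<Rightarrow> (nat \<Rightarrow> nat list) \<Rightarrow> 'a) \<Rightarrow>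
   (nat \<Rightarrow> nat \<Rightarrow> 'a \<Rightarrow> nat \<Rightarrow> nat list) \<Rightarrow> nat \<Rightarrow> nat \<Rightarrow> 'a" where
  "global_run E a f out 0 = a"
| "global_run E a f out (Suc t) = (\<lambda>v. f v t (global_run E a f out t v)
     (\<lambda>u. if u \<in> neighbors E v then out u t (global_run E a f out t u) v else []))"

text \<open>The hypothesis on \<open>sent\<close> is limited to times below \<open>K\<close> so that
  the lemma can be applied inside an induction over rounds, when only earlier messages are
  understood.\<close>

lemma local_run_eq_global_run:
  assumes nb: "\<And>v. v \<in> V \<Longrightarrow> neighbors E v \<subseteq> V"
    and sent: "\<And>t v u. t < K \<Longrightarrow> v \<in> V \<Longrightarrow> u \<in> V \<Longrightarrow>
      sent P E X (s + t) v u = out v t (global_run E a f out t v) u"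
    and "t \<le> K" "s + t \<le> T" "v \<in> V"
  shows "local_run (a v) (f v) (received P E X T v) s t = global_run E a f out t v"
  using assms(3-)
proof (induction t arbitrary: v)
  case (Suc t)
  then have "local_run (a v) (f v) (received P E X T v) s t = global_run E a f out t v"
    by simp
  moreover have "received P E X T v (s + t) =
      (\<lambda>u. if u \<in> neighbors E v then out u t (global_run E a f out t u) v else [])"
    using Suc.prems nb[of v] by (intro ext) (auto simp: received_eq intro!: sent)
  ultimately show ?case by simp
qed simp

section \<open>Distances, leader election, and agreement on a round\<close>

definition nat_dist :: "nat set set \<Rightarrow> nat \<Rightarrow> nat \<Rightarrow> nat" where
  "nat_dist E u v = (LEAST k. (u, v) \<in> arcs E ^^ k)"

lemma arcs_neighbors: "(u, v) \<in> arcs E \<longleftrightarrow> u \<in> neighbors E v"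
  by (simp add: arcs_def neighbors_def)

lemma neighbors_sym: "u \<in> neighbors E v \<longleftrightarrow> v \<in> neighbors E u"
  by (simp add: neighbors_def insert_commute)

lemma arcs_pow_sym: "(u, v) \<in> arcs E ^^ k \<Longrightarrow> (v, u) \<in> arcs E ^^ k"
proof (induction k arbitrary: v)
  case (Suc k)
  then obtain w where "(u, w) \<in> arcs E ^^ k" "(w, v) \<in> arcs E" by auto
  then show ?case
    using Suc.IH[of w] by (intro relpow_Suc_I2[of v w]) (auto simp: arcs_neighbors neighbors_sym)
qed simp

lemma nat_dist_le: "(u, v) \<in> arcs E ^^ k \<Longrightarrow> nat_dist E u v \<le> k"
  unfolding nat_dist_def by (rule Least_le)

lemma nat_dist_walk: "(u, v) \<in> arcs E ^^ k \<Longrightarrow> (u, v) \<in> arcs E ^^ nat_dist E u v"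
  unfolding nat_dist_def by (rule LeastI)

lemma gdist_le: "(u, v) \<in> arcs E ^^ k \<Longrightarrow> gdist E u v \<le> enat k"
  unfolding gdist_def by (rule Inf_lower) auto

lemma gdist_eq:
  assumes "(u, v) \<in> arcs E ^^ k"
  shows "gdist E u v = enat (nat_dist E u v)"
proof (rule antisym)
  show "gdist E u v \<le> enat (nat_dist E u v)"
    by (rule gdist_le[OF nat_dist_walk[OF assms]])
  show "enat (nat_dist E u v) \<le> gdist E u v"
    unfolding gdist_def by (rule Inf_greatest) (auto simp: nat_dist_le)
qed

definition pow4 :: "nat \<Rightarrow> bool" where
  "pow4 t \<longleftrightarrow> (\<exists>j. t = 4 ^ j)"

text \<open>In the setup phase a node keeps the smallest identifier heard of, together with the distance
  over which it came. At each time \<open>4 ^ j\<close> it restarts a test value, the successor of that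
  identifier, which turns to \<open>0\<close> as soon as a neighbor has another test value.\<close>

definition test_value :: "nat \<Rightarrow> nat list \<times> nat \<Rightarrow> nat" where
  "test_value t z = (if pow4 t then Suc (fst z ! 0) else snd z)"

definition setup_init :: "nat \<Rightarrow> nat list \<times> nat" where
  "setup_init v = ([v, 0], 0)"

definition setup_out :: "nat \<Rightarrow> nat list \<times> nat \<Rightarrow> nat list" where
  "setup_out t z = fst z @ [test_value t z]"

definition setup_step ::
  "nat set \<Rightarrow> nat \<Rightarrow> nat list \<times> nat \<Rightarrow> (nat \<Rightarrow> nat list) \<Rightarrow> nat list \<times> nat" where
  "setup_step N t z m =
     (Min (insert (fst z) ((\<lambda>u. [m u ! 0, Suc (m u ! 1)]) ` N)),
      if \<forall>u\<in>N. m u ! 2 = test_value t z then test_value t z else 0)"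

locale cgraph =
  fixes V :: "nat set" and E :: "nat set set"
  assumes conn: "connected_graph V E"
begin

lemma finV: "finite V" and neV: "V \<noteq> {}" and edge: "e \<in> E \<Longrightarrow> e \<subseteq> V \<and> card e = 2"
  using conn by (auto simp: connected_graph_def simple_graph_def)

lemma neighbors_subset: "neighbors E v \<subseteq> V"
  using edge by (fastforce simp: neighbors_def)

lemma finite_neighbors: "finite (neighbors E v)"
  using finite_subset[OF neighbors_subset finV] .

lemma neighbor_in_V: "u \<in> neighbors E v \<Longrightarrow> u \<in> V" "u \<in> neighbors E v \<Longrightarrow> v \<in> V"
  using neighbors_subset neighbors_sym by blast+

lemma not_neighbor_self: "v \<notin> neighbors E v"
  using edge[of "{v}"] by (auto simp: neighbors_def)

lemma walk_in_V: "(u, v) \<in> arcs E ^^ k \<Longrightarrow> v \<in> V \<Longrightarrow> u \<in> V"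
proof (induction k arbitrary: v)
  case (Suc k)
  then obtain w where "(u, w) \<in> arcs E ^^ k" "w \<in> neighbors E v"
    by (auto simp: arcs_neighbors)
  then show ?case using Suc.IH neighbor_in_V(1) by blast
qed simp

lemma dist_walk: "u \<in> V \<Longrightarrow> v \<in> V \<Longrightarrow> (u, v) \<in> arcs E ^^ nat_dist E u v"
  using conn nat_dist_walk by (fastforce simp: connected_graph_def dest: rtrancl_imp_relpow)

lemma gdist_nat_dist: "u \<in> V \<Longrightarrow> v \<in> V \<Longrightarrow> gdist E u v = enat (nat_dist E u v)"
  using gdist_eq dist_walk by blast

lemma nat_dist_self [simp]: "nat_dist E v v = 0"
  using nat_dist_le[of v v 0 E] by simp

lemma nat_dist_eq_0: "u \<in> V \<Longrightarrow> v \<in> V \<Longrightarrow> nat_dist E u v = 0 \<longleftrightarrow> u = v"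
  using dist_walk[of u v] by auto

lemma nat_dist_sym: "u \<in> V \<Longrightarrow> v \<in> V \<Longrightarrow> nat_dist E u v = nat_dist E v u"
  by (meson antisym arcs_pow_sym dist_walk nat_dist_le)

lemma nat_dist_triangle:
  assumes "u \<in> V" "v \<in> V" "w \<in> V"
  shows "nat_dist E u w \<le> nat_dist E u v + nat_dist E v w"
  using assms relpow_trans[OF dist_walk dist_walk] by (intro nat_dist_le) blast

lemma nat_dist_neighbor:
  assumes "u \<in> V" "v \<in> V" "w \<in> neighbors E v"
  shows "nat_dist E u w \<le> Suc (nat_dist E u v)"
  using relpow_Suc_I[OF dist_walk[OF assms(1,2)]] assms(3)
  by (intro nat_dist_le) (auto simp: arcs_neighbors neighbors_sym)

lemma nat_dist_pred:
  assumes "u \<in> V" "v \<in> V" "nat_dist E u v = Suc k"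
  shows "\<exists>w\<in>neighbors E v. nat_dist E u w = k"
proof -
  have "(u, v) \<in> arcs E ^^ Suc k"
    using dist_walk[OF assms(1,2)] assms(3) by simp
  then obtain w where w: "(u, w) \<in> arcs E ^^ k" "w \<in> neighbors E v"
    by (auto simp: arcs_neighbors)
  then have "nat_dist E u w \<le> k" by (simp add: nat_dist_le)
  moreover have "Suc k \<le> Suc (nat_dist E u w)"
    using nat_dist_neighbor[of u w v] w neighbor_in_V assms by (simp add: neighbors_sym)
  ultimately show ?thesis using w by force
qed

lemma nat_dist_intermediate:
  assumes "u \<in> V" "v \<in> V" "k \<le> nat_dist E u v"
  shows "\<exists>w\<in>V. nat_dist E u w = k"
  using assms(2,3)
proof (induction "nat_dist E u v" arbitrary: v)
  case (Suc n)
  show ?case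
  proof (cases "k = Suc n")
    case False
    obtain w where "w \<in> neighbors E v" "nat_dist E u w = n"
      using nat_dist_pred[OF assms(1) Suc.prems(1)] Suc.hyps(2) by metis
    then show ?thesis
      using Suc.hyps(1)[of w] Suc False neighbor_in_V by force
  qed (use Suc in auto)
qed (use assms in force)

section \<open>Leader election and the agreed round\<close>

definition setup_state :: "nat \<Rightarrow> nat \<Rightarrow> nat list \<times> nat" where
  "setup_state = global_run E setup_init (\<lambda>v. setup_step (neighbors E v)) (\<lambda>v t z u. setup_out t z)"

lemma setup_state_0: "setup_state 0 v = ([v, 0], 0)"
  by (simp add: setup_state_def setup_init_def)

lemma setup_state_Suc:
  "setup_state (Suc t) v = setup_step (neighbors E v) t (setup_state t v)
     (\<lambda>u. if u \<in> neighbors E v then setup_out t (setup_state t u) else [])"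
  unfolding setup_state_def by simp

definition walks_to :: "nat \<Rightarrow> nat \<Rightarrow> nat list set" where
  "walks_to t v = {[u, k] |u k. k \<le> t \<and> (u, v) \<in> arcs E ^^ k}"

text \<open>Lists are compared lexicographically, identifier first and distance second, and
  lengthening walks by one edge preserves this order. Flooding minima therefore yields the minimum
  over all walks of length at most \<open>t\<close>.\<close>

lemma fst_setup_state:
  "fst (setup_state t v) \<in> walks_to t v \<and> (\<forall>x\<in>walks_to t v. fst (setup_state t v) \<le> x)"
proof (induction t arbitrary: v)
  case 0
  then show ?case by (auto simp: setup_state_0 walks_to_def)
next
  case (Suc t)
  define inc where "inc = (\<lambda>x. [x ! 0, Suc (x ! 1) :: nat])"
  let ?S = "insert (fst (setup_state t v)) ((\<lambda>u. inc (fst (setup_state t u))) ` neighbors E v)"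
  have two: "\<exists>a b. fst (setup_state t u) = [a, b]" for u
    using Suc[of u] by (auto simp: walks_to_def)
  have "fst (setup_state (Suc t) v) = Min ?S"
  proof -
    have "setup_out t (setup_state t u) ! 0 = fst (setup_state t u) ! 0 \<and>
          setup_out t (setup_state t u) ! 1 = fst (setup_state t u) ! 1" for u
      using two[of u] by (auto simp: setup_out_def)
    then show ?thesis
      by (simp add: setup_state_Suc inc_def setup_step_def cong: image_cong_simp)
  qed
  moreover have fin: "finite ?S" using finite_neighbors by simp
  moreover have "?S \<subseteq> walks_to (Suc t) v"
  proof -
    have "inc (fst (setup_state t u)) \<in> walks_to (Suc t) v" if "u \<in> neighbors E v" for u
    proof -
      obtain x k where x: "fst (setup_state t u) = [x, k]" "k \<le> t" "(x, u) \<in> arcs E ^^ k"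
        using Suc[of u] by (auto simp: walks_to_def)
      then have "(x, v) \<in> arcs E ^^ Suc k"
        using that by (intro relpow_Suc_I) (auto simp: arcs_neighbors)
      then show ?thesis using x by (auto simp: walks_to_def inc_def)
    qed
    then show ?thesis using Suc[of v] by (auto simp: walks_to_def)
  qed
  moreover have "\<exists>y\<in>?S. y \<le> x" if mem: "x \<in> walks_to (Suc t) v" for x
  proof -
    obtain u k where x: "x = [u, k]" "k \<le> Suc t" "(u, v) \<in> arcs E ^^ k"
      using mem unfolding walks_to_def by blast
    show ?thesis
    proof (cases k)
      case 0
      then show ?thesis using Suc[of v] x by (auto simp: walks_to_def)
    next
      case (Suc k')
      then obtain w where w: "(u, w) \<in> arcs E ^^ k'" "w \<in> neighbors E v"
        using x by (auto simp: arcs_neighbors)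
      then have "[u, k'] \<in> walks_to t w" using x Suc by (auto simp: walks_to_def)
      then have "fst (setup_state t w) \<le> [u, k']" using Suc.IH[of w] by blast
      then have "inc (fst (setup_state t w)) \<le> x"
        using two[of w] x Suc by (auto simp: inc_def)
      then show ?thesis using w by auto
    qed
  qed
  ultimately show ?case
    by (metis (no_types, lifting) Min_in Min_le empty_not_insert order_trans subsetD)
qed

definition leader :: nat where "leader = Min V"

lemma leader_in_V: "leader \<in> V" and leader_le: "v \<in> V \<Longrightarrow> leader \<le> v"
  using finV neV by (auto simp: leader_def)

definition depth :: "nat \<Rightarrow> nat" where "depth v = nat_dist E leader v"

lemma setup_state_leader:
  assumes "v \<in> V" "depth v \<le> t"
  shows "fst (setup_state t v) = [leader, depth v]"
proof -
  have "[leader, depth v] \<in> walks_to t v"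
    using assms leader_in_V dist_walk by (auto simp: walks_to_def depth_def)
  then have le: "fst (setup_state t v) \<le> [leader, depth v]"
    using fst_setup_state by blast
  obtain u k where uk: "fst (setup_state t v) = [u, k]" "(u, v) \<in> arcs E ^^ k"
    using fst_setup_state[of t v] by (auto simp: walks_to_def)
  then have "u \<in> V" using walk_in_V assms by blast
  then show ?thesis
    using le uk leader_le[of u] nat_dist_le[of leader v k E] by (auto simp: depth_def)
qed

definition covers :: "nat \<Rightarrow> bool" where
  "covers t \<longleftrightarrow> (\<forall>w\<in>V. depth w \<le> t)"

text \<open>A test begun at time \<open>4 ^ j\<close> runs for \<open>3 * 4 ^ j\<close> rounds
  without being restarted.\<close>

lemma not_pow4_between:
  assumes "0 < s" "s < 3 * 4 ^ j"
  shows "\<not> pow4 (4 ^ j + s)"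
proof
  assume "pow4 (4 ^ j + s)"
  then obtain i where i: "4 ^ j + s = (4::nat) ^ i" by (auto simp: pow4_def)
  have "(4::nat) ^ j < 4 ^ i" "(4::nat) ^ i < 4 ^ Suc j"
    unfolding i[symmetric] using assms by simp_all
  then have "j < i" "i < Suc j" by (simp_all only: power_strict_increasing_iff)
  then show False by simp
qed

text \<open>A disagreement turns test values to \<open>0\<close> and spreads by one edge per round.
  A value that survives \<open>s\<close> rounds thus certifies that all nodes within distance
  \<open>s\<close> held the same candidate at the restart.\<close>

lemma snd_setup_state:
  assumes "v \<in> V" "e = 4 ^ j" "0 < s" "s \<le> 3 * e"
  shows "(\<forall>w\<in>V. fst (setup_state e w) ! 0 = c) \<Longrightarrow> snd (setup_state (e + s) v) = Suc c"
    and "snd (setup_state (e + s) v) = Suc c \<Longrightarrow> k \<le> s \<Longrightarrow> (w, v) \<in> arcs E ^^ k \<Longrightarrow>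
           fst (setup_state e w) ! 0 = c"
proof -
  \<comment> \<open>At offset \<open>0\<close> the stored value still belongs to the previous test;
    the restarted value takes its place.\<close>
  define y where "y = (\<lambda>s v. if s = 0 then Suc (fst (setup_state e v) ! 0) else snd (setup_state (e + s) v))"
  have test: "test_value (e + s) (setup_state (e + s) v) = y s v" if "s < 3 * e" for s v
    using not_pow4_between[of s j] that assms by (auto simp: test_value_def pow4_def y_def)
  have len: "length (fst (setup_state t u)) = 2" for t u
    using fst_setup_state[of t u] by (auto simp: walks_to_def)
  have step: "y (Suc s) v = (if \<forall>u\<in>neighbors E v. y s u = y s v then y s v else 0)"
    if "s < 3 * e" for s v
  proof -
    have out: "setup_out (e + s) (setup_state (e + s) u) ! 2 = y s u" for u
      using test[OF that, of u] len[of "e + s" u]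
      by (metis nth_append_length setup_out_def)
    have "y (Suc s) v = snd (setup_state (Suc (e + s)) v)"
      by (simp add: y_def)
    also have "\<dots> = (if \<forall>u\<in>neighbors E v. y s u = y s v then y s v else 0)"
      unfolding setup_state_Suc by (simp add: setup_step_def test[OF that] out)
    finally show ?thesis .
  qed
  have fwd: "y s v = Suc c" if "\<forall>w\<in>V. fst (setup_state e w) ! 0 = c" "s \<le> 3 * e" "v \<in> V" for s v
    using that(2,3)
  proof (induction s arbitrary: v)
    case (Suc s)
    then have "y s u = Suc c" if "u \<in> neighbors E v \<or> u = v" for u
      using that neighbor_in_V[of u v] by (intro Suc.IH) auto
    then show ?case using step[of s v] Suc.prems by simp
  qed (use that in \<open>auto simp: y_def\<close>)
  have bwd: "fst (setup_state e w) ! 0 = c"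
    if "y s v = Suc c" "k \<le> s" "(w, v) \<in> arcs E ^^ k" "s \<le> 3 * e" for s v k
    using that
  proof (induction s arbitrary: v k)
    case (Suc s)
    then have nb: "\<forall>u\<in>neighbors E v. y s u = Suc c" "y s v = Suc c"
      using step[of s v] by (auto split: if_splits)
    show ?case
    proof (cases "k \<le> s")
      case True
      then show ?thesis using Suc nb by auto
    next
      case False
      then have "k = Suc s" using Suc.prems by simp
      then obtain u where u: "(w, u) \<in> arcs E ^^ s" "u \<in> neighbors E v"
        using Suc.prems by (auto simp: arcs_neighbors)
      then show ?thesis using nb(1) Suc.IH[of u s] Suc.prems by auto
    qed
  qed (auto simp: y_def)
  show "(\<forall>w\<in>V. fst (setup_state e w) ! 0 = c) \<Longrightarrow> snd (setup_state (e + s) v) = Suc c"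
    using fwd[of s v] assms by (auto simp: y_def)
  show "snd (setup_state (e + s) v) = Suc c \<Longrightarrow> k \<le> s \<Longrightarrow> (w, v) \<in> arcs E ^^ k \<Longrightarrow>
           fst (setup_state e w) ! 0 = c"
    using bwd[of s v k] assms by (auto simp: y_def)
qed

text \<open>The outcome does not depend on \<open>v\<close>, which makes all nodes stop in the same
  round. If \<open>v\<close> survives, the nodes within distance \<open>3 * e\<close> share a
  candidate \<open>c\<close>, and having learned it by time \<open>e\<close> they lie within
  distance \<open>e\<close> of \<open>c\<close>. So none of them is at distance
  \<open>2 * e + 1\<close> from \<open>v\<close>; hence the whole graph was tested, and
  \<open>c\<close> is the leader.\<close>

lemma setup_test:
  assumes "v \<in> V"
  shows "snd (setup_state (4 ^ Suc j) v) \<noteq> 0 \<longleftrightarrow> covers (4 ^ j)"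
proof -
  define e where "e = (4::nat) ^ j"
  have e: "4 ^ Suc j = e + 3 * e" "e > 0" by (auto simp: e_def)
  show ?thesis
  proof
    assume "covers (4 ^ j)"
    then have "\<forall>w\<in>V. fst (setup_state e w) ! 0 = leader"
      by (auto simp: covers_def e_def setup_state_leader)
    then show "snd (setup_state (4 ^ Suc j) v) \<noteq> 0"
      using snd_setup_state(1)[OF assms e_def, of "3 * e" leader] e by auto
  next
    assume "snd (setup_state (4 ^ Suc j) v) \<noteq> 0"
    then obtain c where "snd (setup_state (e + 3 * e) v) = Suc c"
      using e not0_implies_Suc by metis
    then have c: "fst (setup_state e w) ! 0 = c" if "k \<le> 3 * e" "(w, v) \<in> arcs E ^^ k" for k w
      using snd_setup_state(2)[OF assms e_def, of "3 * e" c k w] that e(2) by simp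
    have near: "c \<in> V \<and> nat_dist E c w \<le> e" if "fst (setup_state e w) ! 0 = c" "w \<in> V" for w
    proof -
      obtain x k where x: "fst (setup_state e w) = [x, k]" "k \<le> e" "(x, w) \<in> arcs E ^^ k"
        using fst_setup_state[of e w] by (auto simp: walks_to_def)
      then show ?thesis using that nat_dist_le[of x w k E] walk_in_V[of x w k] by simp
    qed
    have cv: "c \<in> V" "nat_dist E c v \<le> e" using near[of v] c[of 0 v] assms by auto
    have "nat_dist E v w \<le> 3 * e" if w: "w \<in> V" for w
    proof (rule ccontr)
      assume "\<not> ?thesis"
      then obtain x where x: "x \<in> V" "nat_dist E v x = 2 * e + 1"
        using nat_dist_intermediate[OF assms w, of "2 * e + 1"] e by auto
      then have "fst (setup_state e x) ! 0 = c"
        using c[of "2 * e + 1" x] dist_walk[of x v] nat_dist_sym[of x v] assms e by auto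
      then have "nat_dist E c x \<le> e" using near x by blast
      moreover have "nat_dist E v x \<le> nat_dist E v c + nat_dist E c x"
        using nat_dist_triangle assms cv x by blast
      ultimately show False using cv x nat_dist_sym[of v c] assms by simp
    qed
    then have all: "fst (setup_state e w) ! 0 = c" if "w \<in> V" for w
      using that c[of "nat_dist E w v" w] dist_walk[of w v] nat_dist_sym[of w v] assms by auto
    have "c \<le> leader"
    proof -
      have "[leader, 0] \<in> walks_to e leader" by (auto simp: walks_to_def)
      then have "fst (setup_state e leader) \<le> [leader, 0]" using fst_setup_state by blast
      then show ?thesis
        using all[OF leader_in_V] fst_setup_state[of e leader, THEN conjunct1]
        unfolding walks_to_def by force
    qed
    then have "c = leader" using leader_le[OF cv(1)] by simp
    then show "covers (4 ^ j)"
      using near all by (auto simp: covers_def depth_def e_def)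
  qed
qed

definition J :: nat where "J = (LEAST j. covers (4 ^ j))"

definition T0 :: nat where "T0 = 4 ^ Suc J"

lemma covers_mono: "covers s \<Longrightarrow> s \<le> t \<Longrightarrow> covers t"
  unfolding covers_def using order_trans by blast

lemma covers_J: "covers (4 ^ J)"
proof -
  have "covers (4 ^ (\<Sum>w\<in>V. depth w))"
  proof -
    have "depth w \<le> 4 ^ (\<Sum>w\<in>V. depth w)" if "w \<in> V" for w
    proof -
      have "depth w \<le> (\<Sum>w\<in>V. depth w)" using that finV by (simp add: member_le_sum)
      also have "\<dots> < 4 ^ (\<Sum>w\<in>V. depth w)" by (rule less_exp[THEN less_le_trans]) (simp add: power_mono)
      finally show ?thesis by simp
    qed
    then show ?thesis by (simp add: covers_def)
  qed
  then show ?thesis unfolding J_def by (rule LeastI)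
qed

lemma depth_less_T0: "v \<in> V \<Longrightarrow> depth v \<le> T0 - 1"
  using covers_J by (fastforce simp: covers_def T0_def)

lemma T0_pos: "T0 \<ge> 4" by (simp add: T0_def)

lemma covers_iff: "covers (4 ^ j) \<longleftrightarrow> T0 \<le> 4 ^ Suc j"
proof
  assume "covers (4 ^ j)"
  then have "J \<le> j" unfolding J_def by (rule Least_le)
  then show "T0 \<le> 4 ^ Suc j" by (simp add: T0_def power_increasing)
next
  assume "T0 \<le> 4 ^ Suc j"
  then have "(4::nat) ^ J \<le> 4 ^ j" by (simp add: T0_def)
  then show "covers (4 ^ j)" using covers_J covers_mono by blast
qed

text \<open>One factor 4 is the length of a test, the other comes from the minimality of
  \<open>J\<close>: some node is deeper than \<open>4 ^ (J - 1)\<close>. For \<open>J = 0\<close>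
  the bound rests on \<open>D > 0\<close>.\<close>

lemma T0_le:
  assumes "\<And>v. v \<in> V \<Longrightarrow> depth v \<le> D" "D > 0"
  shows "T0 \<le> 16 * D"
proof (cases J)
  case 0
  then show ?thesis using assms by (simp add: T0_def)
next
  case (Suc j)
  then have "\<not> covers (4 ^ j)" unfolding J_def by (intro not_less_Least) (auto simp: J_def)
  then obtain w where "w \<in> V" "4 ^ j < depth w" by (auto simp: covers_def)
  then show ?thesis using assms(1)[of w] Suc by (simp add: T0_def)
qed

lemma setup_state_late: "v \<in> V \<Longrightarrow> T0 - 1 \<le> t \<Longrightarrow> fst (setup_state t v) = [leader, depth v]"
  using setup_state_leader depth_less_T0[of v] by simp

text \<open>A crude polynomial bound is enough: it serves to show that the deadline
  \<open>K\<close>, and with it the weights, fit into \<open>O(log n)\<close> bits.\<close>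

lemma nat_dist_le_square:
  assumes "u \<in> V" "v \<in> V"
  shows "nat_dist E u v \<le> card V * card V"
proof -
  have sub: "arcs E \<subseteq> V \<times> V"
    using neighbor_in_V by (auto simp: arcs_neighbors)
  then have fin: "finite (arcs E)" using finV finite_subset by blast
  obtain k where "k \<le> card (arcs E)" "(u, v) \<in> arcs E ^^ k"
    using relpow_finite_bounded[OF fin, of "nat_dist E u v"] dist_walk[OF assms] by auto
  moreover have "card (arcs E) \<le> card (V \<times> V)"
    using card_mono[OF _ sub] finV by simp
  ultimately show ?thesis using nat_dist_le[of u v k E] by (simp add: card_cartesian_product)
qed

end

section \<open>Counting the nodes\<close>

text \<open>The census sums up the number of nodes along a breadth-first tree; a node at depth \<open>d\<close> reports
  to its parent \<open>p\<close> in round \<open>T - d\<close>. The total travels back during a second period of \<open>T\<close> rounds.\<close>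

definition census_value :: "nat \<Rightarrow> nat \<times> nat \<Rightarrow> nat" where
  "census_value d z = (if d = 0 then fst z else snd z)"

definition census_out :: "nat \<Rightarrow> nat \<Rightarrow> nat \<Rightarrow> nat \<Rightarrow> nat \<times> nat \<Rightarrow> nat \<Rightarrow> nat list" where
  "census_out T d p t z u =
     (if t < T then (if 0 < d \<and> t + d = T \<and> u = p then [fst z] else [])
      else (if 0 < census_value d z then [census_value d z] else []))"

definition census_step ::
  "nat \<Rightarrow> nat set \<Rightarrow> nat \<Rightarrow> nat \<times> nat \<Rightarrow> (nat \<Rightarrow> nat list) \<Rightarrow> nat \<times> nat" where
  "census_step T N t z m =
     (if t < T then (fst z + (\<Sum>u\<in>N. if m u = [] then 0 else hd (m u)), 0)
      else (fst z, Max (insert (snd z) (hd ` (m ` N - {[]})))))"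

context cgraph
begin

text \<open>\<open>LEAST\<close> makes the choice reproducible by the node itself from the depths
  its neighbors report.\<close>

definition parent :: "nat \<Rightarrow> nat" where
  "parent v = (LEAST u. u \<in> neighbors E v \<and> Suc (depth u) = depth v)"

lemma parent:
  assumes "v \<in> V" "0 < depth v"
  shows "parent v \<in> neighbors E v" "Suc (depth (parent v)) = depth v"
proof -
  obtain k where "depth v = Suc k" using assms(2) gr0_implies_Suc by blast
  then have "\<exists>u. u \<in> neighbors E v \<and> Suc (depth u) = depth v"
    using nat_dist_pred[OF leader_in_V assms(1)] by (auto simp: depth_def)
  then have "parent v \<in> neighbors E v \<and> Suc (depth (parent v)) = depth v"
    unfolding parent_def by (rule LeastI_ex)
  then show "parent v \<in> neighbors E v" "Suc (depth (parent v)) = depth v" by auto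
qed

definition census_state :: "nat \<Rightarrow> nat \<Rightarrow> nat \<times> nat" where
  "census_state = global_run E (\<lambda>v. (Suc 0, 0)) (\<lambda>v. census_step T0 (neighbors E v))
     (\<lambda>v. census_out T0 (depth v) (parent v))"

lemma census_state_0: "census_state 0 v = (Suc 0, 0)"
  by (simp add: census_state_def)

lemma census_state_Suc:
  "census_state (Suc t) v = census_step T0 (neighbors E v) t (census_state t v)
     (\<lambda>u. if u \<in> neighbors E v then census_out T0 (depth u) (parent u) t (census_state t u) v else [])"
  unfolding census_state_def by (simp only: global_run.simps)

text \<open>Invariant of the upward sweep: in round \<open>t\<close> the layer of depth
  \<open>T0 - t\<close> hands its partial counts to its parents and leaves the sum. At
  \<open>t = T0\<close> only the leader remains.\<close>

lemma census_sum:
  "t \<le> T0 \<Longrightarrow> (\<Sum>v | v \<in> V \<and> depth v + t \<le> T0. fst (census_state t v)) = card V"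
proof (induction t)
  case 0
  have "{v. v \<in> V \<and> depth v \<le> T0} = V" using depth_less_T0 by fastforce
  then show ?case by (simp add: census_state_0)
next
  case (Suc t)
  let ?c = "\<lambda>v. fst (census_state t v)"
  let ?A = "{v \<in> V. depth v + Suc t \<le> T0}"
  let ?B = "{u \<in> V. depth u + t = T0}"
  have fin: "finite ?A" "finite ?B" using finV by auto
  have "fst (census_state (Suc t) v) = ?c v + (\<Sum>u\<in>?B. if v = parent u then ?c u else 0)"
    if v: "v \<in> ?A" for v
  proof -
    have "fst (census_state (Suc t) v) =
        ?c v + (\<Sum>u\<in>neighbors E v. if u \<in> ?B \<and> v = parent u then ?c u else 0)"
      using Suc.prems neighbor_in_V(1)[of _ v]
      by (auto simp: census_state_Suc census_step_def census_out_def intro!: sum.cong)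
    also have "(\<Sum>u\<in>neighbors E v. if u \<in> ?B \<and> v = parent u then ?c u else 0) =
        (\<Sum>u\<in>neighbors E v \<inter> ?B. if v = parent u then ?c u else 0)"
      using finite_neighbors by (intro sum.mono_neutral_cong_right) auto
    also have "\<dots> = (\<Sum>u\<in>?B. if v = parent u then ?c u else 0)"
    proof (intro sum.mono_neutral_left)
      show "\<forall>u\<in>?B - neighbors E v \<inter> ?B. (if v = parent u then ?c u else 0) = 0"
      proof
        fix u assume u: "u \<in> ?B - neighbors E v \<inter> ?B"
        then have "0 < depth u" using Suc.prems by auto
        then show "(if v = parent u then ?c u else 0) = 0"
          using u parent(1)[of u] neighbors_sym[of u E v] by auto
      qed
    qed (use fin in auto)
    finally show ?thesis .
  qed
  then have "(\<Sum>v\<in>?A. fst (census_state (Suc t) v)) =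
      (\<Sum>v\<in>?A. ?c v) + (\<Sum>v\<in>?A. \<Sum>u\<in>?B. if v = parent u then ?c u else 0)"
    by (simp add: sum.distrib)
  also have "(\<Sum>v\<in>?A. \<Sum>u\<in>?B. if v = parent u then ?c u else 0) =
      (\<Sum>u\<in>?B. \<Sum>v\<in>?A. if v = parent u then ?c u else 0)"
    by (rule sum.swap)
  also have "\<dots> = (\<Sum>u\<in>?B. ?c u)"
  proof (rule sum.cong[OF refl])
    fix u assume u: "u \<in> ?B"
    then have "0 < depth u" using Suc.prems by auto
    then have "parent u \<in> ?A"
      using u parent[of u] neighbor_in_V(1)[of "parent u" u] by auto
    then show "(\<Sum>v\<in>?A. if v = parent u then ?c u else 0) = ?c u"
      using fin(1) by simp
  qed
  also have "(\<Sum>v\<in>?A. ?c v) + (\<Sum>u\<in>?B. ?c u) = (\<Sum>v\<in>?A \<union> ?B. ?c v)"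
    using fin by (intro sum.union_disjoint[symmetric]) auto
  also have "?A \<union> ?B = {v \<in> V. depth v + t \<le> T0}" by auto
  finally show ?case using Suc by simp
qed

lemma census_fst_le:
  assumes "v \<in> V" "depth v + t \<le> T0"
  shows "fst (census_state t v) \<le> card V"
proof -
  have "fst (census_state t v) \<le> (\<Sum>v | v \<in> V \<and> depth v + t \<le> T0. fst (census_state t v))"
    using assms finV by (intro member_le_sum) auto
  then show ?thesis using census_sum[of t] assms by simp
qed

lemma depth_eq_0: "v \<in> V \<Longrightarrow> depth v = 0 \<longleftrightarrow> v = leader"
  using nat_dist_eq_0[OF leader_in_V] by (auto simp: depth_def)

text \<open>The total floods downwards by one layer per round. The value \<open>0\<close> stands for
  not yet informed and cannot be confused with the total, as \<open>V\<close> is nonempty.\<close>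

lemma census_value_late:
  "v \<in> V \<Longrightarrow> census_value (depth v) (census_state (T0 + i) v) = (if depth v \<le> i then card V else 0)"
proof (induction i arbitrary: v)
  case 0
  have "{v. v \<in> V \<and> depth v = 0} = {leader}" using depth_eq_0 leader_in_V by auto
  then have "fst (census_state T0 leader) = card V"
    using census_sum[of T0] by simp
  moreover have "snd (census_state T0 v) = 0"
    using T0_pos by (cases T0) (auto simp: census_state_Suc census_step_def)
  ultimately show ?case
    using 0 depth_eq_0 by (auto simp: census_value_def)
next
  case (Suc i)
  have pos: "card V > 0" using finV neV by auto
  show ?case
  proof (cases "depth v = 0")
    case True
    then show ?thesis
      using Suc.IH[OF Suc.prems] by (simp add: census_value_def census_state_Suc census_step_def)
  next
    case False
    let ?m = "\<lambda>u. if u \<in> neighbors E v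
      then census_out T0 (depth u) (parent u) (T0 + i) (census_state (T0 + i) u) v else []"
    have m: "?m u = (if depth u \<le> i then [card V] else [])" if "u \<in> neighbors E v" for u
      using that Suc.IH[of u] neighbor_in_V pos by (auto simp: census_out_def)
    have "census_value (depth v) (census_state (T0 + Suc i) v) =
        Max (insert (snd (census_state (T0 + i) v)) (hd ` (?m ` neighbors E v - {[]})))"
      using False by (simp add: census_value_def census_state_Suc census_step_def)
    also have "snd (census_state (T0 + i) v) = (if depth v \<le> i then card V else 0)"
      using Suc.IH[OF Suc.prems] False by (simp add: census_value_def)
    also have "?m ` neighbors E v = (\<lambda>u. if depth u \<le> i then [card V] else []) ` neighbors E v"
      using m by (intro image_cong refl)
    also have "\<dots> - {[]} = (if \<exists>u\<in>neighbors E v. depth u \<le> i then {[card V]} else {})"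
      by (auto split: if_splits)
    also have "hd ` \<dots> = (if \<exists>u\<in>neighbors E v. depth u \<le> i then {card V} else {})"
      by simp
    finally have val: "census_value (depth v) (census_state (T0 + Suc i) v) =
        Max (insert (if depth v \<le> i then card V else 0)
          (if \<exists>u\<in>neighbors E v. depth u \<le> i then {card V} else {}))" .
    show ?thesis
    proof (cases "depth v \<le> Suc i")
      case True
      then have "\<exists>u\<in>neighbors E v. depth u \<le> i"
        using parent[OF Suc.prems] False by (intro bexI[of _ "parent v"]) auto
      then show ?thesis using val True by simp
    next
      case d: False
      have "\<not> depth u \<le> i" if "u \<in> neighbors E v" for u
        using nat_dist_neighbor[OF leader_in_V, of u v] that d neighbor_in_V[of u v]
        by (auto simp: depth_def neighbors_sym[of v])
      then show ?thesis using val d by simp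
    qed
  qed
qed

lemma census_final: "v \<in> V \<Longrightarrow> census_value (depth v) (census_state (2 * T0) v) = card V"
  using census_value_late[of v T0] depth_less_T0[of v] by (simp add: mult_2)

lemma census_out_le:
  assumes "v \<in> V"
  shows "length (census_out T0 (depth v) (parent v) t (census_state t v) u) \<le> 1"
    and "x \<in> set (census_out T0 (depth v) (parent v) t (census_state t v) u) \<Longrightarrow> x \<le> card V"
proof -
  show "length (census_out T0 (depth v) (parent v) t (census_state t v) u) \<le> 1"
    by (simp add: census_out_def)
  show "x \<le> card V" if x: "x \<in> set (census_out T0 (depth v) (parent v) t (census_state t v) u)"
  proof (cases "t < T0")
    case True
    then show ?thesis
      using x census_fst_le[OF assms, of t] by (auto simp: census_out_def split: if_splits)
  next
    case False
    then obtain i where "t = T0 + i" by (metis le_add_diff_inverse not_less)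
    then show ?thesis
      using x census_value_late[OF assms, of i] by (auto simp: census_out_def split: if_splits)
  qed
qed

end

section \<open>Weighted source detection\<close>

text \<open>A token \<open>[w, k, r]\<close> at a node stands for a walk to the source \<open>r\<close> that
  has weight \<open>w\<close> and contains \<open>k\<close> heavy edges, where an edge weighs \<open>b\<close>, or \<open>b + 1\<close> if it is heavy.
  In each of the first \<open>K\<close> rounds a node sends the least token it has not sent yet among those that
  are currently best for their source. The following \<open>K\<close> rounds run through the same schedule backwards:
  this makes every node hear from its children in the tree of a source before its own turn comes.\<close>

record detection_state =
  known :: "(nat list \<times> nat) set"
  picks :: "(nat list \<times> nat) option list"
  marks :: "nat set"
  links :: "nat set"

definition best :: "(nat list \<times> nat) set \<Rightarrow> nat list set" where
  "best A = {x \<in> fst ` A. \<forall>y\<in>fst ` A. y ! 2 = x ! 2 \<longrightarrow> x \<le> y}"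

definition picked :: "(nat list \<times> nat) option list \<Rightarrow> nat list set" where
  "picked ps = {x. \<exists>p. Some (x, p) \<in> set ps}"

definition pick :: "detection_state \<Rightarrow> (nat list \<times> nat) option" where
  "pick z = (let C = best (known z) - picked (picks z) in
     if C = {} then None else Some (Min C, LEAST u. (Min C, u) \<in> known z))"

text \<open>Round \<open>t\<close> of the backward half treats the token picked in round
  \<open>2 * K - 1 - t\<close>. The condition \<open>p \<noteq> v\<close> stops at the source, whose
  initial token names itself as origin; membership in \<open>best\<close> discards tokens that were
  sent and later superseded.\<close>

definition mark :: "nat \<Rightarrow> nat \<Rightarrow> bool \<Rightarrow> nat \<Rightarrow> nat \<Rightarrow> detection_state \<Rightarrow> (nat \<times> nat) option" where
  "mark K b S v t z = (case picks z ! (2 * K - 1 - t) of None \<Rightarrow> None | Some (x, p) \<Rightarrow>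
     if p \<noteq> v \<and> x \<in> best (known z) \<and> (x ! 2 \<in> marks z \<or> S \<and> x ! 1 \<le> 6 * b)
     then Some (x ! 2, p) else None)"

definition detection_init :: "bool \<Rightarrow> nat \<Rightarrow> detection_state" where
  "detection_init R v =
     \<lparr>known = (if R then {([0, 0, v], v)} else {}), picks = [], marks = {}, links = {}\<rparr>"

definition detection_out :: "nat \<Rightarrow> nat \<Rightarrow> bool \<Rightarrow> nat \<Rightarrow> nat \<Rightarrow> detection_state \<Rightarrow> nat \<Rightarrow> nat list" where
  "detection_out K b S v t z u =
     (if t < K then (case pick z of None \<Rightarrow> [] | Some (x, p) \<Rightarrow> x)
      else (case mark K b S v t z of None \<Rightarrow> [] | Some (r, p) \<Rightarrow> if u = p then [r] else []))"

definition detection_step ::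
  "nat \<Rightarrow> nat \<Rightarrow> bool \<Rightarrow> nat set \<Rightarrow> (nat \<Rightarrow> nat) \<Rightarrow> nat \<Rightarrow> nat \<Rightarrow> detection_state \<Rightarrow>
   (nat \<Rightarrow> nat list) \<Rightarrow> detection_state" where
  "detection_step K b S N e v t z m =
     (if t < K
      then z\<lparr>known := known z \<union>
               {([m u ! 0 + b + e u, m u ! 1 + e u, m u ! 2], u) |u. u \<in> N \<and> m u \<noteq> []},
             picks := picks z @ [pick z]\<rparr>
      else z\<lparr>marks := marks z \<union> {hd (m u) |u. u \<in> N \<and> m u \<noteq> []},
             links := links z \<union> {u \<in> N. m u \<noteq> []} \<union>
               (case mark K b S v t z of None \<Rightarrow> {} | Some (r, p) \<Rightarrow> {p})\<rparr>)"

locale detection = cgraph +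
  fixes R S heavy :: "nat \<Rightarrow> bool" and b K :: nat
  assumes b_pos: "0 < b"
begin

definition cost :: "nat \<Rightarrow> nat \<Rightarrow> nat" where
  "cost u v = (if heavy u \<and> heavy v then 1 else 0)"

lemma cost_commute: "cost u v = cost v u"
  by (auto simp: cost_def)

definition state :: "nat \<Rightarrow> nat \<Rightarrow> detection_state" where
  "state = global_run E (\<lambda>v. detection_init (R v) v)
     (\<lambda>v. detection_step K b (S v) (neighbors E v) (\<lambda>u. cost u v) v) (\<lambda>v. detection_out K b (S v) v)"

lemma state_0: "state 0 v = detection_init (R v) v"
  by (simp add: state_def)

lemma state_Suc:
  "state (Suc t) v = detection_step K b (S v) (neighbors E v) (\<lambda>u. cost u v) v t (state t v)
     (\<lambda>u. if u \<in> neighbors E v then detection_out K b (S u) u t (state t u) v else [])"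
  unfolding state_def by (simp only: global_run.simps)

section \<open>Lightest walks to the sources\<close>

definition sources :: "nat set" where "sources = {r \<in> V. R r}"

lemma finite_sources: "finite sources"
  using finV by (simp add: sources_def)

inductive token :: "nat \<Rightarrow> nat \<Rightarrow> nat \<Rightarrow> nat \<Rightarrow> bool" where
  source: "r \<in> sources \<Longrightarrow> token r r 0 0"
| step: "token r u w k \<Longrightarrow> u \<in> neighbors E v \<Longrightarrow> token r v (w + b + cost u v) (k + cost u v)"

lemma token_in_V: "token r v w k \<Longrightarrow> r \<in> sources \<and> v \<in> V"
  by (induction rule: token.induct) (auto simp: sources_def dest: neighbor_in_V)

text \<open>Weight is \<open>b\<close> times length plus number of heavy edges; with
  \<open>k\<close> under control, lengths can be read off from weights.\<close>

lemma token_weight: "token r v w k \<Longrightarrow> \<exists>l. w = b * l + k \<and> k \<le> l \<and> (r, v) \<in> arcs E ^^ l"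
proof (induction rule: token.induct)
  case (step r u w k v)
  then obtain l where l: "w = b * l + k" "k \<le> l" "(r, u) \<in> arcs E ^^ l" by auto
  moreover have "(r, v) \<in> arcs E ^^ Suc l"
    using l(3) step.hyps(2) by (intro relpow_Suc_I) (auto simp: arcs_neighbors)
  ultimately show ?case
    by (intro exI[of _ "Suc l"]) (auto simp: cost_def)
qed (intro exI[of _ 0], simp)

lemma token_walk:
  assumes "r \<in> sources" "p 0 = r" "\<And>i. i < l \<Longrightarrow> p i \<in> neighbors E (p (Suc i))"
  shows "token r (p l) (b * l + (\<Sum>i<l. cost (p i) (p (Suc i)))) (\<Sum>i<l. cost (p i) (p (Suc i)))"
  using assms(3)
proof (induction l)
  case 0
  then show ?case using assms(1,2) token.source by simp
next
  case (Suc l)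
  then have "token r (p l) (b * l + (\<Sum>i<l. cost (p i) (p (Suc i)))) (\<Sum>i<l. cost (p i) (p (Suc i)))"
    by simp
  from token.step[OF this, of "p (Suc l)"] show ?case
    using Suc.prems[of l] by (simp add: algebra_simps)
qed

lemma token_exists:
  assumes "r \<in> sources" "v \<in> V"
  shows "\<exists>w k. token r v w k \<and> w \<le> (b + 1) * nat_dist E r v"
proof -
  have "(r, v) \<in> arcs E ^^ nat_dist E r v"
    using assms dist_walk by (simp add: sources_def)
  then obtain p where p: "p 0 = r" "p (nat_dist E r v) = v"
    "\<And>i. i < nat_dist E r v \<Longrightarrow> p i \<in> neighbors E (p (Suc i))"
    by (auto simp: relpow_fun_conv arcs_neighbors)
  moreover have "(\<Sum>i<l. cost (p i) (p (Suc i))) \<le> l" for l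
    using sum_bounded_above[of "{..<l}" "\<lambda>i. cost (p i) (p (Suc i))" 1] by (simp add: cost_def)
  ultimately show ?thesis
    using token_walk[of r p "nat_dist E r v"] assms by (fastforce simp: algebra_simps)
qed

definition opt_weight :: "nat \<Rightarrow> nat \<Rightarrow> nat" where
  "opt_weight r v = (LEAST w. \<exists>k. token r v w k)"

definition opt_heavy :: "nat \<Rightarrow> nat \<Rightarrow> nat" where
  "opt_heavy r v = (LEAST k. token r v (opt_weight r v) k)"

text \<open>The source comes last as a tie breaker, so distinct sources are strictly ordered at
  every node.\<close>

definition opt :: "nat \<Rightarrow> nat \<Rightarrow> nat list" where
  "opt r v = [opt_weight r v, opt_heavy r v, r]"

lemma opt_nth [simp]: "opt r v ! 0 = opt_weight r v" "opt r v ! 1 = opt_heavy r v"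
  "opt r v ! Suc 0 = opt_heavy r v" "opt r v ! 2 = r"
  by (simp_all add: opt_def)

lemma opt_le: "token r v w k \<Longrightarrow> opt r v \<le> [w, k, r]"
proof -
  assume tok: "token r v w k"
  have "opt_weight r v \<le> w" unfolding opt_weight_def by (rule Least_le) (use tok in auto)
  moreover have "opt_heavy r v \<le> k" if "opt_weight r v = w"
    unfolding opt_heavy_def by (rule Least_le) (use tok that in auto)
  ultimately show ?thesis by (auto simp: opt_def)
qed

lemma token_opt':
  assumes "token r v w k"
  shows "token r v (opt_weight r v) (opt_heavy r v)"
proof -
  have "\<exists>k. token r v (opt_weight r v) k"
    unfolding opt_weight_def by (rule LeastI) (use assms in auto)
  then show ?thesis unfolding opt_heavy_def by (rule LeastI_ex)
qed

lemma token_opt: "r \<in> sources \<Longrightarrow> v \<in> V \<Longrightarrow> token r v (opt_weight r v) (opt_heavy r v)"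
  using token_exists token_opt' by blast

lemma opt_weight_le: "token r v w k \<Longrightarrow> opt_weight r v \<le> w"
  unfolding opt_weight_def by (rule Least_le) auto

text \<open>Extending two tokens by the same edge preserves their lexicographic order, so a better
  token at \<open>u\<close> would improve the optimal one at \<open>v\<close>.\<close>

lemma opt_pred:
  assumes "token r u w k" "u \<in> neighbors E v"
    and "opt r v = [w + b + cost u v, k + cost u v, r]"
  shows "opt r u = [w, k, r]"
proof -
  have "token r v (opt_weight r u + b + cost u v) (opt_heavy r u + cost u v)"
    using token.step[OF token_opt'[OF assms(1)] assms(2)] .
  then have "[w + b + cost u v, k + cost u v, r] \<le>
      [opt_weight r u + b + cost u v, opt_heavy r u + cost u v, r]"
    using opt_le assms(3) by metis
  then have "[w, k, r] \<le> opt r u" by (auto simp: opt_def)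
  then show ?thesis using opt_le[OF assms(1)] by simp
qed

text \<open>Sources that precede \<open>r\<close> at its predecessor \<open>u\<close> still precede
  it at \<open>v\<close>, so \<open>rank\<close> is monotone along tree paths.\<close>

lemma opt_mono:
  assumes "r \<in> sources" "r' \<in> sources" "u \<in> neighbors E v" "opt r' u < opt r u"
    and "opt r v = [opt_weight r u + b + cost u v, opt_heavy r u + cost u v, r]"
  shows "opt r' v < opt r v"
proof -
  have "opt r' v \<le> [opt_weight r' u + b + cost u v, opt_heavy r' u + cost u v, r']"
    using assms neighbor_in_V by (intro opt_le token.step token_opt) auto
  also have "\<dots> < opt r v"
    using assms(4) unfolding assms(5) by (auto simp: opt_def)
  finally show ?thesis .
qed

section \<open>Every source is served by its deadline\<close>

definition rank :: "nat \<Rightarrow> nat \<Rightarrow> nat" where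
  "rank r v = card {r' \<in> sources. opt r' v < opt r v}"

text \<open>The first summand is at least the number of edges the optimal token travels, the second
  counts the tokens that may have to be sent before it.\<close>

definition due :: "nat \<Rightarrow> nat \<Rightarrow> nat" where
  "due r v = opt_weight r v div b + rank r v"

lemma due_less:
  assumes "r' \<in> sources" "opt r' v < opt r v"
  shows "due r' v < due r v"
proof -
  have "{r'' \<in> sources. opt r'' v < opt r' v} \<subset> {r'' \<in> sources. opt r'' v < opt r v}"
    using assms by auto
  then have "rank r' v < rank r v"
    unfolding rank_def using finite_sources by (intro psubset_card_mono) auto
  moreover have "opt_weight r' v \<le> opt_weight r v"
    using assms(2) by (auto simp: opt_def)
  ultimately show ?thesis
    unfolding due_def by (meson add_le_less_mono div_le_mono)
qed

lemma due_pred: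
  assumes "r \<in> sources" "u \<in> neighbors E v"
    and "opt r v = [opt_weight r u + b + cost u v, opt_heavy r u + cost u v, r]"
  shows "due r u < due r v"
proof -
  have "rank r u \<le> rank r v"
    unfolding rank_def using assms finite_sources opt_mono by (intro card_mono) auto
  moreover have "opt_weight r u div b < opt_weight r v div b"
  proof -
    have "Suc (opt_weight r u div b) = (opt_weight r u + b) div b" using b_pos by simp
    also have "\<dots> \<le> opt_weight r v div b"
      using assms(3) by (intro div_le_mono) (simp add: opt_def)
    finally show ?thesis by simp
  qed
  ultimately show ?thesis by (simp add: due_def)
qed

definition picked_at :: "nat \<Rightarrow> nat \<Rightarrow> (nat list \<times> nat) option" where
  "picked_at t v = pick (state t v)"

lemma picks_state: "t \<le> K \<Longrightarrow> picks (state t v) = map (\<lambda>t. picked_at t v) [0..<t]"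
  by (induction t) (auto simp: state_0 detection_init_def state_Suc detection_step_def picked_at_def)

lemma picked_state:
  assumes "t \<le> K"
  shows "picked (picks (state t v)) = {x. \<exists>s<t. \<exists>p. picked_at s v = Some (x, p)}"
proof -
  have "Some (x, p) \<in> set (picks (state t v)) \<longleftrightarrow> (\<exists>s<t. picked_at s v = Some (x, p))" for x p
    unfolding picks_state[OF assms] set_map set_upt image_iff by (metis atLeastLessThan_iff zero_le)
  then show ?thesis by (auto simp: picked_def)
qed

lemma known_Suc: "t < K \<Longrightarrow> known (state (Suc t) v) = known (state t v) \<union>
    {([x ! 0 + b + cost u v, x ! 1 + cost u v, x ! 2], u) |u x p.
       u \<in> neighbors E v \<and> picked_at t u = Some (x, p) \<and> x \<noteq> []}"
  by (fastforce simp: state_Suc detection_step_def detection_out_def picked_at_def split: option.splits)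

lemma known_mono: "t \<le> t' \<Longrightarrow> t' \<le> K \<Longrightarrow> known (state t v) \<subseteq> known (state t' v)"
  by (induction t' rule: dec_induct) (auto simp: known_Suc)

lemma finite_known: "finite (known (state t v))"
proof (induction t)
  case (Suc t)
  have "finite {(f u, u) |u. u \<in> neighbors E v \<and> P u}" for f :: "nat \<Rightarrow> nat list" and P
    using finite_neighbors by (auto intro: finite_subset[of _ "(\<lambda>u. (f u, u)) ` neighbors E v"])
  then show ?case using Suc by (simp add: state_Suc detection_step_def)
qed (simp add: state_0 detection_init_def)

lemma pick_Some:
  assumes "picked_at t v = Some (x, p)"
  shows "(x, p) \<in> known (state t v)" "x \<in> best (known (state t v))"
    "x \<notin> picked (picks (state t v))"
    "\<And>y. y \<in> best (known (state t v)) \<Longrightarrow> y \<notin> picked (picks (state t v)) \<Longrightarrow> x \<le> y"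
proof -
  define C where "C = best (known (state t v)) - picked (picks (state t v))"
  have C: "C \<noteq> {}" "x = Min C" "p = (LEAST u. (x, u) \<in> known (state t v))"
    using assms by (auto simp: picked_at_def pick_def Let_def C_def split: if_splits)
  have "best (known (state t v)) \<subseteq> fst ` known (state t v)" by (auto simp: best_def)
  then have fin: "finite C" unfolding C_def using finite_known finite_subset by blast
  then have x: "x \<in> C" using C Min_in by blast
  then show "x \<in> best (known (state t v))" "x \<notin> picked (picks (state t v))" by (auto simp: C_def)
  then have "\<exists>u. (x, u) \<in> known (state t v)" by (auto simp: best_def)
  then show "(x, p) \<in> known (state t v)" using C(3) LeastI_ex by metis
  show "x \<le> y" if "y \<in> best (known (state t v))" "y \<notin> picked (picks (state t v))" for y
    using that C(2) fin by (simp add: C_def)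
qed

lemma known_cases:
  assumes "(x, u) \<in> known (state t v)" "t \<le> K" "v \<in> V"
  shows "(u = v \<and> v \<in> sources \<and> x = [0, 0, v]) \<or>
    (u \<in> neighbors E v \<and> (\<exists>s<t. \<exists>r w k p. token r u w k \<and> picked_at s u = Some ([w, k, r], p) \<and>
      x = [w + b + cost u v, k + cost u v, r]))"
  using assms
proof (induction t arbitrary: x u v)
  case 0
  then show ?case by (auto simp: state_0 detection_init_def sources_def split: if_splits)
next
  case (Suc t)
  show ?case
  proof (cases "(x, u) \<in> known (state t v)")
    case True
    then show ?thesis using Suc.IH[OF True] Suc.prems by (auto intro: less_SucI)
  next
    case False
    then obtain y p where y: "u \<in> neighbors E v" "picked_at t u = Some (y, p)"
      "x = [y ! 0 + b + cost u v, y ! 1 + cost u v, y ! 2]"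
      using Suc.prems by (auto simp: known_Suc)
    have "(y, p) \<in> known (state t u)" using pick_Some(1)[OF y(2)] .
    then have "\<exists>r w k. token r u w k \<and> y = [w, k, r]"
      using Suc.IH[of y p u] Suc.prems y neighbor_in_V token.source token.step by fastforce
    then show ?thesis using y by auto
  qed
qed

lemma known_token:
  assumes "(x, u) \<in> known (state t v)" "t \<le> K" "v \<in> V"
  shows "\<exists>w k r. token r v w k \<and> x = [w, k, r]"
  using known_cases[OF assms] token.source token.step by blast

lemma best_opt:
  assumes "x \<in> best (known (state t v))" "t \<le> K" "v \<in> V" "(opt r v, p) \<in> known (state t v)" "x ! 2 = r"
  shows "x = opt r v"
proof -
  have "x \<le> opt r v" using assms by (force simp: best_def)
  moreover obtain w k r' where "token r' v w k" "x = [w, k, r']"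
    using assms known_token by (fastforce simp: best_def)
  then have "opt r v \<le> x" using assms(5) opt_le by simp
  ultimately show ?thesis by simp
qed

lemma opt_best:
  assumes "(opt r v, p) \<in> known (state t v)" "t \<le> K" "v \<in> V"
  shows "opt r v \<in> best (known (state t v))"
proof -
  have "opt r v \<le> y" if "y \<in> fst ` known (state t v)" "y ! 2 = r" for y
    using that known_token[of y _ t v] assms opt_le by fastforce
  then show ?thesis using assms by (force simp: best_def)
qed

lemma opt_cases:
  assumes "r \<in> sources" "v \<in> V"
  obtains "v = r" "opt r v = [0, 0, r]"
  | u where "u \<in> neighbors E v" "opt r v = [opt_weight r u + b + cost u v, opt_heavy r u + cost u v, r]"
  using token_opt[OF assms]
proof (cases rule: token.cases)
  case source
  then show ?thesis using that(1) by (simp add: opt_def)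
next
  case (step u w k)
  then have "opt r u = [w, k, r]"
    by (intro opt_pred[OF step(3,4)]) (simp add: opt_def)
  then show ?thesis using step that(2)[of u] by (simp add: opt_def)
qed

lemma opt_source: "r \<in> sources \<Longrightarrow> opt r r = [0, 0, r]"
  using opt_le[OF token.source, of r] by (simp add: opt_def)

text \<open>Strong induction on deadlines. The predecessor on the walk has an earlier deadline, so
  the optimal token arrives in time. If it were still unsent after round \<open>due r v\<close>, a
  smaller token would have been picked then. The source of that token has an earlier deadline at
  \<open>v\<close>, so its optimal token is already sent and is its only token in
  \<open>best\<close>: a contradiction.\<close>

lemma picked_by_due:
  assumes "r \<in> sources" "v \<in> V" "due r v < K"
  shows "(\<exists>p. (opt r v, p) \<in> known (state (due r v) v)) \<and>
         (\<exists>t\<le>due r v. \<exists>p. picked_at t v = Some (opt r v, p))"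
  using assms
proof (induction "due r v" arbitrary: r v rule: less_induct)
  case less
  note IH = less.hyps and r = less.prems(1) and v = less.prems(2) and K = less.prems(3)
  let ?t = "due r v"
  have known: "\<exists>p. (opt r v, p) \<in> known (state ?t v)"
    using r v
  proof (cases rule: opt_cases)
    case 1
    have "([0, 0, v], v) \<in> known (state 0 v)"
      using 1 r by (simp add: state_0 detection_init_def sources_def)
    then show ?thesis using known_mono[of 0 ?t v] K 1 by auto
  next
    case (2 u)
    have less: "due r u < ?t" using due_pred[OF r 2] .
    have u: "u \<in> V" using 2 neighbor_in_V by blast
    obtain t p where t: "t \<le> due r u" "picked_at t u = Some (opt r u, p)"
      using IH[OF less r u] less K by auto
    then have "(opt r v, u) \<in> known (state (Suc t) v)"
      using 2 less K by (subst known_Suc) (auto simp: opt_def)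
    then show ?thesis using known_mono[of "Suc t" ?t v] t less K by auto
  qed
  moreover have "\<exists>t\<le>?t. \<exists>p. picked_at t v = Some (opt r v, p)"
  proof (rule ccontr)
    assume neg: "\<not> ?thesis"
    have picked: "picked (picks (state ?t v)) = {x. \<exists>t<?t. \<exists>p. picked_at t v = Some (x, p)}"
      using K by (simp add: picked_state)
    then have "opt r v \<notin> picked (picks (state ?t v))" using neg by force
    moreover have "opt r v \<in> best (known (state ?t v))"
      using known opt_best K v by force
    ultimately have "picked_at ?t v \<noteq> None"
      by (auto simp: picked_at_def pick_def Let_def)
    then obtain x p where x: "picked_at ?t v = Some (x, p)" by auto
    have "x \<le> opt r v"
      using pick_Some(4)[OF x] \<open>opt r v \<notin> _\<close> \<open>opt r v \<in> _\<close> by blast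
    moreover have "x \<noteq> opt r v" using neg x by auto
    ultimately have lt: "x < opt r v" by simp
    obtain w k r' where tok: "token r' v w k" "x = [w, k, r']"
      using known_token[OF pick_Some(1)[OF x] _ v] K by auto
    have r': "r' \<in> sources" using token_in_V tok by blast
    have "opt r' v < opt r v" using opt_le[OF tok(1)] tok(2) lt by simp
    then have less: "due r' v < ?t" using due_less r' by blast
    from IH[OF less r' v] less K obtain p' s p'' where
      p': "(opt r' v, p') \<in> known (state (due r' v) v)" and
      s: "s \<le> due r' v" "picked_at s v = Some (opt r' v, p'')" by auto
    have "(opt r' v, p') \<in> known (state ?t v)"
      using p' known_mono[of "due r' v" ?t v] less K by auto
    then have "x = opt r' v"
      using best_opt[OF pick_Some(2)[OF x] _ v] tok K by auto
    then have "x \<in> picked (picks (state ?t v))"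
      using picked s le_less_trans[OF s(1) less] by blast
    then show False using pick_Some(3)[OF x] by blast
  qed
  ultimately show ?case by blast
qed

text \<open>The bandwidth has to be respected also if the sampled sources miss the deadline \<open>K\<close>.\<close>

lemma known_bounded:
  assumes "(x, u) \<in> known (state t v)" "t \<le> K" "v \<in> V"
  shows "\<exists>w k r. x = [w, k, r] \<and> w \<le> (b + 1) * t \<and> k \<le> t \<and> r \<in> V"
  using assms
proof (induction t arbitrary: x u v)
  case 0
  then show ?case by (auto simp: state_0 detection_init_def split: if_splits)
next
  case (Suc t)
  show ?case
  proof (cases "(x, u) \<in> known (state t v)")
    case True
    then obtain w k r where "x = [w, k, r] \<and> w \<le> (b + 1) * t \<and> k \<le> t \<and> r \<in> V"
      using Suc.IH[OF True] Suc.prems by auto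
    then show ?thesis by auto
  next
    case False
    then obtain y p where y: "u \<in> neighbors E v" "picked_at t u = Some (y, p)"
      "x = [y ! 0 + b + cost u v, y ! 1 + cost u v, y ! 2]"
      using Suc.prems by (auto simp: known_Suc)
    obtain w k r where "y = [w, k, r]" "w \<le> (b + 1) * t" "k \<le> t" "r \<in> V"
      using Suc.IH[OF pick_Some(1)[OF y(2)]] Suc.prems y neighbor_in_V by fastforce
    then show ?thesis using y by (auto simp: cost_def)
  qed
qed

lemma known_late: "K \<le> t \<Longrightarrow> known (state t v) = known (state K v) \<and> picks (state t v) = picks (state K v)"
  by (induction t rule: dec_induct) (auto simp: state_Suc detection_step_def)

end

context detection
begin

lemma picks_nth: "s < t \<Longrightarrow> t \<le> K \<Longrightarrow> picks (state t v) ! s = picked_at s v"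
  by (simp add: picks_state)

lemma detection_out_bounded:
  assumes "v \<in> V" "t < 2 * K" "x \<in> set (detection_out K b (S v) v t (state t v) u)"
  shows "x \<le> (b + 1) * K \<or> x \<in> V"
proof (cases "t < K")
  case True
  then obtain y p where y: "picked_at t v = Some (y, p)" "x \<in> set y"
    using assms(3) True by (cases "pick (state t v)") (auto simp: detection_out_def picked_at_def)
  obtain w k r where "y = [w, k, r]" "w \<le> (b + 1) * t" "k \<le> t" "r \<in> V"
    using known_bounded[OF pick_Some(1)[OF y(1)]] True assms(1) by auto
  moreover have "(b + 1) * t \<le> (b + 1) * K" using True by (intro mult_le_mono2) simp
  ultimately show ?thesis using y(2) True by auto
next
  case False
  then obtain r p where "mark K b (S v) v t (state t v) = Some (r, p)" "x = r"
    using assms(3) False by (cases "mark K b (S v) v t (state t v)") (auto simp: detection_out_def split: if_splits)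
  then obtain y where y: "picks (state t v) ! (2 * K - 1 - t) = Some (y, p)" "x = y ! 2"
    by (cases "picks (state t v) ! (2 * K - 1 - t)") (auto simp: mark_def split: if_splits)
  have "picks (state t v) = picks (state K v)" using known_late[of t v] False by simp
  then have "picked_at (2 * K - 1 - t) v = Some (y, p)"
    using y(1) False assms(2) picks_nth[of "2 * K - 1 - t" K v] by auto
  then show ?thesis
    using known_bounded[OF pick_Some(1)] y(2) False assms by fastforce
qed

lemma length_detection_out:
  assumes "v \<in> V"
  shows "length (detection_out K b (S v) v t (state t v) u) \<le> 3"
proof (cases "pick (state t v)")
  case (Some xp)
  then have "t < K \<longrightarrow> length (fst xp) = 3"
    using known_token[OF pick_Some(1), of t v "fst xp" "snd xp"] assms by (fastforce simp: picked_at_def)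
  then show ?thesis
    using Some by (cases "mark K b (S v) v t (state t v)") (auto simp: detection_out_def case_prod_beta)
next
  case None
  then show ?thesis
    by (cases "mark K b (S v) v t (state t v)") (auto simp: detection_out_def)
qed

end

section \<open>Lightest-path trees and the backward pass\<close>

locale timely_detection = detection +
  assumes timely: "r \<in> sources \<Longrightarrow> v \<in> V \<Longrightarrow> due r v < K"
begin

lemma picked_inj:
  assumes "picked_at t v = Some (x, p)" "picked_at t' v = Some (x, p')" "t < K" "t' < K"
  shows "t = t'"
proof -
  have "\<not> t < t'" if "picked_at t v = Some (x, p)" "picked_at t' v = Some (x, p')" "t' < K"
    for t t' p p'
  proof
    assume "t < t'"
    then have "x \<in> picked (picks (state t' v))"
      using that(1,3) by (auto simp: picked_state)
    then show False using pick_Some(3)[OF that(2)] by simp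
  qed
  then show ?thesis using assms by (metis nat_neq_iff)
qed

definition pick_time :: "nat \<Rightarrow> nat \<Rightarrow> nat" where
  "pick_time r v = (THE t. t < K \<and> (\<exists>p. picked_at t v = Some (opt r v, p)))"

definition up :: "nat \<Rightarrow> nat \<Rightarrow> nat" where
  "up r v = snd (the (picked_at (pick_time r v) v))"

lemma pick_timeI: "picked_at t v = Some (opt r v, p) \<Longrightarrow> t < K \<Longrightarrow> pick_time r v = t \<and> up r v = p"
proof -
  assume a: "picked_at t v = Some (opt r v, p)" "t < K"
  then have "pick_time r v = t"
    unfolding pick_time_def by (intro the_equality) (use picked_inj in blast)+
  then show ?thesis using a by (simp add: up_def)
qed

lemma pick_time:
  assumes "r \<in> sources" "v \<in> V"
  shows "pick_time r v < K" "picked_at (pick_time r v) v = Some (opt r v, up r v)"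
proof -
  obtain t p where "t \<le> due r v" "picked_at t v = Some (opt r v, p)"
    using picked_by_due[OF assms timely[OF assms]] by blast
  then show "pick_time r v < K" "picked_at (pick_time r v) v = Some (opt r v, up r v)"
    using pick_timeI[of t v r p] timely[OF assms] by auto
qed

lemma opt_known: "r \<in> sources \<Longrightarrow> v \<in> V \<Longrightarrow> \<exists>p. (opt r v, p) \<in> known (state K v)"
  using pick_Some(1)[OF pick_time(2)[of r v]] pick_time(1)[of r v] known_mono[of "pick_time r v" K v]
  by auto

text \<open>The token picked for \<open>r\<close> came from \<open>up r v\<close>, where it was
  optimal as well and had been picked strictly earlier. The strict decrease of
  \<open>pick_time\<close> lets the reversed schedule treat children before parents.\<close>

lemma up_step:
  assumes "r \<in> sources" "v \<in> V"
  shows "up r v = v \<longleftrightarrow> v = r"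
    and "v \<noteq> r \<Longrightarrow> up r v \<in> neighbors E v \<and> pick_time r (up r v) < pick_time r v \<and>
      opt r v = [opt_weight r (up r v) + b + cost (up r v) v, opt_heavy r (up r v) + cost (up r v) v, r]"
proof -
  note p = pick_time[OF assms]
  consider "up r v = v" "v = r"
    | s w k p where "up r v \<in> neighbors E v" "s < pick_time r v" "token r (up r v) w k"
      "picked_at s (up r v) = Some ([w, k, r], p)"
      "opt r v = [w + b + cost (up r v) v, k + cost (up r v) v, r]"
    using known_cases[OF pick_Some(1)[OF p(2)]] p(1) assms(2) by (auto simp: opt_def)
  then have "(up r v = v \<and> v = r) \<or> (up r v \<in> neighbors E v \<and> pick_time r (up r v) < pick_time r v \<and>
      opt r v = [opt_weight r (up r v) + b + cost (up r v) v, opt_heavy r (up r v) + cost (up r v) v, r])"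
  proof cases
    case 2
    have "opt r (up r v) = [w, k, r]" using opt_pred 2 by blast
    then show ?thesis using 2 pick_timeI[of s "up r v" r p] p(1) by (auto simp: opt_def)
  qed auto
  moreover have "v \<noteq> r"
    if "opt r v = [opt_weight r (up r v) + b + cost (up r v) v, opt_heavy r (up r v) + cost (up r v) v, r]"
    using that opt_source[OF assms(1)] b_pos by auto
  ultimately show "up r v = v \<longleftrightarrow> v = r"
    and "v \<noteq> r \<Longrightarrow> up r v \<in> neighbors E v \<and> pick_time r (up r v) < pick_time r v \<and>
      opt r v = [opt_weight r (up r v) + b + cost (up r v) v, opt_heavy r (up r v) + cost (up r v) v, r]"
    using not_neighbor_self by metis+
qed

lemma up_in_V: "r \<in> sources \<Longrightarrow> v \<in> V \<Longrightarrow> up r v \<in> V"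
  using up_step[of r v] neighbor_in_V(1)[of "up r v" v] by (cases "v = r") auto

definition mark_at :: "nat \<Rightarrow> nat \<Rightarrow> (nat \<times> nat) option" where
  "mark_at t v = mark K b (S v) v t (state t v)"

lemma mark_at_iff:
  assumes "v \<in> V" "K \<le> t" "t < 2 * K"
  shows "mark_at t v = Some (r, p) \<longleftrightarrow> r \<in> sources \<and> t + pick_time r v = 2 * K - 1 \<and> v \<noteq> r \<and> p = up r v \<and>
    (r \<in> marks (state t v) \<or> S v \<and> opt_heavy r v \<le> 6 * b)"
proof -
  have eq: "picks (state t v) ! (2 * K - 1 - t) = picked_at (2 * K - 1 - t) v"
    "known (state t v) = known (state K v)"
    using known_late[of t v] assms picks_nth[of "2 * K - 1 - t" K v] by auto
  show ?thesis
  proof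
    assume "mark_at t v = Some (r, p)"
    then obtain x where x: "picked_at (2 * K - 1 - t) v = Some (x, p)" "x \<in> best (known (state K v))"
      "p \<noteq> v" "r = x ! 2" "x ! 2 \<in> marks (state t v) \<or> S v \<and> x ! 1 \<le> 6 * b"
      using eq by (cases "picked_at (2 * K - 1 - t) v") (auto simp: mark_at_def mark_def split: if_splits)
    have lt: "2 * K - 1 - t < K" using assms by simp
    obtain w k r' where "token r' v w k" "x = [w, k, r']"
      using known_token[OF pick_Some(1)[OF x(1)]] assms lt by auto
    then have r: "r \<in> sources" using token_in_V x(4) by simp
    then have xo: "x = opt r v" using best_opt[OF x(2)] opt_known assms(1) x(4) by blast
    then show "r \<in> sources \<and> t + pick_time r v = 2 * K - 1 \<and> v \<noteq> r \<and> p = up r v \<and>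
        (r \<in> marks (state t v) \<or> S v \<and> opt_heavy r v \<le> 6 * b)"
      using pick_timeI[of "2 * K - 1 - t" v r p] x(1,3,5)[unfolded xo] lt r up_step(1)[OF r assms(1)] assms
      by auto
  next
    assume a: "r \<in> sources \<and> t + pick_time r v = 2 * K - 1 \<and> v \<noteq> r \<and> p = up r v \<and>
        (r \<in> marks (state t v) \<or> S v \<and> opt_heavy r v \<le> 6 * b)"
    then have "2 * K - 1 - t = pick_time r v" by (elim conjE) linarith
    moreover have "opt r v \<in> best (known (state K v))"
      using opt_best[OF _ order_refl assms(1)] opt_known[OF _ assms(1), of r] a by auto
    ultimately show "mark_at t v = Some (r, p)"
      using a eq pick_time[of r v] up_step(1)[of r v] assms(1) by (auto simp: mark_at_def mark_def)
  qed
qed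

lemma marks_K: "t \<le> K \<Longrightarrow> marks (state t v) = {} \<and> links (state t v) = {}"
  by (induction t) (auto simp: state_0 state_Suc detection_init_def detection_step_def)

lemma mark_at_neighbor:
  assumes "v \<in> V" "K \<le> t" "t < 2 * K" "mark_at t v = Some (r, p)"
  shows "p \<in> neighbors E v" "v \<in> neighbors E p"
proof -
  have "r \<in> sources" "v \<noteq> r" "p = up r v"
    using mark_at_iff[OF assms(1-3)] assms(4) by auto
  then show "p \<in> neighbors E v" using up_step(2) assms(1) by blast
  then show "v \<in> neighbors E p" using neighbors_sym by blast
qed

lemma backward_out:
  assumes "u \<in> V" "K \<le> t" "t < 2 * K"
  shows "(if u \<in> neighbors E v then detection_out K b (S u) u t (state t u) v else []) =
    (case mark_at t u of None \<Rightarrow> [] | Some (r, p) \<Rightarrow> if p = v then [r] else [])"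
  using mark_at_neighbor[OF assms] assms(2)
  by (cases "mark_at t u") (auto simp: detection_out_def mark_at_def)

lemma marks_links_Suc:
  assumes "v \<in> V" "K \<le> t" "t < 2 * K"
  shows "marks (state (Suc t) v) = marks (state t v) \<union> {r. \<exists>u\<in>V. mark_at t u = Some (r, v)}"
    and "links (state (Suc t) v) = links (state t v) \<union> {u \<in> V. \<exists>r. mark_at t u = Some (r, v)} \<union>
      {p. \<exists>r. mark_at t v = Some (r, p)}"
proof -
  let ?m = "\<lambda>u. if u \<in> neighbors E v then detection_out K b (S u) u t (state t u) v else []"
  have m: "u \<in> neighbors E v \<and> ?m u \<noteq> [] \<and> r = hd (?m u) \<longleftrightarrow> u \<in> V \<and> mark_at t u = Some (r, v)" for u r
  proof (cases "u \<in> V")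
    case True
    show ?thesis
      unfolding backward_out[OF True assms(2,3)]
      using mark_at_neighbor[OF True assms(2,3)] True
      by (cases "mark_at t u") (auto split: if_splits)
  qed (use neighbor_in_V in auto)
  have "{hd (?m u) |u. u \<in> neighbors E v \<and> ?m u \<noteq> []} = {r. \<exists>u\<in>V. mark_at t u = Some (r, v)}"
    using m by blast
  then show "marks (state (Suc t) v) = marks (state t v) \<union> {r. \<exists>u\<in>V. mark_at t u = Some (r, v)}"
    using assms(2) by (simp add: state_Suc detection_step_def)
  have "{u \<in> neighbors E v. ?m u \<noteq> []} = {u \<in> V. \<exists>r. mark_at t u = Some (r, v)}"
    using m by blast
  then show "links (state (Suc t) v) = links (state t v) \<union> {u \<in> V. \<exists>r. mark_at t u = Some (r, v)} \<union>
      {p. \<exists>r. mark_at t v = Some (r, p)}"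
    using assms(2)
    by (cases "mark_at t v") (auto simp add: state_Suc detection_step_def mark_at_def)
qed

text \<open>Specification of the backward pass without timing: the union of those tree paths from
  centers to \<open>r\<close> that have at most \<open>6 * b\<close> heavy edges.\<close>

inductive marked :: "nat \<Rightarrow> nat \<Rightarrow> bool" where
  start: "r \<in> sources \<Longrightarrow> v \<in> V \<Longrightarrow> S v \<Longrightarrow> opt_heavy r v \<le> 6 * b \<Longrightarrow> marked r v"
| up: "marked r v \<Longrightarrow> v \<noteq> r \<Longrightarrow> marked r (up r v)"

lemma marked_in_V: "marked r v \<Longrightarrow> r \<in> sources \<and> v \<in> V"
  by (induction rule: marked.induct) (auto simp: up_in_V)

lemma marks_sound:
  assumes "t \<le> 2 * K" "v \<in> V" "r \<in> marks (state t v)"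
  shows "\<exists>u. marked r u \<and> u \<noteq> r \<and> up r u = v"
  using assms
proof (induction t arbitrary: v)
  case (Suc t)
  show ?case
  proof (cases "r \<in> marks (state t v)")
    case False
    then have t: "K \<le> t"
      using Suc.prems marks_K[of "Suc t" v] not_less_eq_eq by blast
    then obtain u where u: "u \<in> V" "mark_at t u = Some (r, v)"
      using False Suc.prems marks_links_Suc(1)[of v t] by auto
    then have "r \<in> sources" "u \<noteq> r" "v = up r u" "r \<in> marks (state t u) \<or> S u \<and> opt_heavy r u \<le> 6 * b"
      using mark_at_iff[OF u(1) t, of r v] Suc.prems by auto
    then show ?thesis
      using Suc.IH[of u] Suc.prems u(1) marked.up marked.start by (metis Suc_leD)
  qed (use Suc in auto)
qed (simp add: marks_K)

lemma marks_mono: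
  assumes "K \<le> t" "t \<le> t'" "t' \<le> 2 * K" "v \<in> V"
  shows "marks (state t v) \<subseteq> marks (state t' v)"
  using assms(2,3) by (induction t' rule: dec_induct) (use assms in \<open>auto simp: marks_links_Suc\<close>)

text \<open>In the reversed schedule the slot of a child is strictly before that of its parent, so
  the mark has arrived when the turn of the parent comes.\<close>

lemma marks_complete:
  "marked r v \<Longrightarrow> v \<noteq> r \<Longrightarrow> mark_at (2 * K - 1 - pick_time r v) v = Some (r, up r v)"
proof (induction rule: marked.induct)
  case (start r v)
  then show ?case using pick_time(1)[of r v] by (subst mark_at_iff) auto
next
  case (up r v)
  let ?u = "up r v"
  have rv: "r \<in> sources" "v \<in> V" "?u \<in> V" using marked_in_V[OF up.hyps(1)] up_in_V by auto
  have t: "pick_time r ?u < pick_time r v" "pick_time r v < K"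
    using up_step(2) rv up.hyps pick_time by auto
  let ?t = "2 * K - 1 - pick_time r v" and ?t' = "2 * K - 1 - pick_time r ?u"
  have "mark_at ?t v = Some (r, ?u)" using up by blast
  then have "r \<in> marks (state (Suc ?t) ?u)"
    using marks_links_Suc(1)[OF rv(3), of ?t] t rv(2) by auto
  moreover have "marks (state (Suc ?t) ?u) \<subseteq> marks (state ?t' ?u)"
    using t rv by (intro marks_mono) auto
  ultimately show ?case
    using rv t up.prems by (subst mark_at_iff) auto
qed

lemma mark_at_marked:
  assumes "v \<in> V" "K \<le> t" "t < 2 * K" "mark_at t v = Some (r, p)"
  shows "marked r v \<and> v \<noteq> r \<and> p = up r v"
proof -
  have a: "r \<in> sources" "v \<noteq> r" "p = up r v" "r \<in> marks (state t v) \<or> S v \<and> opt_heavy r v \<le> 6 * b"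
    using mark_at_iff[OF assms(1-3), of r p] assms(4) by auto
  moreover have "marked r v" if "r \<in> marks (state t v)"
    using marks_sound[OF _ assms(1) that] assms(3) marked.up by (metis less_imp_le_nat)
  ultimately show ?thesis using marked.start assms(1) by blast
qed

text \<open>The description is symmetric in the endpoints of a tree edge, so both of them learn that
  it is kept.\<close>

lemma links_eq:
  assumes "v \<in> V"
  shows "links (state (2 * K) v) =
    {u. \<exists>r. marked r v \<and> v \<noteq> r \<and> u = up r v \<or> marked r u \<and> u \<noteq> r \<and> v = up r u}"
proof -
  have "K + k \<le> 2 * K \<Longrightarrow> links (state (K + k) v) =
      {u \<in> V. \<exists>s r. K \<le> s \<and> s < K + k \<and> mark_at s u = Some (r, v)} \<union>
      {p. \<exists>s r. K \<le> s \<and> s < K + k \<and> mark_at s v = Some (r, p)}" for k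
  proof (induction k)
    case (Suc k)
    have "links (state (K + Suc k) v) = links (state (K + k) v) \<union>
        {u \<in> V. \<exists>r. mark_at (K + k) u = Some (r, v)} \<union> {p. \<exists>r. mark_at (K + k) v = Some (r, p)}"
      using marks_links_Suc(2)[OF assms, of "K + k"] Suc.prems by simp
    moreover have "(\<exists>s r. K \<le> s \<and> s < K + Suc k \<and> P s r) \<longleftrightarrow>
        (\<exists>s r. K \<le> s \<and> s < K + k \<and> P s r) \<or> (\<exists>r. P (K + k) r)" for P :: "nat \<Rightarrow> nat \<Rightarrow> bool"
      by (metis add_Suc_right le_add1 less_Suc_eq)
    ultimately show ?case using Suc by auto
  qed (simp add: marks_K)
  from this[of K] have links: "links (state (2 * K) v) =
      {u \<in> V. \<exists>s r. K \<le> s \<and> s < 2 * K \<and> mark_at s u = Some (r, v)} \<union>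
      {p. \<exists>s r. K \<le> s \<and> s < 2 * K \<and> mark_at s v = Some (r, p)}"
    by (simp add: mult_2)
  have iff: "(\<exists>s r. K \<le> s \<and> s < 2 * K \<and> mark_at s u = Some (r, p)) \<longleftrightarrow>
      (\<exists>r. marked r u \<and> u \<noteq> r \<and> p = up r u)" if u: "u \<in> V" for u p
  proof
    assume "\<exists>r. marked r u \<and> u \<noteq> r \<and> p = up r u"
    then obtain r where r: "marked r u" "u \<noteq> r" "p = up r u" by blast
    have "pick_time r u < K" using pick_time marked_in_V[OF r(1)] by blast
    then show "\<exists>s r. K \<le> s \<and> s < 2 * K \<and> mark_at s u = Some (r, p)"
      using marks_complete[OF r(1,2)] r(3) by (intro exI[of _ "2 * K - 1 - pick_time r u"] exI[of _ r]) auto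
  qed (use mark_at_marked[OF u] in blast)
  have "{u \<in> V. \<exists>s r. K \<le> s \<and> s < 2 * K \<and> mark_at s u = Some (r, v)} =
      {u \<in> V. \<exists>r. marked r u \<and> u \<noteq> r \<and> v = up r u}"
    by (intro Collect_cong conj_cong refl iff)
  also have "\<dots> = {u. \<exists>r. marked r u \<and> u \<noteq> r \<and> v = up r u}"
    using marked_in_V by blast
  finally show ?thesis
    unfolding links iff[OF assms] by auto
qed

lemma opt_weight_up:
  "r \<in> sources \<Longrightarrow> v \<in> V \<Longrightarrow> v \<noteq> r \<Longrightarrow> opt_weight r v = opt_weight r (up r v) + b + cost (up r v) v"
  "r \<in> sources \<Longrightarrow> v \<in> V \<Longrightarrow> v \<noteq> r \<Longrightarrow> opt_heavy r v = opt_heavy r (up r v) + cost (up r v) v"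
  using up_step(2)[of r v] by (simp_all add: opt_def)

lemma marked_walk:
  assumes "marked r v" "\<And>u. marked r u \<Longrightarrow> u \<noteq> r \<Longrightarrow> {u, up r u} \<in> H"
  shows "\<exists>l. (v, r) \<in> arcs H ^^ l \<and> opt_weight r v = b * l + opt_heavy r v"
  using assms(1)
proof (induction "opt_weight r v" arbitrary: v rule: less_induct)
  case less
  have rv: "r \<in> sources" "v \<in> V" using marked_in_V[OF less.prems] by auto
  show ?case
  proof (cases "v = r")
    case True
    then show ?thesis using opt_source[OF rv(1)] by (intro exI[of _ 0]) (simp add: opt_def)
  next
    case False
    then obtain l where l: "(up r v, r) \<in> arcs H ^^ l"
      "opt_weight r (up r v) = b * l + opt_heavy r (up r v)"
      using less.hyps[of "up r v"] opt_weight_up[OF rv] b_pos marked.up[OF less.prems] by auto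
    have "(v, up r v) \<in> arcs H"
      using assms(2)[OF less.prems False] by (simp add: arcs_def)
    then have "(v, r) \<in> arcs H ^^ Suc l" using l(1) relpow_Suc_I2 by metis
    then show ?thesis using l(2) opt_weight_up[OF rv False] by (intro exI[of _ "Suc l"]) auto
  qed
qed

section \<open>Counting the heavy edges on kept tree paths\<close>

inductive chain :: "nat \<Rightarrow> nat \<Rightarrow> nat \<Rightarrow> bool" for r v where
  refl: "chain r v v"
| up: "chain r v u \<Longrightarrow> u \<noteq> r \<Longrightarrow> chain r v (up r u)"

definition chain_edges :: "nat \<Rightarrow> nat \<Rightarrow> nat set set" where
  "chain_edges r v = {{u, up r u} |u. chain r v u \<and> u \<noteq> r \<and> heavy u \<and> heavy (up r u)}"

lemma chain_up: "chain r v u \<Longrightarrow> u = v \<or> v \<noteq> r \<and> chain r (up r v) u"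
  by (induction rule: chain.induct) (auto intro: chain.intros)

lemma card_chain_edges:
  assumes "r \<in> sources" "v \<in> V"
  shows "finite (chain_edges r v) \<and> card (chain_edges r v) \<le> opt_heavy r v"
  using assms(2)
proof (induction "opt_weight r v" arbitrary: v rule: less_induct)
  case less
  show ?case
  proof (cases "v = r")
    case True
    then have "chain_edges r v = {}" by (auto simp: chain_edges_def dest: chain_up)
    then show ?thesis by simp
  next
    case False
    let ?F = "if heavy v \<and> heavy (up r v) then {{v, up r v}} else {}"
    have IH: "finite (chain_edges r (up r v)) \<and> card (chain_edges r (up r v)) \<le> opt_heavy r (up r v)"
      using less.hyps[of "up r v"] opt_weight_up[OF assms(1) less.prems False] b_pos
        up_in_V[OF assms(1) less.prems] by simp
    have "chain_edges r v \<subseteq> ?F \<union> chain_edges r (up r v)"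
      by (auto simp: chain_edges_def dest: chain_up)
    moreover have fin: "finite (?F \<union> chain_edges r (up r v))" using IH by simp
    ultimately have "card (chain_edges r v) \<le> card (?F \<union> chain_edges r (up r v))"
      by (rule card_mono[rotated])
    also have "\<dots> \<le> card ?F + card (chain_edges r (up r v))" by (rule card_Un_le)
    also have "\<dots> \<le> cost (up r v) v + opt_heavy r (up r v)" using IH by (auto simp: cost_def)
    finally show ?thesis
      using opt_weight_up(2)[OF assms(1) less.prems False] fin
        finite_subset[OF \<open>chain_edges r v \<subseteq> _\<close>] by simp
  qed
qed

lemma marked_chain: "marked r u \<Longrightarrow> \<exists>v\<in>V. S v \<and> opt_heavy r v \<le> 6 * b \<and> chain r v u"
  by (induction rule: marked.induct) (auto intro: chain.intros)

text \<open>Each edge is charged to a pair of a source and a center whose tree path contains it and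
  has at most \<open>6 * b\<close> heavy edges. Light edges need no charge, since all of them are
  kept anyway.\<close>

lemma card_marked_heavy:
  fixes F defines "F \<equiv> {{u, up r u} |r u. marked r u \<and> u \<noteq> r \<and> heavy u \<and> heavy (up r u)}"
  shows "finite F" "card F \<le> card sources * card {v \<in> V. S v} * (6 * b)"
proof -
  define I where "I = sources \<times> {v \<in> V. S v}"
  define Q where "Q = {(r, v) \<in> I. opt_heavy r v \<le> 6 * b}"
  have fin: "finite I" using finite_sources finV by (simp add: I_def)
  have "Q \<subseteq> I" by (auto simp: Q_def)
  then have finQ: "finite Q" using fin finite_subset by blast
  have sub: "F \<subseteq> (\<Union>(r, v)\<in>Q. chain_edges r v)"
  proof
    fix e assume "e \<in> F"
    then obtain r u where e: "e = {u, up r u}" "marked r u" "u \<noteq> r" "heavy u" "heavy (up r u)"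
      unfolding F_def by blast
    obtain v where v: "v \<in> V" "S v" "opt_heavy r v \<le> 6 * b" "chain r v u"
      using marked_chain[OF e(2)] by blast
    have "(r, v) \<in> Q" using v marked_in_V[OF e(2)] by (simp add: Q_def I_def)
    moreover have "e \<in> chain_edges r v" unfolding chain_edges_def using e v(4) by blast
    ultimately show "e \<in> (\<Union>(r, v)\<in>Q. chain_edges r v)" by blast
  qed
  have each: "finite (chain_edges r v) \<and> card (chain_edges r v) \<le> 6 * b" if "(r, v) \<in> Q" for r v
    using that card_chain_edges[of r v] by (auto simp: Q_def I_def)
  have finU: "finite (\<Union>(r, v)\<in>Q. chain_edges r v)" using each finQ by auto
  then show "finite F" using sub finite_subset by blast
  have "card F \<le> card (\<Union>(r, v)\<in>Q. chain_edges r v)" using card_mono[OF finU sub] .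
  also have "\<dots> \<le> (\<Sum>(r, v)\<in>Q. card (chain_edges r v))"
    using card_UN_le[OF finQ, of "\<lambda>(r, v). chain_edges r v"] by (simp add: case_prod_beta)
  also have "\<dots> \<le> card Q * (6 * b)"
    using sum_bounded_above[of Q "\<lambda>(r, v). card (chain_edges r v)" "6 * b"] each by auto
  also have "\<dots> \<le> card I * (6 * b)"
    using fin \<open>Q \<subseteq> I\<close> by (intro mult_le_mono1 card_mono)
  also have "card I = card sources * card {v \<in> V. S v}"
    by (simp add: I_def card_cartesian_product)
  finally show "card F \<le> card sources * card {v \<in> V. S v} * (6 * b)" .
qed

end

section \<open>The spanner algorithm\<close>

text \<open>A node is heavy if its degree is at least \<open>heavy_degree M n\<close>. The nodes sampled at level \<open>i\<close>, which
  are those whose random number is at least \<open>threshold n i\<close>, serve paths with about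
  \<open>2 ^ (scale n * i)\<close> to \<open>2 ^ (scale n * (i + 1))\<close> heavy edges; those of level \<open>0\<close> are also the
  cluster centers.\<close>

definition theta :: "nat \<Rightarrow> nat" where
  "theta n = (GREATEST \<theta>. 2 ^ (11 * \<theta>) * floorlog 2 n \<le> n ^ 4)"

definition scale :: "nat \<Rightarrow> nat" where
  "scale n = (LEAST g. n \<le> 2 ^ (11 * g))"

definition heavy_degree :: "nat \<Rightarrow> nat \<Rightarrow> nat" where
  "heavy_degree M n = M * floorlog 2 n * 2 ^ theta n"

definition threshold :: "nat \<Rightarrow> nat \<Rightarrow> nat" where
  "threshold n i = theta n + scale n * i"

definition base_weight :: "nat \<Rightarrow> nat \<Rightarrow> nat" where
  "base_weight n i = 2 ^ (scale n * (i + 1))"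

text \<open>Four times the expected size of level \<open>0\<close> plus a logarithmic deviation. The
  division loses less than \<open>1\<close>, for which the summand \<open>4\<close>
  compensates.\<close>

definition sample_bound :: "nat \<Rightarrow> nat \<Rightarrow> nat" where
  "sample_bound M n = 4 * (n div 2 ^ theta n) + 4 + M * floorlog 2 n"

text \<open>The \<open>loc_\<close> functions are what a single node reconstructs from its own view;
  each is later identified with the corresponding global quantity.\<close>

definition loc_setup :: "nat \<Rightarrow> nat set \<Rightarrow> inputs \<Rightarrow> nat \<Rightarrow> nat list \<times> nat" where
  "loc_setup v N I t = local_run (setup_init v) (setup_step N) I 0 t"

definition loc_stop :: "nat \<Rightarrow> nat set \<Rightarrow> inputs \<Rightarrow> nat \<Rightarrow> bool" where
  "loc_stop v N I t \<longleftrightarrow> (\<exists>j. t = 4 ^ Suc j) \<and> snd (loc_setup v N I t) \<noteq> 0"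

definition loc_T0 :: "nat \<Rightarrow> nat set \<Rightarrow> inputs \<Rightarrow> nat" where
  "loc_T0 v N I = (LEAST t. loc_stop v N I t)"

definition loc_depth :: "nat \<Rightarrow> nat set \<Rightarrow> inputs \<Rightarrow> nat" where
  "loc_depth v N I = fst (loc_setup v N I (loc_T0 v N I)) ! 1"

text \<open>In the last setup round the message of every neighbor carries its final depth at
  position \<open>1\<close>.\<close>

definition loc_parent :: "nat \<Rightarrow> nat set \<Rightarrow> inputs \<Rightarrow> nat" where
  "loc_parent v N I =
     (LEAST u. u \<in> N \<and> Suc (I (loc_T0 v N I - 1) u ! 1) = loc_depth v N I)"

definition loc_census :: "nat \<Rightarrow> nat set \<Rightarrow> inputs \<Rightarrow> nat \<Rightarrow> nat \<times> nat" where
  "loc_census v N I t =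
     local_run (Suc 0, 0) (census_step (loc_T0 v N I) N) I (loc_T0 v N I) t"

definition loc_size :: "nat \<Rightarrow> nat set \<Rightarrow> inputs \<Rightarrow> nat" where
  "loc_size v N I = census_value (loc_depth v N I) (loc_census v N I (2 * loc_T0 v N I))"

definition loc_heavy :: "nat \<Rightarrow> nat \<Rightarrow> nat set \<Rightarrow> inputs \<Rightarrow> bool" where
  "loc_heavy M v N I \<longleftrightarrow> heavy_degree M (loc_size v N I) \<le> card N"

definition loc_flag :: "nat \<Rightarrow> nat \<Rightarrow> nat set \<Rightarrow> inputs \<Rightarrow> nat set" where
  "loc_flag i v N I = {u \<in> N. I (3 * loc_T0 v N I) u ! i = 1}"

definition loc_center :: "nat \<Rightarrow> nat \<Rightarrow> nat set \<Rightarrow> inputs \<Rightarrow> nat option" where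
  "loc_center M v N I = (if loc_heavy M v N I \<and> loc_flag 0 v N I \<noteq> {}
     then Some (Min (loc_flag 0 v N I)) else None)"

definition loc_K :: "nat \<Rightarrow> nat \<Rightarrow> nat set \<Rightarrow> inputs \<Rightarrow> nat" where
  "loc_K M v N I = loc_T0 v N I + sample_bound M (loc_size v N I)"

definition loc_detection :: "nat \<Rightarrow> nat \<Rightarrow> nat set \<Rightarrow> nat \<Rightarrow> inputs \<Rightarrow> nat \<Rightarrow> nat \<Rightarrow> detection_state" where
  "loc_detection M v N x I i t = (let n = loc_size v N I; K = loc_K M v N I in
     local_run (detection_init (threshold n i \<le> x) v)
       (detection_step K (base_weight n i) (threshold n 0 \<le> x) N
          (\<lambda>u. if loc_heavy M v N I \<and> u \<in> loc_flag (Suc 0) v N I then 1 else 0) v)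
       I (3 * loc_T0 v N I + 2 + 2 * K * i) t)"

text \<open>Schedule: setup up to \<open>T\<close>, census up to \<open>3 * T\<close>, one round for
  the sampling and heaviness bits, one for notifying centers, then blocks of \<open>2 * K\<close>
  rounds, one per level.\<close>

definition spanner_out :: "nat \<Rightarrow> (nat \<Rightarrow> nat list) local_fun" where
  "spanner_out M v N x I t u =
     (if \<not> (\<exists>s\<le>t. loc_stop v N I s) then setup_out t (loc_setup v N I t)
      else let T = loc_T0 v N I; n = loc_size v N I; K = loc_K M v N I;
               i = (t - (3 * T + 2)) div (2 * K); \<tau> = (t - (3 * T + 2)) mod (2 * K) in
        if t < 3 * T
          then census_out T (loc_depth v N I) (loc_parent v N I) (t - T) (loc_census v N I (t - T)) u
        else if t = 3 * T
          then [if threshold n 0 \<le> x then 1 else 0, if loc_heavy M v N I then 1 else 0]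
        else if t = 3 * T + 1
          then (if loc_center M v N I = Some u then [1] else [])
        else detection_out K (base_weight n i) (threshold n 0 \<le> x) v \<tau> (loc_detection M v N x I i \<tau>) u)"

text \<open>In a connected graph a node without neighbors is alone, so it can stop at once. The
  \<open>14\<close> is seven blocks of \<open>2 * K\<close> rounds.\<close>

definition spanner_result :: "nat \<Rightarrow> nat set option local_fun" where
  "spanner_result M v N x I t =
     (if N = {} then Some {}
      else if \<not> (\<exists>s\<le>t. loc_stop v N I s) then None
      else if t < 3 * loc_T0 v N I + 2 + 14 * loc_K M v N I then None
      else Some {u \<in> N. \<not> loc_heavy M v N I \<or> u \<notin> loc_flag (Suc 0) v N I \<or> loc_center M v N I = Some u \<or>
                   I (3 * loc_T0 v N I + 1) u \<noteq> [] \<or>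
                   (\<exists>i<7. u \<in> links (loc_detection M v N x I i (2 * loc_K M v N I)))})"

definition spanner_algorithm :: "nat \<Rightarrow> nat congest_algorithm" where
  "spanner_algorithm M = view_algorithm (spanner_out M) (spanner_result M)"

lemma spanner_out_setup:
  "\<not> (\<exists>s\<le>t. loc_stop v N I s) \<Longrightarrow> spanner_out M v N x I t u = setup_out t (loc_setup v N I t)"
  unfolding spanner_out_def by (rule if_P)

lemma spanner_out_after_setup:
  assumes "\<exists>s\<le>t. loc_stop v N I s" "loc_T0 v N I = T"
  shows "t < 3 * T \<Longrightarrow> spanner_out M v N x I t u =
      census_out T (loc_depth v N I) (loc_parent v N I) (t - T) (loc_census v N I (t - T)) u"
    and "t = 3 * T \<Longrightarrow> spanner_out M v N x I t u =
      [if threshold (loc_size v N I) 0 \<le> x then 1 else 0, if loc_heavy M v N I then 1 else 0]"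
    and "t = 3 * T + 1 \<Longrightarrow> spanner_out M v N x I t u = (if loc_center M v N I = Some u then [1] else [])"
    and "t = 3 * T + 2 + 2 * K * i + \<tau> \<Longrightarrow> loc_K M v N I = K \<Longrightarrow> \<tau> < 2 * K \<Longrightarrow> loc_size v N I = n \<Longrightarrow>
      spanner_out M v N x I t u = detection_out K (base_weight n i) (threshold n 0 \<le> x) v \<tau>
        (loc_detection M v N x I i \<tau>) u"
  using assms by (auto simp: spanner_out_def Let_def)

lemma detection_step_cong:
  assumes "\<And>u. u \<in> N \<Longrightarrow> e u = e' u"
  shows "detection_step K b S N e = detection_step K b S N e'"
proof -
  have "{([m u ! 0 + b + e u, m u ! 1 + e u, m u ! 2], u) |u. u \<in> N \<and> m u \<noteq> []} =
        {([m u ! 0 + b + e' u, m u ! 1 + e' u, m u ! 2], u) |u. u \<in> N \<and> m u \<noteq> []}" for m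
    using assms by auto
  then show ?thesis by (intro ext) (simp add: detection_step_def)
qed

declare received.simps [simp del]

locale spanner_run = cgraph +
  fixes M :: nat and X :: "nat \<Rightarrow> nat"
begin

abbreviation n :: nat where "n \<equiv> card V"

abbreviation msg :: "nat \<Rightarrow> nat \<Rightarrow> nat \<Rightarrow> nat list" where
  "msg \<equiv> sent (spanner_out M) E X"

abbreviation ins :: "nat \<Rightarrow> nat \<Rightarrow> inputs" where
  "ins \<equiv> received (spanner_out M) E X"

abbreviation N :: "nat \<Rightarrow> nat set" where "N \<equiv> neighbors E"

lemma ins_eq: "u \<in> N v \<Longrightarrow> t < T \<Longrightarrow> ins T v t u = msg t u v"
  by (simp add: received_eq)

text \<open>Reconstruction up to time \<open>t\<close> presupposes the form of the messages sent
  before \<open>t\<close>, while the message of round \<open>t\<close> presupposes the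
  reconstruction. The primed version takes the former as a hypothesis and feeds the strong induction
  over rounds; census and detection follow the same pattern.\<close>

lemma loc_setup_eq':
  assumes "\<And>s v u. s < t \<Longrightarrow> v \<in> V \<Longrightarrow> msg s v u = setup_out s (setup_state s v)"
    and "s \<le> t" "s \<le> T" "v \<in> V"
  shows "loc_setup v (N v) (ins T v) s = setup_state s v"
  unfolding loc_setup_def setup_state_def
  by (rule local_run_eq_global_run[where V = V and K = t])
     (use assms neighbors_subset in \<open>auto simp flip: setup_state_def\<close>)

lemma stop_setup_state:
  assumes "v \<in> V"
  shows "(\<exists>j. t = 4 ^ Suc j) \<and> snd (setup_state t v) \<noteq> 0 \<longleftrightarrow> (\<exists>j. t = 4 ^ Suc j) \<and> T0 \<le> t"
  using setup_test[OF assms] covers_iff by auto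

lemma msg_setup: "t < T0 \<Longrightarrow> v \<in> V \<Longrightarrow> msg t v u = setup_out t (setup_state t v)"
proof (induction t arbitrary: v u rule: less_induct)
  case (less t)
  have eq: "loc_setup v (N v) (ins t v) s = setup_state s v" if "s \<le> t" for s
    using less that by (intro loc_setup_eq'[of t]) auto
  then have "\<not> loc_stop v (N v) (ins t v) s" if "s \<le> t" for s
    using stop_setup_state[OF less.prems(2), of s] less.prems(1) that by (auto simp: loc_stop_def)
  then show ?case using eq[of t] by (subst sent_def, subst spanner_out_setup) auto
qed

lemma loc_setup_eq: "v \<in> V \<Longrightarrow> t \<le> T0 \<Longrightarrow> t \<le> T \<Longrightarrow> loc_setup v (N v) (ins T v) t = setup_state t v"
  using msg_setup by (intro loc_setup_eq'[of T0]) auto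

lemma loc_stop_iff:
  "v \<in> V \<Longrightarrow> t \<le> T0 \<Longrightarrow> t \<le> T \<Longrightarrow> loc_stop v (N v) (ins T v) t \<longleftrightarrow> t = T0"
  using stop_setup_state[of v t] by (auto simp: loc_stop_def loc_setup_eq T0_def)

lemma started_iff: "v \<in> V \<Longrightarrow> (\<exists>s\<le>t. loc_stop v (N v) (ins t v) s) \<longleftrightarrow> T0 \<le> t"
  using loc_stop_iff[of v _ t] by (metis le_trans linear)

lemma loc_T0_eq:
  assumes "v \<in> V" "T0 \<le> T"
  shows "loc_T0 v (N v) (ins T v) = T0"
  unfolding loc_T0_def
proof (rule Least_equality)
  show "loc_stop v (N v) (ins T v) T0" using loc_stop_iff assms by simp
  show "T0 \<le> t" if "loc_stop v (N v) (ins T v) t" for t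
    using loc_stop_iff[of v t T] that assms by (cases "t \<le> T0") auto
qed

lemma loc_depth_eq: "v \<in> V \<Longrightarrow> T0 \<le> T \<Longrightarrow> loc_depth v (N v) (ins T v) = depth v"
  by (simp add: loc_depth_def loc_T0_eq loc_setup_eq setup_state_late)

lemma loc_parent_eq:
  assumes "v \<in> V" "T0 \<le> T"
  shows "loc_parent v (N v) (ins T v) = parent v"
proof -
  have "ins T v (T0 - 1) u ! 1 = depth u" if "u \<in> N v" for u
  proof -
    have "u \<in> V" using that neighbor_in_V by blast
    then have "msg (T0 - 1) u v = setup_out (T0 - 1) (setup_state (T0 - 1) u)"
      using T0_pos by (intro msg_setup) auto
    moreover have "fst (setup_state (T0 - 1) u) = [leader, depth u]"
      using setup_state_late \<open>u \<in> V\<close> by simp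
    ultimately show ?thesis
      using assms(2) that T0_pos by (simp add: ins_eq setup_out_def)
  qed
  then have "(u \<in> N v \<and> Suc (ins T v (T0 - 1) u ! 1) = depth v) \<longleftrightarrow> (u \<in> N v \<and> Suc (depth u) = depth v)" for u
    by auto
  then show ?thesis
    unfolding loc_parent_def parent_def using assms by (simp only: loc_T0_eq loc_depth_eq)
qed

lemma loc_census_eq':
  assumes "\<And>s v u. s < t \<Longrightarrow> v \<in> V \<Longrightarrow>
      msg (T0 + s) v u = census_out T0 (depth v) (parent v) s (census_state s v) u"
    and "s \<le> t" "T0 + s \<le> T" "v \<in> V"
  shows "loc_census v (N v) (ins T v) s = census_state s v"
  unfolding loc_census_def census_state_def loc_T0_eq[OF assms(4) add_leD1[OF assms(3)]]
  by (rule local_run_eq_global_run[where V = V and K = t and a = "\<lambda>_. (Suc 0, 0)"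
        and f = "\<lambda>v. census_step T0 (N v)"])
     (use assms neighbors_subset in \<open>auto simp flip: census_state_def\<close>)

lemma msg_census:
  "t < 2 * T0 \<Longrightarrow> v \<in> V \<Longrightarrow>
     msg (T0 + t) v u = census_out T0 (depth v) (parent v) t (census_state t v) u"
proof (induction t arbitrary: v u rule: less_induct)
  case (less t)
  have "loc_census v (N v) (ins (T0 + t) v) t = census_state t v"
    using less by (intro loc_census_eq'[of t]) auto
  then show ?case
    using less.prems started_iff[of v "T0 + t"]
    by (subst sent_def, subst spanner_out_after_setup(1)[where T = T0])
       (simp_all add: loc_T0_eq loc_depth_eq loc_parent_eq)
qed

lemma loc_census_eq:
  "v \<in> V \<Longrightarrow> t \<le> 2 * T0 \<Longrightarrow> T0 + t \<le> T \<Longrightarrow> loc_census v (N v) (ins T v) t = census_state t v"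
  using msg_census by (intro loc_census_eq'[of "2 * T0"]) auto

lemma loc_size_eq: "v \<in> V \<Longrightarrow> 3 * T0 \<le> T \<Longrightarrow> loc_size v (N v) (ins T v) = n"
  by (simp add: loc_size_def loc_T0_eq loc_depth_eq loc_census_eq census_final)

definition heavy :: "nat \<Rightarrow> bool" where
  "heavy v \<longleftrightarrow> heavy_degree M n \<le> card (N v)"

definition level :: "nat \<Rightarrow> nat \<Rightarrow> bool" where
  "level i v \<longleftrightarrow> threshold n i \<le> X v"

definition K :: nat where "K = T0 + sample_bound M n"

definition center :: "nat \<Rightarrow> nat option" where
  "center v = (if heavy v \<and> {u \<in> N v. level 0 u} \<noteq> {} then Some (Min {u \<in> N v. level 0 u}) else None)"

lemma loc_heavy_eq: "v \<in> V \<Longrightarrow> 3 * T0 \<le> T \<Longrightarrow> loc_heavy M v (N v) (ins T v) \<longleftrightarrow> heavy v"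
  by (simp add: loc_heavy_def heavy_def loc_size_eq)

lemma loc_K_eq: "v \<in> V \<Longrightarrow> 3 * T0 \<le> T \<Longrightarrow> loc_K M v (N v) (ins T v) = K"
  by (simp add: loc_K_def K_def loc_size_eq loc_T0_eq)

lemma msg_flags:
  "v \<in> V \<Longrightarrow> msg (3 * T0) v u = [if level 0 v then 1 else 0, if heavy v then 1 else 0]"
  using started_iff[of v "3 * T0"]
  by (subst sent_def, subst spanner_out_after_setup(2)[where T = T0])
     (simp_all add: loc_T0_eq loc_size_eq loc_heavy_eq level_def)

lemma loc_flag_eq:
  assumes "v \<in> V" "3 * T0 < T"
  shows "loc_flag 0 v (N v) (ins T v) = {u \<in> N v. level 0 u}"
    and "loc_flag (Suc 0) v (N v) (ins T v) = {u \<in> N v. heavy u}"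
  using assms neighbor_in_V(1)[of _ v] by (auto simp: loc_flag_def loc_T0_eq ins_eq msg_flags split: if_splits)

lemma loc_center_eq: "v \<in> V \<Longrightarrow> 3 * T0 < T \<Longrightarrow> loc_center M v (N v) (ins T v) = center v"
  by (simp add: loc_center_def center_def loc_heavy_eq loc_flag_eq)

lemma msg_center: "v \<in> V \<Longrightarrow> msg (3 * T0 + 1) v u = (if center v = Some u then [1] else [])"
  using started_iff[of v "3 * T0 + 1"]
  by (subst sent_def, subst spanner_out_after_setup(3)[where T = T0])
     (simp_all add: loc_T0_eq loc_center_eq)

sublocale det: detection V E "level i" "level 0" heavy "base_weight n i" K for i
  by unfold_locales (simp add: base_weight_def)

definition base :: "nat \<Rightarrow> nat" where "base i = 3 * T0 + 2 + 2 * K * i"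

lemma K_pos: "0 < K" using T0_pos by (simp add: K_def)

lemma loc_detection_eq':
  assumes "\<And>s v u. s < t \<Longrightarrow> v \<in> V \<Longrightarrow>
      msg (base i + s) v u = detection_out K (base_weight n i) (level 0 v) v s (det.state i s v) u"
    and "s \<le> t" "base i + s \<le> T" "v \<in> V"
  shows "loc_detection M v (N v) (X v) (ins T v) i s = det.state i s v"
proof -
  have T: "3 * T0 < T" using assms(3) by (simp add: base_def)
  have step: "detection_step K (base_weight n i) (level 0 v) (N v)
          (\<lambda>u. if loc_heavy M v (N v) (ins T v) \<and> u \<in> loc_flag (Suc 0) v (N v) (ins T v) then 1 else 0) v =
        detection_step K (base_weight n i) (level 0 v) (N v) (\<lambda>u. det.cost u v) v"
    using T assms(4) by (subst detection_step_cong[of "N v"])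
      (auto simp: loc_heavy_eq loc_flag_eq det.cost_def)
  have "loc_detection M v (N v) (X v) (ins T v) i s =
      local_run (detection_init (level i v) v)
        (detection_step K (base_weight n i) (level 0 v) (N v) (\<lambda>u. det.cost u v) v) (ins T v) (base i) s"
    using T assms(4) step
    by (simp add: loc_detection_def Let_def loc_size_eq loc_K_eq loc_T0_eq base_def level_def)
  also have "\<dots> = det.state i s v"
    unfolding det.state_def
    by (rule local_run_eq_global_run[where V = V and K = t
          and a = "\<lambda>v. detection_init (level i v) v"
          and f = "\<lambda>v. detection_step K (base_weight n i) (level 0 v) (N v) (\<lambda>u. det.cost u v) v"])
       (use assms neighbors_subset in \<open>auto simp flip: det.state_def\<close>)
  finally show ?thesis .
qed

lemma msg_detection:
  "t < 2 * K \<Longrightarrow> v \<in> V \<Longrightarrow>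
     msg (base i + t) v u = detection_out K (base_weight n i) (level 0 v) v t (det.state i t v) u"
proof (induction t arbitrary: v u rule: less_induct)
  case (less t)
  have eq: "loc_detection M v (N v) (X v) (ins (base i + t) v) i t = det.state i t v"
    using less by (intro loc_detection_eq'[of t]) auto
  have T: "3 * T0 + 1 < base i + t" by (simp add: base_def)
  show ?case
    using less.prems started_iff[of v "base i + t"] T eq
    by (subst sent_def, subst spanner_out_after_setup(4)[where T = T0 and i = i and \<tau> = t and K = K and n = n])
       (simp_all add: loc_T0_eq loc_size_eq loc_K_eq level_def base_def)
qed

lemma loc_detection_eq:
  "v \<in> V \<Longrightarrow> t \<le> 2 * K \<Longrightarrow> base i + t \<le> T \<Longrightarrow>
     loc_detection M v (N v) (X v) (ins T v) i t = det.state i t v"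
  using msg_detection by (intro loc_detection_eq'[of "2 * K"]) auto

definition T_end :: nat where "T_end = 3 * T0 + 2 + 14 * K"

definition kept :: "nat \<Rightarrow> nat set" where
  "kept v = {u \<in> N v. \<not> heavy v \<or> \<not> heavy u \<or> center v = Some u \<or> center u = Some v \<or>
     (\<exists>i<7. u \<in> links (det.state i (2 * K) v))}"

lemma result_before: "v \<in> V \<Longrightarrow> N v \<noteq> {} \<Longrightarrow> t < T_end \<Longrightarrow>
    result_at (spanner_result M) (spanner_out M) E X t v = None"
  using started_iff[of v t] T0_pos
  by (cases "3 * T0 \<le> t")
     (auto simp: result_at_def spanner_result_def loc_T0_eq loc_K_eq T_end_def)

lemma result_end:
  assumes "v \<in> V" "N v \<noteq> {}"
  shows "result_at (spanner_result M) (spanner_out M) E X T_end v = Some (kept v)"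
proof -
  have T: "T0 \<le> T_end" "3 * T0 \<le> T_end" "3 * T0 < T_end" by (auto simp: T_end_def)
  have links: "loc_detection M v (N v) (X v) (ins T_end v) i (2 * K) = det.state i (2 * K) v" if "i < 7" for i
  proof -
    have "2 * K * Suc i \<le> 2 * K * 7" using that by (intro mult_le_mono2) simp
    then show ?thesis using assms by (intro loc_detection_eq) (auto simp: base_def T_end_def)
  qed
  have center: "ins T_end v (3 * T0 + 1) u \<noteq> [] \<longleftrightarrow> center u = Some v" if "u \<in> N v" for u
    using that neighbor_in_V[OF that] msg_center[of u v] by (simp add: received_eq T_end_def)
  have "result_at (spanner_result M) (spanner_out M) E X T_end v =
    Some {u \<in> N v. \<not> heavy v \<or> u \<notin> {u \<in> N v. heavy u} \<or> center v = Some u \<or>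
      ins T_end v (3 * T0 + 1) u \<noteq> [] \<or> (\<exists>i<7. u \<in> links (loc_detection M v (N v) (X v) (ins T_end v) i (2 * K)))}"
    using assms started_iff[of v T_end] T
    by (simp add: result_at_def spanner_result_def loc_T0_eq loc_K_eq loc_heavy_eq loc_flag_eq loc_center_eq
        del: One_nat_def add_2_eq_Suc' Collect_mem_eq) (simp add: T_end_def)
  also have "\<dots> = Some (kept v)"
    unfolding kept_def using center links by (auto cong: conj_cong)
  finally show ?thesis .
qed

end

section \<open>Stretch and size of the spanner\<close>

context cgraph
begin

text \<open>Chosen from the graph alone, independently of the sample, so that the union bound can
  range over one fixed path per pair of nodes.\<close>

definition geodesic :: "nat \<Rightarrow> nat \<Rightarrow> nat \<Rightarrow> nat" where
  "geodesic u v = (SOME p. p 0 = u \<and> p (nat_dist E u v) = v \<and>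
     (\<forall>i<nat_dist E u v. p i \<in> neighbors E (p (Suc i))))"

lemma geodesic:
  assumes "u \<in> V" "v \<in> V"
  shows "geodesic u v 0 = u" "geodesic u v (nat_dist E u v) = v"
    "i < nat_dist E u v \<Longrightarrow> geodesic u v i \<in> neighbors E (geodesic u v (Suc i))"
proof -
  have "\<exists>p. p 0 = u \<and> p (nat_dist E u v) = v \<and> (\<forall>i<nat_dist E u v. p i \<in> neighbors E (p (Suc i)))"
    using dist_walk[OF assms] by (simp add: relpow_fun_conv arcs_neighbors)
  from someI_ex[OF this] show "geodesic u v 0 = u" "geodesic u v (nat_dist E u v) = v"
    "i < nat_dist E u v \<Longrightarrow> geodesic u v i \<in> neighbors E (geodesic u v (Suc i))"
    by (auto simp: geodesic_def)
qed

lemma geodesic_in_V: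
  assumes "u \<in> V" "v \<in> V" "i \<le> nat_dist E u v"
  shows "geodesic u v i \<in> V"
proof (cases "i = nat_dist E u v")
  case False
  then show ?thesis using geodesic(3)[OF assms(1,2), of i] assms(3) neighbor_in_V(1) by auto
qed (use geodesic(2) assms in auto)

lemma walk_along:
  assumes "\<And>i. x \<le> i \<Longrightarrow> i < y \<Longrightarrow> p i \<in> neighbors E' (p (Suc i))" "x \<le> y"
  shows "(p x, p y) \<in> arcs E' ^^ (y - x)"
  using assms(2,1)
proof (induction y rule: dec_induct)
  case (step y)
  then have "(p x, p y) \<in> arcs E' ^^ (y - x)" "(p y, p (Suc y)) \<in> arcs E'"
    by (auto simp: arcs_neighbors)
  then show ?case using step.hyps relpow_Suc_I by (metis Suc_diff_le)
qed simp

lemma nat_dist_geodesic: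
  assumes uv: "u \<in> V" "v \<in> V" and ij: "i \<le> j" "j \<le> nat_dist E u v"
  shows "nat_dist E (geodesic u v i) (geodesic u v j) = j - i"
proof (rule antisym)
  let ?p = "geodesic u v" and ?d = "nat_dist E u v"
  have walk: "(?p x, ?p y) \<in> arcs E ^^ (y - x)" if "x \<le> y" "y \<le> ?d" for x y
    using that geodesic(3)[OF uv] by (intro walk_along) auto
  show "nat_dist E (?p i) (?p j) \<le> j - i" using nat_dist_le walk ij by blast
  have V: "?p i \<in> V" "?p j \<in> V" using geodesic_in_V uv ij by auto
  have "nat_dist E u v \<le> nat_dist E u (?p i) + (nat_dist E (?p i) (?p j) + nat_dist E (?p j) v)"
    using nat_dist_triangle[OF uv(1) V(1) uv(2)] nat_dist_triangle[OF V(1,2) uv(2)] by simp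
  moreover have "nat_dist E u (?p i) \<le> i" "nat_dist E (?p j) v \<le> ?d - j"
    using walk[of 0 i] walk[of j ?d] nat_dist_le geodesic(1,2)[OF uv] ij by fastforce+
  ultimately show "j - i \<le> nat_dist E (?p i) (?p j)" using ij by simp
qed

text \<open>A node has at most three neighbors on a shortest path, so the neighborhoods of the nodes of a
  shortest path overlap little.\<close>

lemma geodesic_neighborhood:
  assumes uv: "u \<in> V" "v \<in> V" and I: "I \<subseteq> {..<nat_dist E u v}"
    and deg: "\<And>j. j \<in> I \<Longrightarrow> h \<le> card (neighbors E (geodesic u v j))"
  shows "card I * h \<le> 3 * card (\<Union>j\<in>I. neighbors E (geodesic u v j))"
proof -
  let ?p = "geodesic u v"
  let ?A = "\<Union>j\<in>I. neighbors E (?p j)"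
  have finI: "finite I" using I finite_subset by blast
  then have finA: "finite ?A" using finite_neighbors by blast
  have three: "card {j \<in> I. z \<in> neighbors E (?p j)} \<le> 3" for z
  proof (cases "{j \<in> I. z \<in> neighbors E (?p j)} = {}")
    case False
    let ?J = "{j \<in> I. z \<in> neighbors E (?p j)}"
    have fin: "finite ?J" using finI by simp
    define m where "m = Min ?J"
    have m: "m \<in> ?J" unfolding m_def using Min_in[OF fin False] .
    \<comment> \<open>Path nodes with a common neighbor \<open>z\<close> are at distance at most 2,
      and on a shortest path distances are differences of indices.\<close>
    have "?J \<subseteq> {m..m + 2}"
    proof
      fix j assume j: "j \<in> ?J"
      have "m \<le> j" using fin j by (simp add: m_def)
      moreover have "j - m \<le> 2"
      proof -
        have "(?p m, ?p j) \<in> arcs E ^^ Suc (Suc 0)"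
          using m j by (auto simp: arcs_neighbors neighbors_sym intro!: relcompI[of _ z])
        then have "nat_dist E (?p m) (?p j) \<le> 2" using nat_dist_le by fastforce
        then show ?thesis
          using nat_dist_geodesic[OF uv \<open>m \<le> j\<close>] j I by auto
      qed
      ultimately show "j \<in> {m..m + 2}" by auto
    qed
    then have "card ?J \<le> card {m..m + 2}" by (intro card_mono) auto
    then show ?thesis by simp
  next
    case True
    then show ?thesis by (simp only: card.empty)
  qed
  \<comment> \<open>Double counting of the pairs of a path node and a neighbor of it.\<close>
  have "card I * h \<le> (\<Sum>j\<in>I. card (neighbors E (?p j)))"
    using sum_mono[of I "\<lambda>_. h"] deg by simp
  also have "\<dots> = (\<Sum>j\<in>I. \<Sum>z\<in>?A. if z \<in> neighbors E (?p j) then 1 else 0)"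
  proof (rule sum.cong[OF refl])
    fix j assume "j \<in> I"
    then have "?A \<inter> {z. z \<in> neighbors E (?p j)} = neighbors E (?p j)" by auto
    then show "card (neighbors E (?p j)) = (\<Sum>z\<in>?A. if z \<in> neighbors E (?p j) then 1 else 0)"
      using finA by (simp add: sum.If_cases)
  qed
  also have "\<dots> = (\<Sum>z\<in>?A. \<Sum>j\<in>I. if z \<in> neighbors E (?p j) then 1 else 0)"
    by (rule sum.swap)
  also have "\<dots> \<le> (\<Sum>z\<in>?A. 3)"
  proof (rule sum_mono)
    fix z
    have "(\<Sum>j\<in>I. if z \<in> neighbors E (?p j) then 1 else 0) = card {j \<in> I. z \<in> neighbors E (?p j)}"
      using finI by (simp add: sum.If_cases Collect_conj_eq Int_commute)
    then show "(\<Sum>j\<in>I. if z \<in> neighbors E (?p j) then 1 else 0) \<le> (3::nat)"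
      using three[of z] by simp
  qed
  finally show ?thesis by simp
qed

text \<open>The detour via the leader has length at most \<open>2 * 4 ^ J\<close>, half of
  \<open>T0\<close>. The spare factor 2 is spent on weights, which may be up to twice
  \<open>b\<close> times the distance.\<close>

lemma nat_dist_le_T0:
  assumes "u \<in> V" "v \<in> V"
  shows "2 * nat_dist E u v \<le> T0"
proof -
  have "nat_dist E u v \<le> depth u + depth v"
    using nat_dist_triangle[OF assms(1) leader_in_V assms(2)] nat_dist_sym[OF assms(1) leader_in_V]
    by (simp add: depth_def)
  moreover have "depth u \<le> 4 ^ J" "depth v \<le> 4 ^ J" using covers_J assms by (auto simp: covers_def)
  ultimately show ?thesis by (simp add: T0_def)
qed

lemma test_value_bound:
  assumes "v \<in> V"
  shows "test_value t (setup_state t v) \<in> {0} \<union> Suc ` V"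
proof -
  have 1: "test_value t (setup_state t v) \<in> {0} \<union> Suc ` V"
    if "v \<in> V" "snd (setup_state t v) \<in> {0} \<union> Suc ` V" for t v
    using fst_setup_state[of t v] that walk_in_V by (auto simp: walks_to_def test_value_def)
  have 2: "snd (setup_state t v) \<in> {0} \<union> Suc ` V" if "v \<in> V" for t v
    using that
  proof (induction t arbitrary: v)
    case (Suc t)
    then show ?case using 1[of v t] by (simp add: setup_state_Suc setup_step_def)
  qed (simp add: setup_state_0)
  show ?thesis using 1[OF assms 2[OF assms]] .
qed

end

context spanner_run
begin

lemma T0_le_K: "T0 \<le> K" by (simp add: K_def)

lemma base_weight_mono: "i \<le> 6 \<Longrightarrow> base_weight n i \<le> base_weight n 6"
  by (simp add: base_weight_def)

text \<open>Valid for every \<open>X\<close>, good or not, because bandwidth admits no exceptional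
  event.\<close>

lemma msg_bounded:
  assumes "t < T_end" "v \<in> V"
  shows "length (msg t v u) \<le> 3"
    and "x \<in> set (msg t v u) \<Longrightarrow> x \<le> n + 1 + (base_weight n 6 + 1) * K \<or> x \<in> V \<or> x \<in> Suc ` V"
proof -
  have "length (msg t v u) \<le> 3 \<and>
    (\<forall>x\<in>set (msg t v u). x \<le> n + 1 + (base_weight n 6 + 1) * K \<or> x \<in> V \<or> x \<in> Suc ` V)"
  proof -
    consider "t < T0" | "T0 \<le> t" "t < 3 * T0" | "t = 3 * T0" | "t = 3 * T0 + 1" | "3 * T0 + 2 \<le> t" by linarith
    then show ?thesis
    proof cases
      case 1
      obtain w k where "fst (setup_state t v) = [w, k]" "k \<le> t" "w \<in> V"
        using fst_setup_state[of t v] walk_in_V assms(2) by (auto simp: walks_to_def)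
      moreover have "t \<le> (base_weight n 6 + 1) * K"
        using 1 T0_le_K by (simp add: add_increasing)
      ultimately show ?thesis
        using 1 assms(2) test_value_bound[OF assms(2), of t] by (auto simp: msg_setup setup_out_def)
    next
      case 2
      then have "msg t v u = census_out T0 (depth v) (parent v) (t - T0) (census_state (t - T0) v) u"
        using msg_census[of "t - T0" v u] assms(2) by simp
      then have "length (msg t v u) \<le> 1" "\<forall>x\<in>set (msg t v u). x \<le> n"
        using census_out_le(1)[OF assms(2), of "t - T0" u] census_out_le(2)[OF assms(2), of _ "t - T0" u]
        by auto
      moreover have "x \<le> n + 1 + c" if "x \<le> n" for x c using that by simp
      ultimately show ?thesis by fastforce
    next
      case 3
      then show ?thesis using assms(2) by (auto simp: msg_flags)
    next
      case 4
      then show ?thesis using msg_center[OF assms(2), of u] by auto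
    next
      case 5
      define i \<tau> where "i = (t - (3 * T0 + 2)) div (2 * K)" and "\<tau> = (t - (3 * T0 + 2)) mod (2 * K)"
      have t: "t = base i + \<tau>" "\<tau> < 2 * K"
        using 5 K_pos by (simp_all add: base_def i_def \<tau>_def)
      have i: "i < 7"
        unfolding i_def using assms(1) 5 by (intro less_mult_imp_div_less) (simp add: T_end_def)
      have "(base_weight n i + 1) * K \<le> (base_weight n 6 + 1) * K"
        using base_weight_mono[of i] i by simp
      have "x \<le> n + 1 + (base_weight n 6 + 1) * K \<or> x \<in> V" if "x \<in> set (msg t v u)" for x
      proof -
        have "x \<le> (base_weight n i + 1) * K \<or> x \<in> V"
          using det.detection_out_bounded[OF assms(2) t(2), of x i u] that
          unfolding t(1) msg_detection[OF t(2) assms(2), of i u] by blast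
        then show ?thesis using \<open>(base_weight n i + 1) * K \<le> _\<close> by linarith
      qed
      moreover have "length (msg t v u) \<le> 3"
        using det.length_detection_out[OF assms(2), of i \<tau> u] msg_detection[OF t(2) assms(2), of i u] t(1)
        by simp
      ultimately show ?thesis by blast
    qed
  qed
  then show "length (msg t v u) \<le> 3"
    and "x \<in> set (msg t v u) \<Longrightarrow> x \<le> n + 1 + (base_weight n 6 + 1) * K \<or> x \<in> V \<or> x \<in> Suc ` V"
    by auto
qed

definition heavy_steps :: "nat \<Rightarrow> nat \<Rightarrow> nat set" where
  "heavy_steps u v = {j. j < nat_dist E u v \<and> heavy (geodesic u v j) \<and> heavy (geodesic u v (Suc j))}"

lemma finite_heavy_steps: "finite (heavy_steps u v)"
  by (simp add: heavy_steps_def)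

definition spanner :: "nat set set" where
  "spanner = {{v, u} |v u. v \<in> V \<and> u \<in> kept v}"

end

text \<open>What the correctness of the spanner requires of the run, stated without probabilities.
  The bound on \<open>heavy_steps\<close> places every path in one of the seven levels.\<close>

locale good_run = spanner_run +
  assumes size_ge_2: "2 \<le> n"
    and few_centers: "card {v \<in> V. level 0 v} \<le> sample_bound M n"
    and centers_hit: "\<And>v. v \<in> V \<Longrightarrow> heavy v \<Longrightarrow> \<exists>u\<in>N v. level 0 u"
    and few_heavy_steps: "\<And>u v. u \<in> V \<Longrightarrow> v \<in> V \<Longrightarrow> card (heavy_steps u v) < 2 ^ (scale n * 7)"
    and geodesics_hit: "\<And>u v i. u \<in> V \<Longrightarrow> v \<in> V \<Longrightarrow> i < 7 \<Longrightarrow> heavy_steps u v \<noteq> {} \<Longrightarrow>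
      2 ^ (scale n * i) \<le> card (heavy_steps u v) \<Longrightarrow>
      \<exists>j\<in>heavy_steps u v. \<exists>r\<in>N (geodesic u v j). level i r"
begin

lemma scale_pos: "0 < scale n"
proof (rule ccontr)
  assume "\<not> 0 < scale n"
  moreover have "n \<le> 2 ^ (11 * scale n)"
  proof -
    have "n \<le> 2 ^ (11 * n)" using less_exp[of n] power_increasing[of n "11 * n" "2::nat"] by linarith
    then show ?thesis unfolding scale_def by (rule LeastI)
  qed
  ultimately show False using size_ge_2 by simp
qed

lemma base_weight_ge_2: "2 \<le> base_weight n i"
proof -
  have "(2::nat) ^ 1 \<le> 2 ^ (scale n * (i + 1))" using scale_pos by (intro power_increasing) auto
  then show ?thesis by (simp add: base_weight_def)
qed

text \<open>As \<open>b + 1 \<le> 2 * b\<close>, the weight quotient is at most twice the distance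
  and hence at most \<open>T0\<close>. The rank is below the number of sources, all of which belong
  to level \<open>0\<close> because the samples are nested.\<close>

sublocale tdet: timely_detection V E "level i" "level 0" heavy "base_weight n i" K for i
proof
  fix r v assume r: "r \<in> det.sources i" and v: "v \<in> V"
  let ?b = "base_weight n i"
  obtain w k where tok: "det.token i r v w k" "w \<le> (?b + 1) * nat_dist E r v"
    using det.token_exists[OF r v] by blast
  have "det.opt_weight i r v div ?b \<le> (?b * (2 * nat_dist E r v)) div ?b"
  proof (rule div_le_mono)
    have "det.opt_weight i r v \<le> (?b + 1) * nat_dist E r v"
      using det.opt_weight_le[OF tok(1)] tok(2) by simp
    also have "\<dots> \<le> (?b * 2) * nat_dist E r v"
      using base_weight_ge_2[of i] by (intro mult_le_mono1) simp
    finally show "det.opt_weight i r v \<le> ?b * (2 * nat_dist E r v)" by simp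
  qed
  also have "\<dots> = 2 * nat_dist E r v" using base_weight_ge_2[of i] by simp
  also have "\<dots> \<le> T0" using nat_dist_le_T0 r v by (simp add: det.sources_def)
  finally have 1: "det.opt_weight i r v div ?b \<le> T0" .
  have "{r' \<in> det.sources i. det.opt i r' v < det.opt i r v} \<subset> det.sources i" using r by auto
  then have "det.rank i r v < card (det.sources i)"
    unfolding det.rank_def using det.finite_sources by (intro psubset_card_mono)
  also have "\<dots> \<le> card {v \<in> V. level 0 v}"
    using finV by (intro card_mono) (auto simp: det.sources_def level_def threshold_def)
  finally show "det.due i r v < K"
    using 1 few_centers by (simp add: det.due_def K_def)
qed

lemma kept_sym:
  assumes "u \<in> V" "v \<in> V"
  shows "u \<in> kept v \<longleftrightarrow> v \<in> kept u"
proof -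
  have "u \<in> links (det.state i (2 * K) v) \<longleftrightarrow> v \<in> links (det.state i (2 * K) u)" for i
    unfolding tdet.links_eq[OF assms(1)] tdet.links_eq[OF assms(2)] by blast
  then show ?thesis
    unfolding kept_def mem_Collect_eq neighbors_sym[of u E v] by blast
qed

lemma neighbors_spanner:
  assumes "v \<in> V"
  shows "neighbors spanner v = kept v"
proof (intro set_eqI iffI)
  fix u assume "u \<in> neighbors spanner v"
  then obtain x y where xy: "{u, v} = {x, y}" "x \<in> V" "y \<in> kept x"
    by (auto simp: neighbors_def spanner_def)
  then have "y \<in> V" using neighbor_in_V(1) by (auto simp: kept_def)
  then show "u \<in> kept v" using xy kept_sym[of y x] by (auto simp: doubleton_eq_iff)
next
  fix u assume "u \<in> kept v"
  then have "{v, u} \<in> spanner" using assms unfolding spanner_def by blast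
  then show "u \<in> neighbors spanner v" by (simp add: neighbors_def insert_commute)
qed

lemma spanner_subset: "spanner \<subseteq> E"
  by (auto simp: spanner_def kept_def neighbors_def insert_commute)

lemma arcs_spanner: "(u, v) \<in> arcs spanner \<longleftrightarrow> v \<in> V \<and> u \<in> kept v"
proof
  assume "(u, v) \<in> arcs spanner"
  then have uv: "u \<in> neighbors spanner v" by (simp add: arcs_neighbors)
  then have "v \<in> V" using spanner_subset neighbor_in_V(2)[of u v] by (auto simp: neighbors_def)
  then show "v \<in> V \<and> u \<in> kept v" using uv neighbors_spanner by blast
qed (simp add: arcs_neighbors neighbors_spanner)

lemma arcs_spanner_sym: "(u, v) \<in> arcs spanner \<Longrightarrow> (v, u) \<in> arcs spanner"
  by (simp add: arcs_def insert_commute)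

lemma center_Some:
  assumes "v \<in> V" "heavy v"
  obtains s where "center v = Some s" "s \<in> N v" "s \<in> V" "level 0 s" "(v, s) \<in> arcs spanner"
proof -
  have ne: "{u \<in> N v. level 0 u} \<noteq> {}" using centers_hit[OF assms] by blast
  moreover have fin: "finite {u \<in> N v. level 0 u}" using finite_neighbors by simp
  ultimately have s: "center v = Some (Min {u \<in> N v. level 0 u})" "Min {u \<in> N v. level 0 u} \<in> {u \<in> N v. level 0 u}"
    using assms(2) Min_in by (auto simp: center_def simp del: Collect_empty_eq)
  then show thesis
    using neighbor_in_V(1) neighbors_sym by (intro that) (auto simp: arcs_spanner kept_def)
qed

lemma light_arc: "u \<in> N v \<Longrightarrow> \<not> (heavy u \<and> heavy v) \<Longrightarrow> (u, v) \<in> arcs spanner"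
  using neighbor_in_V by (auto simp: arcs_spanner kept_def)

text \<open>Here \<open>q\<close> leads from a node \<open>q 0\<close> next to the source \<open>r\<close> along part of a shortest path to a
  node \<open>q l\<close> next to the center \<open>s\<close>.\<close>

lemma spanner_walk_to_center:
  assumes i: "i < 7" and r: "r \<in> det.sources i" "r \<in> N (q 0)"
    and q: "\<And>x. x < l \<Longrightarrow> q x \<in> N (q (Suc x))" "nat_dist E (q 0) (q l) = l"
    and heavy: "(\<Sum>x<l. det.cost (q x) (q (Suc x))) < base_weight n i"
    and s: "s \<in> V" "level 0 s" "s \<in> N (q l)"
  shows "\<exists>m. (s, r) \<in> arcs spanner ^^ m \<and> m \<le> l + 3"
proof -
  let ?b = "base_weight n i" and ?S = "\<lambda>x. \<Sum>y<x. det.cost (q y) (q (Suc y))"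
  have "det.token i r (q x) (?b * Suc x + ?S x + det.cost r (q 0))
      (?S x + det.cost r (q 0))" if "x \<le> l" for x
    using that
  proof (induction x)
    case 0
    then show ?case using det.token.step[OF det.token.source[OF r(1)] r(2)] by simp
  next
    case (Suc x)
    then have "det.token i r (q x) (?b * Suc x + ?S x + det.cost r (q 0))
        (?S x + det.cost r (q 0))" by simp
    from det.token.step[OF this, of "q (Suc x)"] q(1)[of x] Suc.prems show ?case
      by (simp add: algebra_simps)
  qed
  from det.token.step[OF this[OF order_refl], of s] s(3) neighbors_sym[of s]
  have tok: "det.token i r s
      (?b * Suc l + ?S l + det.cost r (q 0) + ?b + det.cost (q l) s)
      (?S l + det.cost r (q 0) + det.cost (q l) s)" by simp
  have "det.opt_weight i r s \<le>
      ?b * Suc l + ?S l + det.cost r (q 0) + ?b + det.cost (q l) s"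
    using det.opt_weight_le[OF tok] .
  moreover have "det.cost r (q 0) \<le> 1" "det.cost (q l) s \<le> 1" by (simp_all add: det.cost_def)
  \<comment> \<open>The path has at most \<open>b - 1\<close> heavy edges and the two end edges add
    at most 2, so the weight is at most \<open>b * (l + 3) + 1\<close>; here
    \<open>b \<ge> 2\<close> enters.\<close>
  ultimately have less: "det.opt_weight i r s < ?b * (l + 4)"
    using heavy base_weight_ge_2[of i] by (simp add: algebra_simps)
  obtain m where m: "det.opt_weight i r s = ?b * m + det.opt_heavy i r s" "(r, s) \<in> arcs E ^^ m"
    using det.token_weight[OF det.token_opt[OF r(1) s(1)]] by blast
  have V: "q 0 \<in> V" "q l \<in> V" "r \<in> V" using r s neighbor_in_V by blast+
  have "nat_dist E (q 0) (q l) \<le> nat_dist E (q 0) r + (nat_dist E r s + nat_dist E s (q l))"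
    using nat_dist_triangle[OF V(1) V(3) V(2)] nat_dist_triangle[OF V(3) s(1) V(2)] by simp
  moreover have "nat_dist E (q 0) r \<le> 1" "nat_dist E s (q l) \<le> 1"
    using nat_dist_le[of _ _ 1 E] r(2) s(3) by (auto simp: arcs_neighbors neighbors_sym)
  ultimately have "l \<le> m + 2" using q(2) nat_dist_le[OF m(2)] by simp
  \<comment> \<open>Origin of the limit \<open>6 * b\<close>: if the lightest path has
    \<open>m\<close> edges, \<open>k\<close> of them heavy, then
    \<open>b * m + k < b * (l + 4) \<le> b * (m + 6)\<close>.\<close>
  then have "?b * (l + 4) \<le> ?b * (m + 6)" by (intro mult_le_mono2) simp
  then have "det.opt_heavy i r s \<le> 6 * ?b"
    using less m(1) by (simp add: algebra_simps)
  then have marked: "tdet.marked i r s" using tdet.marked.start r(1) s by blast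
  have "{u, tdet.up i r u} \<in> spanner" if u: "tdet.marked i r u" "u \<noteq> r" for u
  proof -
    have V: "u \<in> V" "r \<in> det.sources i" using tdet.marked_in_V[OF u(1)] by auto
    then have "tdet.up i r u \<in> kept u"
      using tdet.up_step(2)[of r i u] u i tdet.links_eq[OF V(1), of i] by (auto simp: kept_def)
    then show ?thesis using V(1) by (auto simp: spanner_def)
  qed
  from tdet.marked_walk[OF marked this] obtain m' where
    m': "(s, r) \<in> arcs spanner ^^ m'" "det.opt_weight i r s = ?b * m' + det.opt_heavy i r s" by blast
  then have "?b * m' < ?b * (l + 4)" using less by linarith
  then have "m' < l + 4" by (rule mult_left_less_imp_less) simp
  then show ?thesis using m'(1) by auto
qed

lemma stretch:
  assumes uv: "u \<in> V" "v \<in> V"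
  shows "\<exists>m. (u, v) \<in> arcs spanner ^^ m \<and> m \<le> nat_dist E u v + 8"
proof (cases "heavy_steps u v = {}")
  case True
  let ?p = "geodesic u v" and ?d = "nat_dist E u v"
  have "(?p 0, ?p ?d) \<in> arcs spanner ^^ (?d - 0)"
  proof (rule walk_along)
    fix x assume "x < ?d"
    then show "?p x \<in> neighbors spanner (?p (Suc x))"
      using light_arc[OF geodesic(3)[OF uv]] True by (auto simp: heavy_steps_def arcs_neighbors)
  qed simp
  then show ?thesis using geodesic[OF uv] by auto
next
  case False
  let ?p = "geodesic u v" and ?d = "nat_dist E u v" and ?H = "heavy_steps u v"
  define a where "a = Min ?H"
  define e where "e = Max ?H"
  have ae: "a \<in> ?H" "e \<in> ?H" and ae_le: "\<And>j. j \<in> ?H \<Longrightarrow> a \<le> j \<and> j \<le> e"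
    using False finite_heavy_steps by (auto simp: a_def e_def)
  have card: "0 < card ?H" using False finite_heavy_steps by (simp add: card_gt_0_iff)
  \<comment> \<open>The level whose range contains the number of heavy edges; index \<open>6\<close>
    qualifies by \<open>few_heavy_steps\<close>.\<close>
  define i where "i = (LEAST i. card ?H < 2 ^ (scale n * (i + 1)))"
  have hi: "card ?H < 2 ^ (scale n * (i + 1))"
    unfolding i_def by (rule LeastI[of _ 6]) (use few_heavy_steps[OF uv] in simp)
  have i: "i < 7"
    using Least_le[of "\<lambda>i. card ?H < 2 ^ (scale n * (i + 1))" 6] few_heavy_steps[OF uv] by (simp add: i_def)
  have lo: "2 ^ (scale n * i) \<le> card ?H"
  proof (cases i)
    case 0
    then show ?thesis using card by simp
  next
    case (Suc i')
    then have "\<not> card ?H < 2 ^ (scale n * (i' + 1))"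
      unfolding i_def by (intro not_less_Least) (simp add: i_def)
    then show ?thesis using Suc by simp
  qed
  obtain j r where j: "j \<in> ?H" "r \<in> N (?p j)" "level i r"
    using geodesics_hit[OF uv i False lo] by blast
  have jd: "a \<le> j" "j \<le> e" "e < ?d" using ae_le[OF j(1)] ae by (auto simp: heavy_steps_def)
  have r: "r \<in> det.sources i" using j neighbor_in_V by (auto simp: det.sources_def)
  have pV: "?p x \<in> V" if "x \<le> ?d" for x using geodesic_in_V uv that by blast
  have cost: "det.cost (?p x) (?p (Suc x)) = (if x \<in> ?H then 1 else 0)" if "x < ?d" for x
    using that by (simp add: det.cost_def heavy_steps_def)
  have cost_sum: "(\<Sum>x\<in>A. det.cost (?p x) (?p (Suc x))) < base_weight n i" if "A \<subseteq> {..<?d}" "finite A" for A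
  proof -
    have "(\<Sum>x\<in>A. det.cost (?p x) (?p (Suc x))) = card (A \<inter> ?H)"
      using that cost by (simp add: sum.If_cases subset_iff cong: sum.cong_simp)
    also have "\<dots> \<le> card ?H" using finite_heavy_steps by (intro card_mono) auto
    finally show ?thesis using hi by (simp add: base_weight_def)
  qed
  obtain s where s: "s \<in> N (?p a)" "s \<in> V" "level 0 s" "(?p a, s) \<in> arcs spanner"
    using center_Some[of "?p a"] ae(1) pV by (auto simp: heavy_steps_def)
  obtain s' where s': "s' \<in> N (?p (Suc e))" "s' \<in> V" "level 0 s'" "(?p (Suc e), s') \<in> arcs spanner"
    using center_Some[of "?p (Suc e)"] ae(2) pV by (auto simp: heavy_steps_def)
  have "\<exists>m. (s, r) \<in> arcs spanner ^^ m \<and> m \<le> (j - a) + 3"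
  proof (rule spanner_walk_to_center[OF i r, of "\<lambda>x. ?p (j - x)"])
    show "?p (j - x) \<in> N (?p (j - Suc x))" if "x < j - a" for x
      using geodesic(3)[OF uv, of "j - Suc x"] that jd neighbors_sym by (simp add: Suc_diff_Suc)
    show "nat_dist E (?p (j - 0)) (?p (j - (j - a))) = j - a"
      using nat_dist_geodesic[OF uv jd(1)] nat_dist_sym[of "?p a" "?p j"] pV jd by simp
    have "(\<Sum>x<j - a. det.cost (?p (j - x)) (?p (j - Suc x))) =
        (\<Sum>x\<in>{a..<j}. det.cost (?p x) (?p (Suc x)))"
      by (rule sum.reindex_bij_witness[of _ "\<lambda>x. j - Suc x" "\<lambda>x. j - Suc x"])
         (use jd in \<open>auto simp: Suc_diff_Suc det.cost_commute\<close>)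
    moreover have "{a..<j} \<subseteq> {..<?d}" using jd by auto
    ultimately show "(\<Sum>x<j - a. det.cost (?p (j - x)) (?p (j - Suc x))) < base_weight n i"
      using cost_sum[of "{a..<j}"] by simp
  qed (use j s jd in auto)
  then obtain m where m: "(s, r) \<in> arcs spanner ^^ m" "m \<le> (j - a) + 3" by blast
  have "\<exists>m. (s', r) \<in> arcs spanner ^^ m \<and> m \<le> (Suc e - j) + 3"
  proof (rule spanner_walk_to_center[OF i r, of "\<lambda>x. ?p (j + x)"])
    show "?p (j + x) \<in> N (?p (j + Suc x))" if "x < Suc e - j" for x
      using geodesic(3)[OF uv, of "j + x"] that jd by simp
    show "nat_dist E (?p (j + 0)) (?p (j + (Suc e - j))) = Suc e - j"
      using nat_dist_geodesic[OF uv, of j "Suc e"] jd by simp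
    have "(\<Sum>x<Suc e - j. det.cost (?p (j + x)) (?p (j + Suc x))) =
        (\<Sum>x\<in>{j..<Suc e}. det.cost (?p x) (?p (Suc x)))"
      by (rule sum.reindex_bij_witness[of _ "\<lambda>x. x - j" "\<lambda>x. j + x"]) (use jd in auto)
    moreover have "{j..<Suc e} \<subseteq> {..<?d}" using jd by auto
    ultimately show "(\<Sum>x<Suc e - j. det.cost (?p (j + x)) (?p (j + Suc x))) < base_weight n i"
      using cost_sum[of "{j..<Suc e}"] by simp
  qed (use j s' jd in auto)
  then obtain m' where m': "(s', r) \<in> arcs spanner ^^ m'" "m' \<le> (Suc e - j) + 3" by blast
  have light: "?p x \<in> neighbors spanner (?p (Suc x))" if "x < ?d" "x < a \<or> e < x" for x
  proof -
    have "x \<notin> ?H" using ae_le[of x] that(2) by auto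
    then show ?thesis
      using that(1) light_arc[OF geodesic(3)[OF uv that(1)]] by (simp add: heavy_steps_def arcs_neighbors)
  qed
  have "(?p 0, ?p a) \<in> arcs spanner ^^ (a - 0)"
    by (rule walk_along) (use jd in \<open>auto intro: light\<close>)
  moreover have "(?p (Suc e), ?p ?d) \<in> arcs spanner ^^ (?d - Suc e)"
    by (rule walk_along) (use jd in \<open>auto intro: light\<close>)
  ultimately have w: "(u, ?p a) \<in> arcs spanner ^^ a" "(?p (Suc e), v) \<in> arcs spanner ^^ (?d - Suc e)"
    using geodesic[OF uv] by auto
  have c: "(?p a, s) \<in> arcs spanner ^^ 1" "(s', ?p (Suc e)) \<in> arcs spanner ^^ 1"
    using s(4) arcs_spanner_sym[OF s'(4)] by auto
  have "(r, s') \<in> arcs spanner ^^ m'" by (rule arcs_pow_sym[OF m'(1)])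
  from relpow_trans[OF relpow_trans[OF relpow_trans[OF relpow_trans[OF relpow_trans[OF
      w(1) c(1)] m(1)] this] c(2)] w(2)]
  have "(u, v) \<in> arcs spanner ^^ (a + 1 + m + m' + 1 + (?d - Suc e))"
    by simp
  \<comment> \<open>The excess 8 consists of two center edges and 3 for each of the two legs through
    \<open>r\<close>.\<close>
  moreover have "a + 1 + m + m' + 1 + (?d - Suc e) \<le> ?d + 8"
    using m(2) m'(2) jd by linarith
  ultimately show ?thesis by blast
qed

lemma additive_spanner_spanner: "additive_spanner V E 8 spanner"
  unfolding additive_spanner_def
proof (intro conjI ballI spanner_subset)
  fix u v assume uv: "u \<in> V" "v \<in> V"
  obtain m where "(u, v) \<in> arcs spanner ^^ m" "m \<le> nat_dist E u v + 8"
    using stretch[OF uv] by blast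
  then show "gdist spanner u v \<le> gdist E u v + enat 8"
    using gdist_le[of u v m spanner] gdist_nat_dist[OF uv] by (auto intro: order_trans)
qed

text \<open>The three terms account for edges at light nodes, one center edge per node, and heavy
  tree edges of the seven levels.\<close>

lemma card_spanner:
  "card spanner \<le> n * heavy_degree M n + n +
     (\<Sum>i<7. card {v \<in> V. level i v} * card {v \<in> V. level 0 v} * (6 * base_weight n i))"
proof -
  define L where "L = (\<Union>v\<in>{v \<in> V. \<not> heavy v}. (\<lambda>u. {v, u}) ` N v)"
  define C where "C = (\<lambda>v. {v, the (center v)}) ` V"
  define F where "F i = {{u, tdet.up i r u} |r u. tdet.marked i r u \<and> u \<noteq> r \<and> heavy u \<and> heavy (tdet.up i r u)}"
    for i
  have F: "finite (F i)" "card (F i) \<le> card {v \<in> V. level i v} * card {v \<in> V. level 0 v} * (6 * base_weight n i)" for i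
    using tdet.card_marked_heavy[of i] by (simp_all add: F_def det.sources_def)
  have sub: "spanner \<subseteq> L \<union> C \<union> (\<Union>i<7. F i)"
  proof
    fix x assume "x \<in> spanner"
    then obtain v u where x: "x = {v, u}" "v \<in> V" "u \<in> kept v" by (auto simp: spanner_def)
    then have N: "u \<in> N v" "v \<in> N u" "u \<in> V" using neighbors_sym neighbor_in_V(1) by (auto simp: kept_def)
    consider "\<not> heavy v" | "\<not> heavy u" | "center v = Some u" | "center u = Some v"
      | i where "heavy v" "heavy u" "i < 7" "u \<in> links (det.state i (2 * K) v)"
      using x(3) by (auto simp: kept_def)
    then show "x \<in> L \<union> C \<union> (\<Union>i<7. F i)"
    proof cases
      case 1
      then show ?thesis using x N by (auto simp: L_def)
    next
      case 2
      then have "{u, v} \<in> L" using x N by (auto simp: L_def)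
      then show ?thesis using x by (simp add: insert_commute)
    next
      case 3
      then show ?thesis using x by (auto simp: C_def)
    next
      case 4
      then have "{u, v} \<in> C" using N by (auto simp: C_def)
      then show ?thesis using x by (simp add: insert_commute)
    next
      case (5 i)
      then obtain r where "tdet.marked i r v \<and> v \<noteq> r \<and> u = tdet.up i r v \<or>
          tdet.marked i r u \<and> u \<noteq> r \<and> v = tdet.up i r u"
        using tdet.links_eq[OF x(2), of i] by auto
      then have "{v, u} \<in> F i \<or> {u, v} \<in> F i" using 5 unfolding F_def by blast
      then show ?thesis using x(1) 5(3) by (auto simp: insert_commute)
    qed
  qed
  have finL: "finite L" using finV finite_neighbors by (auto simp: L_def)
  have "card L \<le> (\<Sum>v\<in>{v \<in> V. \<not> heavy v}. card ((\<lambda>u. {v, u}) ` N v))"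
    unfolding L_def using finV by (intro card_UN_le) simp
  also have "\<dots> \<le> (\<Sum>v\<in>{v \<in> V. \<not> heavy v}. heavy_degree M n)"
  proof (rule sum_mono)
    fix v assume "v \<in> {v \<in> V. \<not> heavy v}"
    moreover have "card ((\<lambda>u. {v, u}) ` N v) \<le> card (N v)" by (rule card_image_le[OF finite_neighbors])
    ultimately show "card ((\<lambda>u. {v, u}) ` N v) \<le> heavy_degree M n" by (simp add: heavy_def)
  qed
  also have "\<dots> \<le> n * heavy_degree M n"
    using finV by (simp add: card_mono)
  finally have L: "card L \<le> n * heavy_degree M n" .
  have C: "finite C" "card C \<le> n" using finV by (auto simp: C_def card_image_le)
  have "card spanner \<le> card (L \<union> C \<union> (\<Union>i<7. F i))"
    using sub finL C F by (intro card_mono) auto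
  also have "\<dots> \<le> card L + card C + card (\<Union>i<7. F i)"
    by (meson card_Un_le add_le_mono1 order_trans)
  also have "card (\<Union>i<7. F i) \<le> (\<Sum>i<7. card (F i))" by (rule card_UN_le) simp
  also have "\<dots> \<le> (\<Sum>i<7. card {v \<in> V. level i v} * card {v \<in> V. level 0 v} * (6 * base_weight n i))"
    using F by (intro sum_mono) auto
  finally show ?thesis using L C by linarith
qed

end

section \<open>The random sample\<close>

lemma prob_geometric_less:
  "measure_pmf.prob (geometric_pmf (1/2)) {..<k} = 1 - (1/2) ^ k"
proof -
  have "measure_pmf.prob (geometric_pmf (1/2)) {..<k} = (\<Sum>i<k. (1/2::real) ^ i * (1/2))"
    by (simp add: measure_measure_pmf_finite)
  also have "\<dots> = 1 - (1/2) ^ k" by (induction k) auto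
  finally show ?thesis .
qed

lemma prob_geometric_ge:
  "measure_pmf.prob (geometric_pmf (1/2)) {k..} = (1/2) ^ k"
proof -
  have "measure_pmf.prob (geometric_pmf (1/2)) (UNIV - {..<k}) = 1 - (1 - (1/2) ^ k)"
    using measure_pmf.prob_compl[of "{..<k}" "geometric_pmf (1/2)"]
    by (simp add: prob_geometric_less)
  moreover have "UNIV - {..<k} = {k..}" by auto
  ultimately show ?thesis by simp
qed

lemma prob_unsampled:
  assumes fin: "finite V" and A: "A \<subseteq> V"
  shows "measure_pmf.prob (samples V) {X. \<forall>v\<in>A. X v < k} \<le> exp (- real (card A) / 2 ^ k)"
proof -
  let ?p = "(1/2::real) ^ k"
  have "{X. \<forall>v\<in>A. X v < k} = Pi V (\<lambda>v. if v \<in> A then {..<k} else UNIV)"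
    using A by (fastforce simp: Pi_def)
  then have "measure_pmf.prob (samples V) {X. \<forall>v\<in>A. X v < k} =
      (\<Prod>v\<in>V. measure_pmf.prob (geometric_pmf (1/2)) (if v \<in> A then {..<k} else UNIV))"
    unfolding samples_def by (simp only: measure_Pi_pmf_Pi[OF fin])
  also have "\<dots> = (\<Prod>v\<in>V. if v \<in> A then 1 - ?p else 1)"
    by (intro prod.cong refl) (simp add: prob_geometric_less)
  also have "\<dots> = (1 - ?p) ^ card A"
    using fin A by (simp add: prod.If_cases Int_absorb1)
  also have "\<dots> \<le> exp (- ?p) ^ card A"
    using exp_ge_add_one_self[of "- ?p"] by (intro power_mono) (auto simp: power_le_one)
  also have "\<dots> = exp (- real (card A) / 2 ^ k)"
    by (simp add: power_one_over field_simps flip: exp_of_nat_mult)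
  finally show ?thesis .
qed

text \<open>Markov's inequality for 2 to the number of sampled nodes, whose expectation factorises
  by independence into \<open>(1 + p) ^ card V\<close> with \<open>p = (1/2) ^ k\<close>. The factor
  4 is a generous choice for \<open>1 + p \<le> exp p \<le> 2 powr (4 * p)\<close>.\<close>

lemma prob_many_sampled:
  assumes fin: "finite V"
  shows "measure_pmf.prob (samples V) {X. 4 * real (card V) / 2 ^ k + t < real (card {v \<in> V. k \<le> X v})}
    \<le> 2 powr (- t)"
proof -
  let ?p = "(1/2::real) ^ k" and ?P = "geometric_pmf (1/2)"
  define f :: "nat \<Rightarrow> real" where "f = (\<lambda>x. 1 + indicator {k..} x)"
  define c where "c = 4 * real (card V) / 2 ^ k + t"
  have int: "integrable (measure_pmf ?P) f"
    unfolding f_def by (rule Bochner_Integration.integrable_add) (auto intro: measure_pmf.integrable_const_bound[of _ 1])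
  have f_nonneg: "0 \<le> f x" for x by (simp add: f_def)
  have prod: "(\<Prod>v\<in>V. f (X v)) = 2 powr real (card {v \<in> V. k \<le> X v})" for X
  proof -
    have "(\<Prod>v\<in>V. f (X v)) = (\<Prod>v\<in>V. if k \<le> X v then 2 else 1)"
      by (intro prod.cong refl) (simp add: f_def)
    also have "\<dots> = 2 ^ card {v \<in> V. k \<le> X v}"
      using fin by (simp add: prod.If_cases Int_def)
    finally show ?thesis by (simp add: powr_realpow)
  qed
  have Ef: "measure_pmf.expectation ?P f = 1 + ?p"
  proof -
    have "measure_pmf.expectation ?P f = 1 + measure_pmf.expectation ?P (indicator {k..})"
      unfolding f_def by (subst Bochner_Integration.integral_add) (auto intro: measure_pmf.integrable_const_bound[of _ 1])
    then show ?thesis by (simp add: prob_geometric_ge)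
  qed
  have "measure_pmf.expectation (samples V) (\<lambda>X. \<Prod>v\<in>V. f (X v)) = (1 + ?p) ^ card V"
    unfolding samples_def
    by (subst expectation_prod_Pi_pmf) (auto simp: fin int Ef f_nonneg)
  also have "\<dots> \<le> (2 powr (4 * ?p)) ^ card V"
  proof (rule power_mono)
    have "1 + ?p \<le> exp ?p" by (rule exp_ge_add_one_self)
    also have "\<dots> \<le> exp (4 * ?p * ln 2)"
    proof -
      have "1 \<le> 4 * ln (2::real)" using ln2_ge_two_thirds by simp
      then have "?p * 1 \<le> ?p * (4 * ln 2)" by (intro mult_left_mono) auto
      then show ?thesis by (simp add: algebra_simps)
    qed
    also have "\<dots> = 2 powr (4 * ?p)" by (simp add: powr_def)
    finally show "1 + ?p \<le> 2 powr (4 * ?p)" .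
  qed simp
  also have "(2 powr (4 * ?p)) ^ card V = 2 powr (4 * real (card V) / 2 ^ k)"
    by (simp add: powr_powr power_one_over field_simps flip: powr_realpow)
  finally have expect: "measure_pmf.expectation (samples V) (\<lambda>X. \<Prod>v\<in>V. f (X v)) \<le>
      2 powr (4 * real (card V) / 2 ^ k)" .
  have "measure_pmf.prob (samples V) {X \<in> space (samples V). 2 powr c \<le> (\<Prod>v\<in>V. f (X v))} \<le>
      measure_pmf.expectation (samples V) (\<lambda>X. \<Prod>v\<in>V. f (X v)) / 2 powr c"
    unfolding samples_def
    by (rule integral_Markov_inequality_measure[where A = UNIV])
       (auto intro!: integrable_prod_Pi_pmf fin int AE_pmfI prod_nonneg f_nonneg)
  also have "\<dots> \<le> 2 powr (4 * real (card V) / 2 ^ k) / 2 powr c"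
    using expect by (rule divide_right_mono) simp
  also have "\<dots> = 2 powr (4 * real (card V) / 2 ^ k - c)" by (rule powr_diff[symmetric])
  also have "\<dots> = 2 powr (- t)" by (simp add: c_def)
  finally have "measure_pmf.prob (samples V) {X. 2 powr c \<le> (\<Prod>v\<in>V. f (X v))} \<le> 2 powr (- t)"
    by simp
  moreover have "measure_pmf.prob (samples V) {X. c < real (card {v \<in> V. k \<le> X v})} \<le>
      measure_pmf.prob (samples V) {X. 2 powr c \<le> (\<Prod>v\<in>V. f (X v))}"
    by (rule measure_pmf.finite_measure_mono) (use prod in \<open>auto intro!: powr_mono\<close>)
  ultimately show ?thesis unfolding c_def by linarith
qed

lemma floorlog_le_self: "floorlog 2 n \<le> n"
  by (rule floorlog_leI) (auto simp: less_exp)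

lemma theta:
  assumes "n > 0"
  shows "2 ^ (11 * theta n) * floorlog 2 n \<le> n ^ 4" "n ^ 4 < 2 ^ (11 * Suc (theta n)) * floorlog 2 n"
proof -
  let ?Q = "\<lambda>\<theta>. 2 ^ (11 * \<theta>) * floorlog 2 n \<le> n ^ 4"
  have pos: "0 < floorlog 2 n" using assms by (simp add: floorlog_def)
  have bound: "\<theta> \<le> n ^ 4" if "?Q \<theta>" for \<theta>
  proof -
    have "\<theta> < 2 ^ \<theta>" by (rule less_exp)
    also have "(2::nat) ^ \<theta> \<le> 2 ^ (11 * \<theta>) * 1" by (simp add: power_increasing)
    also have "\<dots> \<le> 2 ^ (11 * \<theta>) * floorlog 2 n" using pos by (intro mult_le_mono2) simp
    finally show ?thesis using that by simp
  qed
  have "?Q 0"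
  proof -
    have "n \<le> n ^ 4" using assms by (intro self_le_power) auto
    then show ?thesis using floorlog_le_self[of n] by simp
  qed
  then show "?Q (theta n)" unfolding theta_def by (rule GreatestI_nat) (rule bound)
  have "\<not> ?Q (Suc (theta n))"
  proof
    assume "?Q (Suc (theta n))"
    then have "Suc (theta n) \<le> theta n"
      unfolding theta_def[of n] by (rule Greatest_le_nat) (rule bound)
    then show False by simp
  qed
  then show "n ^ 4 < 2 ^ (11 * Suc (theta n)) * floorlog 2 n" by simp
qed

lemma scale:
  assumes "2 \<le> n"
  shows "n \<le> 2 ^ (11 * scale n)" "2 ^ (11 * scale n) < 2 ^ 11 * n"
proof -
  have "n \<le> 2 ^ (11 * n)" using less_exp[of n] power_increasing[of n "11 * n" "2::nat"] by linarith
  then show le: "n \<le> 2 ^ (11 * scale n)" unfolding scale_def by (rule LeastI)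
  then obtain s where s: "scale n = Suc s" using assms by (cases "scale n") auto
  have "\<not> n \<le> 2 ^ (11 * s)" using not_less_Least[of s "\<lambda>g. n \<le> 2 ^ (11 * g)"] s by (simp add: scale_def)
  then show "2 ^ (11 * scale n) < 2 ^ 11 * n" using s by (simp add: power_add)
qed

context spanner_run
begin

text \<open>No randomness is involved: \<open>2 ^ (scale n * 7)\<close> heavy steps would have more
  than \<open>n\<close> distinct neighbors. Eleventh powers are compared to stay within the
  naturals; \<open>6 \<le> M\<close> pays 3 for overlaps and 2 for the rounding in
  \<open>theta n\<close>.\<close>

lemma card_heavy_steps_less:
  assumes "6 \<le> M" "2 \<le> n" and uv: "u \<in> V" "v \<in> V"
  shows "card (heavy_steps u v) < 2 ^ (scale n * 7)"
proof (rule ccontr)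
  let ?L = "floorlog 2 n" and ?th = "theta n" and ?s = "scale n"
  have L: "1 \<le> ?L" using assms(2) by (simp add: floorlog_def)
  assume "\<not> ?thesis"
  then have "2 ^ (?s * 7) * heavy_degree M n \<le> card (heavy_steps u v) * heavy_degree M n"
    by (intro mult_le_mono1) simp
  also have "\<dots> \<le> 3 * card (\<Union>j\<in>heavy_steps u v. N (geodesic u v j))"
    by (rule geodesic_neighborhood[OF uv]) (auto simp: heavy_steps_def heavy_def)
  also have "\<dots> \<le> 3 * n"
    using finV neighbors_subset by (intro mult_le_mono2 card_mono) auto
  finally have "(2 ^ (?s * 7) * heavy_degree M n) ^ 11 \<le> (3 * n) ^ 11" by (rule power_mono) simp
  then have "2 ^ 11 * (2 ^ (?s * 7) * heavy_degree M n) ^ 11 \<le> 2 ^ 11 * (3 * n) ^ 11"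
    by (rule mult_le_mono2)
  moreover have "6 ^ 11 * n ^ 11 < 2 ^ 11 * (2 ^ (?s * 7) * heavy_degree M n) ^ 11"
  proof -
    have "6 ^ 11 * n ^ 11 = n ^ 7 * (6 ^ 11 * n ^ 4)" by (simp flip: power_add)
    also have "\<dots> < n ^ 7 * (6 ^ 11 * (2 ^ (11 * Suc ?th) * ?L))"
      using theta(2)[of n] assms(2) by simp
    also have "\<dots> \<le> (2 ^ (11 * ?s)) ^ 7 * (M ^ 11 * (2 ^ (11 * Suc ?th) * ?L ^ 11))"
      using scale(1)[OF assms(2)] assms(1) L self_le_power[of ?L 11]
      by (intro mult_le_mono power_mono) auto
    also have "\<dots> = 2 ^ 11 * (2 ^ (?s * 7) * heavy_degree M n) ^ 11"
      by (simp add: heavy_degree_def power_mult_distrib power_add flip: power_mult)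
    finally show ?thesis .
  qed
  ultimately show False by (simp add: power_mult_distrib)
qed

end

text \<open>\<open>good_run\<close> limits the size of level \<open>0\<close> only; the edge count
  also needs the samples to shrink from level to level.\<close>

definition good_sample :: "nat set \<Rightarrow> nat set set \<Rightarrow> nat \<Rightarrow> (nat \<Rightarrow> nat) \<Rightarrow> bool" where
  "good_sample V E M X \<longleftrightarrow> good_run V E M X \<and>
     (\<forall>i<7. real (card {v \<in> V. threshold (card V) i \<le> X v}) \<le>
        4 * real (card V) / 2 ^ threshold (card V) i + real (M * floorlog 2 (card V)))"

lemma ln_le_floorlog: "2 \<le> n \<Longrightarrow> ln (real n) \<le> real (floorlog 2 n)"
proof -
  assume n: "2 \<le> n"
  have "n < 2 ^ floorlog 2 n" using floorlog_bounds[of n 2] n by simp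
  then have "real n \<le> 2 ^ floorlog 2 n" by (simp add: of_nat_less_numeral_power_cancel_iff less_imp_le)
  then have "ln (real n) \<le> ln (2 ^ floorlog 2 n)" using n by (subst ln_le_cancel_iff) auto
  also have "\<dots> = real (floorlog 2 n) * ln 2" by (simp add: ln_realpow)
  also have "\<dots> \<le> real (floorlog 2 n) * 1"
    using ln_2_less_1 by (intro mult_left_mono) auto
  finally show ?thesis by simp
qed

text \<open>Union bound over at most \<open>7 + n + 7 * n ^ 2\<close> events: a level is too large
  (\<open>B1\<close>), a heavy node has no center (\<open>B2\<close>), a path with enough heavy
  steps for a level has no neighbor sampled there (\<open>B3\<close>).\<close>

lemma (in cgraph) prob_good_sample:
  assumes n: "2 \<le> card V" and M: "6 \<le> M" "3 * c + 18 \<le> real M"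
  shows "1 - real (card V) powr (- c) \<le> measure_pmf.prob (samples V) {X. good_sample V E M X}"
proof -
  let ?n = "card V" and ?th = "threshold (card V)" and ?P = "measure_pmf.prob (samples V)"
  let ?L = "floorlog 2 ?n"
  \<comment> \<open>The divisor 3 is the overlap factor in \<open>geodesic_neighborhood\<close>,
    which governs \<open>B3\<close>; the other events are at most this likely.\<close>
  define \<epsilon> where "\<epsilon> = exp (- real (M * ?L) / 3)"
  \<comment> \<open>Heaviness and heavy steps do not involve \<open>X\<close>, so the bad events are
    indexed by fixed sets.\<close>
  define hv where "hv = spanner_run.heavy V E M"
  define hs where "hs = spanner_run.heavy_steps V E M"
  have run: "spanner_run V E" by unfold_locales
  define B1 where "B1 i = {X. 4 * real ?n / 2 ^ ?th i + real (M * ?L) < real (card {v \<in> V. ?th i \<le> X v})}" for i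
  define B2 where "B2 v = {X::nat \<Rightarrow> nat. \<forall>u\<in>neighbors E v. X u < ?th 0}" for v
  define A where "A = (\<lambda>(u, v). \<Union>j\<in>hs u v. neighbors E (geodesic u v j))"
  define B3 where "B3 = (\<lambda>(uv, i). {X::nat \<Rightarrow> nat. \<forall>w\<in>A uv. X w < ?th i})"
  define I3 where "I3 = {(uv, i). uv \<in> V \<times> V \<and> i \<in> {..<7::nat} \<and> 2 ^ (scale ?n * i) \<le> card (hs (fst uv) (snd uv))}"
  define Bad where "Bad = (\<Union>i<7. B1 i) \<union> (\<Union>v\<in>{v \<in> V. hv v}. B2 v) \<union> (\<Union>x\<in>I3. B3 x)"
  have hs: "hs u v = {j. j < nat_dist E u v \<and> hv (geodesic u v j) \<and> hv (geodesic u v (Suc j))}" for u v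
    by (simp add: hs_def hv_def spanner_run.heavy_steps_def[OF run])
  have hv: "hv v \<longleftrightarrow> heavy_degree M ?n \<le> card (neighbors E v)" for v
    by (simp add: hv_def spanner_run.heavy_def[OF run])
  have p1: "?P (B1 i) \<le> \<epsilon>" for i
  proof -
    have "?P (B1 i) \<le> 2 powr (- real (M * ?L))"
      unfolding B1_def by (rule prob_many_sampled[OF finV])
    also have "\<dots> = exp (- real (M * ?L) * ln 2)" by (simp add: powr_def)
    also have "\<dots> \<le> \<epsilon>"
    proof -
      have "real (M * ?L) * (1/3) \<le> real (M * ?L) * ln 2"
        using ln2_ge_two_thirds by (intro mult_left_mono) auto
      then show ?thesis by (simp add: \<epsilon>_def)
    qed
    finally show ?thesis .
  qed
  have p2: "?P (B2 v) \<le> \<epsilon>" if "v \<in> V" "hv v" for v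
  proof -
    have "?P (B2 v) \<le> exp (- real (card (neighbors E v)) / 2 ^ ?th 0)"
      unfolding B2_def by (rule prob_unsampled[OF finV neighbors_subset])
    also have "\<dots> \<le> \<epsilon>"
    proof -
      have "real (M * ?L) * 2 ^ ?th 0 = real (heavy_degree M ?n)"
        by (simp add: heavy_degree_def threshold_def)
      also have "\<dots> \<le> real (card (neighbors E v))" using that hv by simp
      finally have "real (M * ?L) \<le> real (card (neighbors E v)) / 2 ^ ?th 0"
        by (simp add: field_simps)
      moreover have "real (M * ?L) / 3 \<le> real (M * ?L)" by simp
      ultimately show ?thesis unfolding \<epsilon>_def exp_le_cancel_iff minus_divide_left[symmetric] neg_le_iff_le
        by linarith
    qed
    finally show ?thesis .
  qed
  have p3: "?P (B3 x) \<le> \<epsilon>" if xI: "x \<in> I3" for x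
  proof -
    obtain u v i where x: "x = ((u, v), i)" "u \<in> V" "v \<in> V" "2 ^ (scale ?n * i) \<le> card (hs u v)"
      using xI by (auto simp: I3_def)
    have "A (u, v) \<subseteq> V" using neighbors_subset by (auto simp: A_def)
    then have "?P (B3 x) \<le> exp (- real (card (A (u, v))) / 2 ^ ?th i)"
      unfolding B3_def x(1) prod.case by (rule prob_unsampled[OF finV])
    also have "\<dots> \<le> \<epsilon>"
    proof -
      have "2 ^ (scale ?n * i) * heavy_degree M ?n \<le> card (hs u v) * heavy_degree M ?n"
        using x(4) by (rule mult_le_mono1)
      also have "\<dots> \<le> 3 * card (A (u, v))"
        unfolding A_def prod.case by (rule geodesic_neighborhood[OF x(2,3)]) (auto simp: hs hv)
      finally have "real (2 ^ (scale ?n * i) * heavy_degree M ?n) \<le> real (3 * card (A (u, v)))"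
        by (simp only: of_nat_le_iff)
      moreover have "real (2 ^ (scale ?n * i) * heavy_degree M ?n) = real (M * ?L) * 2 ^ ?th i"
        by (simp add: heavy_degree_def threshold_def power_add)
      ultimately have "real (M * ?L) / 3 \<le> real (card (A (u, v))) / 2 ^ ?th i"
        by (simp add: field_simps)
      then show ?thesis by (simp add: \<epsilon>_def)
    qed
    finally show ?thesis .
  qed
  have I3: "I3 \<subseteq> (V \<times> V) \<times> {..<7}" by (auto simp: I3_def)
  then have finI3: "finite I3" using finV finite_subset by blast
  have "card I3 \<le> card ((V \<times> V) \<times> {..<7::nat})" using I3 finV by (intro card_mono) auto
  then have cI3: "card I3 \<le> 7 * ?n\<^sup>2" by (simp add: card_cartesian_product power2_eq_square)
  have "?P Bad \<le> ?P (\<Union>i<7. B1 i) + ?P (\<Union>v\<in>{v \<in> V. hv v}. B2 v) + ?P (\<Union>x\<in>I3. B3 x)"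
    unfolding Bad_def
    by (intro order_trans[OF measure_Un_le] add_mono) auto
  also have "?P (\<Union>i<7. B1 i) \<le> (\<Sum>i<7. ?P (B1 i))"
    by (rule measure_UNION_le) auto
  also have "\<dots> \<le> (\<Sum>i<(7::nat). \<epsilon>)" using p1 by (intro sum_mono)
  also have "?P (\<Union>v\<in>{v \<in> V. hv v}. B2 v) \<le> (\<Sum>v\<in>{v \<in> V. hv v}. ?P (B2 v))"
    using finV by (intro measure_UNION_le) auto
  also have "\<dots> \<le> (\<Sum>v\<in>{v \<in> V. hv v}. \<epsilon>)" using p2 by (intro sum_mono) auto
  also have "\<dots> \<le> real ?n * \<epsilon>" using finV by (simp add: card_mono \<epsilon>_def)
  also have "?P (\<Union>x\<in>I3. B3 x) \<le> (\<Sum>x\<in>I3. ?P (B3 x))"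
    using finI3 by (intro measure_UNION_le) auto
  also have "\<dots> \<le> (\<Sum>x\<in>I3. \<epsilon>)" using p3 by (intro sum_mono)
  also have "\<dots> \<le> 7 * (real ?n)\<^sup>2 * \<epsilon>"
  proof -
    have "real (card I3) \<le> real (7 * ?n\<^sup>2)" using cI3 by (simp only: of_nat_le_iff)
    then show ?thesis by (simp add: \<epsilon>_def)
  qed
  finally have "?P Bad \<le> (7 + real ?n + 7 * (real ?n)\<^sup>2) * \<epsilon>"
    by (simp add: algebra_simps)
  \<comment> \<open>The factor \<open>n powr 6\<close> absorbs the number of events; hence the
    requirement \<open>3 * (c + 6) \<le> M\<close>.\<close>
  also have "\<dots> \<le> real ?n powr 6 * real ?n powr (- c - 6)"
  proof (rule mult_mono)
    have "7 + real ?n + 7 * (real ?n)\<^sup>2 \<le> 10 * (real ?n)\<^sup>2"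
    proof -
      have "2 * 2 \<le> real ?n * real ?n" "2 * real ?n \<le> real ?n * real ?n"
        using n by (intro mult_mono; simp)+
      then show ?thesis unfolding power2_eq_square by linarith
    qed
    also have "\<dots> \<le> real ?n ^ 4 * (real ?n)\<^sup>2"
    proof (rule mult_right_mono)
      have "(2::real) ^ 4 \<le> real ?n ^ 4" by (rule power_mono) (use n in auto)
      then show "10 \<le> real ?n ^ 4" by simp
    qed simp
    also have "\<dots> = real ?n powr 6" using n by (simp add: powr_numeral flip: power_add)
    finally show "7 + real ?n + 7 * (real ?n)\<^sup>2 \<le> real ?n powr 6" .
    have "(c + 6) * ln (real ?n) \<le> (real M / 3) * real ?L"
      using M ln_le_floorlog[OF n] n by (intro mult_mono) auto
    then show "\<epsilon> \<le> real ?n powr (- c - 6)"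
      using n by (simp add: \<epsilon>_def powr_def algebra_simps)
  qed (auto simp: \<epsilon>_def)
  also have "\<dots> = real ?n powr (- c)" by (subst powr_add[symmetric]) simp
  finally have bad: "?P Bad \<le> real ?n powr (- c)" .
  have "X \<in> Bad" if "\<not> good_sample V E M X" for X
  proof (rule ccontr)
    assume X: "X \<notin> Bad"
    interpret R: spanner_run V E M X by unfold_locales
    have hv': "R.heavy v \<longleftrightarrow> hv v" and hs': "R.heavy_steps u v = hs u v" for u v
      by (simp_all add: hv_def hs_def)
    have few: "real (card {v \<in> V. ?th i \<le> X v}) \<le> 4 * real ?n / 2 ^ ?th i + real (M * ?L)" if "i < 7" for i
    proof -
      have "X \<notin> B1 i" using X that by (auto simp: Bad_def)
      then show ?thesis by (simp add: B1_def)
    qed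
    have "good_run V E M X"
    proof unfold_locales
      show "2 \<le> card V" by fact
      have "real (card {v \<in> V. ?th 0 \<le> X v}) \<le> 4 * (real ?n / 2 ^ theta ?n) + real (M * ?L)"
        using few[of 0] by (simp add: threshold_def)
      also have "real ?n / 2 ^ theta ?n \<le> real (?n div 2 ^ theta ?n) + 1"
      proof -
        have "?n < (?n div 2 ^ theta ?n + 1) * 2 ^ theta ?n"
          using dividend_less_div_times[of "2 ^ theta ?n" ?n] by simp
        then have "real ?n < real ((?n div 2 ^ theta ?n + 1) * 2 ^ theta ?n)"
          by (simp only: of_nat_less_iff)
        then show ?thesis by (simp add: divide_le_eq distrib_right)
      qed
      finally have "real (card {v \<in> V. ?th 0 \<le> X v}) \<le> real (sample_bound M ?n)"
        by (simp add: sample_bound_def)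
      then show "card {v \<in> V. R.level 0 v} \<le> sample_bound M ?n"
        by (simp add: R.level_def)
      show "\<exists>u\<in>neighbors E v. R.level 0 u" if "v \<in> V" "R.heavy v" for v
        using X that by (force simp: Bad_def B2_def hv' R.level_def)
      show "card (R.heavy_steps u v) < 2 ^ (scale ?n * 7)" if "u \<in> V" "v \<in> V" for u v
        by (rule R.card_heavy_steps_less[OF M(1) n that])
      show "\<exists>j\<in>R.heavy_steps u v. \<exists>r\<in>neighbors E (geodesic u v j). R.level i r"
        if "u \<in> V" "v \<in> V" "i < 7" "2 ^ (scale ?n * i) \<le> card (R.heavy_steps u v)" for u v i
      proof -
        have "((u, v), i) \<in> I3" using that by (simp add: I3_def hs')
        then have "X \<notin> B3 ((u, v), i)" using X by (auto simp: Bad_def)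
        then show ?thesis by (auto simp: B3_def A_def hs' R.level_def not_less)
      qed
    qed
    then show False using that few unfolding good_sample_def by blast
  qed
  then have "UNIV - Bad \<subseteq> {X. good_sample V E M X}" by auto
  then have "?P (UNIV - Bad) \<le> ?P {X. good_sample V E M X}"
    by (intro measure_pmf.finite_measure_mono) auto
  moreover have "?P (UNIV - Bad) = 1 - ?P Bad"
    using measure_pmf.prob_compl[of Bad "samples V"] by simp
  ultimately show ?thesis using bad by linarith
qed

section \<open>Asymptotic bounds\<close>

locale large_n =
  fixes n :: nat
  assumes n: "2 \<le> n"
begin

definition L :: real where "L = real (floorlog 2 n)"

lemma L_ge_1: "1 \<le> L"
  using n by (simp add: L_def floorlog_def)

lemma L_le: "L \<le> 3 * ln (real n)"
proof -
  have "2 ^ (floorlog 2 n - 1) \<le> n" using floorlog_bounds[of n 2] n by simp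
  then have "real (2 ^ (floorlog 2 n - 1)) \<le> real n" by (simp only: of_nat_le_iff)
  then have "ln (2 ^ (floorlog 2 n - 1)) \<le> ln (real n)" using n by (subst ln_le_cancel_iff) auto
  then have "(L - 1) * ln 2 \<le> ln (real n)"
    using L_ge_1 by (simp add: ln_realpow L_def of_nat_diff)
  then have 1: "L * ln 2 \<le> ln (real n) + ln 2" by (simp add: algebra_simps)
  also have "ln 2 \<le> ln (real n)" using n by (subst ln_le_cancel_iff) auto
  finally have "L * ln 2 \<le> 2 * ln (real n)" by simp
  moreover have "L * (2/3) \<le> L * ln 2"
    using L_ge_1 ln2_ge_two_thirds by (intro mult_left_mono) auto
  ultimately show ?thesis by linarith
qed

text \<open>From \<open>ln x \<le> x powr a / a\<close> with \<open>a = 1/11\<close>; it absorbs the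
  additive deviation terms of the sample sizes.\<close>

lemma L_le_powr: "L \<le> 33 * real n powr (1/11)"
  using L_le ln_powr_bound[of "real n" "1/11"] n by simp

text \<open>The common order of the sample size at level \<open>0\<close> and of the round bound
  without \<open>D\<close>.\<close>

definition Y :: real where "Y = real n powr (7/11) * L powr (1/11)"

lemma powr_L_ge_1: "0 \<le> a \<Longrightarrow> 1 \<le> L powr a"
  using L_ge_1 by (simp add: ge_one_powr_ge_zero)

lemma powr_n_le_Y: "a \<le> 7/11 \<Longrightarrow> real n powr a \<le> Y"
proof -
  assume "a \<le> 7/11"
  then have "real n powr a * 1 \<le> real n powr (7/11) * L powr (1/11)"
    using n powr_L_ge_1[of "1/11"] by (intro mult_mono powr_mono) auto
  then show ?thesis by (simp add: Y_def)
qed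

lemma Y_ge_1: "1 \<le> Y"
  using powr_n_le_Y[of 0] n by simp

lemma powr_11: "0 < x \<Longrightarrow> (x ^ 11) powr (1/11) = (x::real)"
  by (simp add: powr_powr flip: powr_numeral)

lemma theta_upper: "2 ^ theta n * L powr (1/11) \<le> real n powr (4/11)"
proof -
  have "real (2 ^ (11 * theta n) * floorlog 2 n) \<le> real (n ^ 4)"
    using theta(1)[of n] n by (simp only: of_nat_le_iff)
  then have "(2 ^ theta n) ^ 11 * L \<le> real n ^ 4"
    by (simp add: L_def mult.commute flip: power_mult)
  then have "((2 ^ theta n) ^ 11 * L) powr (1/11) \<le> (real n ^ 4) powr (1/11)"
    using L_ge_1 by (intro powr_mono2) auto
  also have "(real n ^ 4) powr (1/11) = real n powr (4/11)"
    using n by (simp add: powr_powr flip: powr_numeral)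
  finally show ?thesis
    using L_ge_1 by (simp add: powr_mult powr_11 del: power_mult)
qed

lemma theta_lower: "real n / 2 ^ theta n \<le> 2 * Y"
proof -
  have "real (n ^ 4) \<le> real (2 ^ (11 * Suc (theta n)) * floorlog 2 n)"
    using theta(2)[of n] n by (simp only: of_nat_le_iff less_imp_le)
  also have "\<dots> = (2 ^ Suc (theta n)) ^ 11 * L"
    by (simp only: L_def of_nat_mult of_nat_power of_nat_numeral mult.commute[of 11] power_mult)
  finally have "(real n ^ 4) powr (1/11) \<le> ((2 ^ Suc (theta n)) ^ 11 * L) powr (1/11)"
    by (intro powr_mono2) auto
  also have "\<dots> = 2 ^ Suc (theta n) * L powr (1/11)"
    using L_ge_1 powr_11[of "2 ^ Suc (theta n)"] by (simp only: powr_mult) simp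
  also have "(real n ^ 4) powr (1/11) = real n powr (4/11)"
    using n by (simp add: powr_powr flip: powr_numeral)
  finally have "real n powr (7/11) * real n powr (4/11) \<le>
      real n powr (7/11) * (2 ^ Suc (theta n) * L powr (1/11))"
    by (intro mult_left_mono) auto
  then have "real n \<le> 2 * Y * 2 ^ theta n"
    using n by (simp add: Y_def mult_ac flip: powr_add)
  then show ?thesis by (simp add: field_simps)
qed

lemma scale_upper: "2 ^ scale n \<le> 2 * real n powr (1/11)"
proof -
  have "real (2 ^ (11 * scale n)) \<le> real (2 ^ 11 * n)"
    using scale(2)[OF n] by (simp only: of_nat_le_iff less_imp_le)
  then have "(2 ^ scale n) ^ 11 \<le> 2 ^ 11 * real n"
    by (simp add: mult.commute flip: power_mult)
  then have "((2 ^ scale n) ^ 11) powr (1/11) \<le> (2 ^ 11 * real n) powr (1/11)"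
    by (intro powr_mono2) auto
  then show ?thesis
    using powr_11[of "2 ^ scale n"] powr_11[of 2] by (simp only: powr_mult) simp
qed

lemma heavy_degree_upper: "real (n * heavy_degree M n) \<le> real M * (real n powr (15/11) * L powr (10/11))"
proof -
  have "real (n * heavy_degree M n) = real M * real n * (L powr (10/11) * (2 ^ theta n * L powr (1/11)))"
    using L_ge_1 by (simp add: heavy_degree_def L_def mult_ac flip: powr_add)
  also have "\<dots> \<le> real M * real n * (L powr (10/11) * real n powr (4/11))"
    using theta_upper by (intro mult_left_mono) auto
  also have "\<dots> = real M * ((real n powr 1 * real n powr (4/11)) * L powr (10/11))"
    using n by (simp add: mult_ac)
  also have "real n powr 1 * real n powr (4/11) = real n powr (15/11)"
    by (subst powr_add[symmetric]) simp
  finally show ?thesis .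
qed

lemma mult_L_upper: "real M * L \<le> 33 * real M * Y"
proof -
  have "real M * L \<le> real M * (33 * real n powr (1/11))"
    using L_le_powr by (intro mult_left_mono) auto
  also have "\<dots> \<le> real M * (33 * Y)"
    using powr_n_le_Y[of "1/11"] by (intro mult_left_mono) auto
  finally show ?thesis by simp
qed

lemma sample_bound_upper: "real (sample_bound M n) \<le> (12 + 33 * real M) * Y"
proof -
  have "real (n div 2 ^ theta n) \<le> real n / real (2 ^ theta n)"
    by (rule of_nat_div_le_of_nat)
  then have "real (n div 2 ^ theta n) \<le> 2 * Y" using theta_lower by simp
  then show ?thesis
    using mult_L_upper[of M] Y_ge_1 by (simp add: sample_bound_def L_def algebra_simps)
qed

text \<open>In the main term \<open>q ^ i\<close> cancels between sampling rate and
  \<open>base_weight\<close>, leaving a single \<open>q\<close>. The deviation \<open>M * L\<close>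
  does not shrink with \<open>i\<close>, but \<open>q ^ (i + 1)\<close> is of order at most
  \<open>Y\<close> for \<open>i < 7\<close>, and \<open>L\<close> of order at most
  \<open>n powr (1/11)\<close>. Both terms are thus of order \<open>Y * n powr (1/11)\<close>, to be
  multiplied by \<open>Y\<close> for the centers.\<close>

lemma pairs_upper:
  assumes i: "i < 7"
    and x: "x \<le> 4 * real n / 2 ^ threshold n i + real M * L" "0 \<le> x"
    and y: "y \<le> 4 * real n / 2 ^ threshold n 0 + real M * L" "0 \<le> y"
  shows "x * y * (6 * real (base_weight n i)) \<le>
    6 * (16 + 4224 * real M) * (8 + 33 * real M) * (real n powr (15/11) * L powr (10/11))"
proof -
  define q where "q = (2::real) ^ scale n"
  let ?e = "real n powr (1/11)"
  have q: "1 \<le> q" by (simp add: q_def)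
  have t: "2 ^ threshold n i = 2 ^ theta n * q ^ i"
    by (simp only: q_def threshold_def power_add power_mult)
  have b: "real (base_weight n i) = q ^ (i + 1)"
    by (simp only: q_def base_weight_def of_nat_power of_nat_numeral power_mult)
  have "x * real (base_weight n i) \<le> (4 * real n / 2 ^ threshold n i + real M * L) * q ^ (i + 1)"
    using x(1) q unfolding b by (intro mult_right_mono) auto
  also have "\<dots> = 4 * (real n / 2 ^ theta n) * q + real M * L * q ^ (i + 1)"
    using q unfolding t by (simp add: field_simps)
  also have "\<dots> \<le> 4 * (2 * Y) * (2 * ?e) + real M * (33 * ?e) * (128 * Y)"
  proof (intro add_mono mult_mono)
    show "real n / 2 ^ theta n \<le> 2 * Y" by (rule theta_lower)
    show "q \<le> 2 * ?e" unfolding q_def by (rule scale_upper)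
    show "L \<le> 33 * ?e" by (rule L_le_powr)
    have "q ^ (i + 1) \<le> q ^ 7" using i q by (intro power_increasing) auto
    also have "\<dots> \<le> (2 * ?e) ^ 7" unfolding q_def using scale_upper by (intro power_mono) auto
    also have "\<dots> = 128 * real n powr (7/11)"
      using n by (simp add: power_mult_distrib powr_powr flip: powr_numeral)
    also have "\<dots> \<le> 128 * Y" using powr_n_le_Y[of "7/11"] by simp
    finally show "q ^ (i + 1) \<le> 128 * Y" .
  qed (use Y_ge_1 L_ge_1 q in auto)
  also have "\<dots> = (16 + 4224 * real M) * (Y * ?e)" by (simp add: algebra_simps)
  finally have 1: "x * real (base_weight n i) \<le> (16 + 4224 * real M) * (Y * ?e)" .
  have 2: "y \<le> (8 + 33 * real M) * Y"
  proof -
    have "y \<le> 4 * (real n / 2 ^ theta n) + real M * L" using y(1) by (simp add: threshold_def)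
    also have "\<dots> \<le> 4 * (2 * Y) + 33 * real M * Y"
      using theta_lower mult_L_upper[of M] by linarith
    finally show ?thesis by (simp add: algebra_simps)
  qed
  have "x * y * (6 * real (base_weight n i)) = 6 * ((x * real (base_weight n i)) * y)" by simp
  also have "\<dots> \<le> 6 * (((16 + 4224 * real M) * (Y * ?e)) * ((8 + 33 * real M) * Y))"
    using y(2) Y_ge_1 by (intro mult_left_mono mult_mono[OF 1 2]) auto
  also have "\<dots> = 6 * (16 + 4224 * real M) * (8 + 33 * real M) * (Y * Y * ?e)" by simp
  also have "Y * Y * ?e = real n powr (15/11) * L powr (2/11)"
  proof -
    have "Y * Y * ?e = (real n powr (7/11) * real n powr (7/11) * ?e) * (L powr (1/11) * L powr (1/11))"
      by (simp add: Y_def)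
    also have "real n powr (7/11) * real n powr (7/11) * ?e = real n powr (15/11)"
      by (simp only: powr_add[symmetric]) simp
    also have "L powr (1/11) * L powr (1/11) = L powr (2/11)"
      by (simp only: powr_add[symmetric]) simp
    finally show ?thesis .
  qed
  also have "6 * (16 + 4224 * real M) * (8 + 33 * real M) * (real n powr (15/11) * L powr (2/11)) \<le>
      6 * (16 + 4224 * real M) * (8 + 33 * real M) * (real n powr (15/11) * L powr (10/11))"
    using L_ge_1 by (intro mult_left_mono powr_mono) auto
  finally show ?thesis .
qed

lemma powr_L_le:
  assumes "0 \<le> a" "a \<le> 1"
  shows "L powr a \<le> 3 * ln (real n) powr a"
proof -
  have ln: "0 < ln (real n)" using n by simp
  have "L powr a \<le> (3 * ln (real n)) powr a" using L_le L_ge_1 assms by (intro powr_mono2) auto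
  also have "\<dots> = 3 powr a * ln (real n) powr a" using ln by (simp add: powr_mult)
  also have "\<dots> \<le> 3 powr 1 * ln (real n) powr a"
    using assms by (intro mult_right_mono powr_mono) auto
  finally show ?thesis by simp
qed

end

text \<open>Here 42 is seven levels times \<open>6\<close>, and the leading 3 converts powers of
  \<open>L\<close> to powers of \<open>ln n\<close>.\<close>

definition edge_constant :: "nat \<Rightarrow> real" where
  "edge_constant M = 3 * (real M + 1 + 42 * (16 + 4224 * real M) * (8 + 33 * real M))"

text \<open>\<open>272 = 17 * 16\<close>: the seven blocks contain \<open>T0\<close> 14 times, the
  stages before them 3 times, and \<open>T0 \<le> 16 * D\<close>.\<close>

definition round_constant :: "nat \<Rightarrow> real" where
  "round_constant M = 272 + 3 * (2 + 14 * (12 + 33 * real M))"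

lemma card_spanner_upper:
  assumes "good_sample V E M X"
  shows "real (card (spanner_run.spanner V E M X)) \<le>
    edge_constant M * (real (card V) powr (15/11) * ln (real (card V)) powr (10/11))"
proof -
  interpret good_run V E M X using assms by (simp add: good_sample_def)
  interpret large_n n using size_ge_2 by unfold_locales
  let ?Z = "real n powr (15/11) * L powr (10/11)"
  have level: "real (card {v \<in> V. level i v}) \<le> 4 * real n / 2 ^ threshold n i + real M * L" if "i < 7" for i
    using assms that by (simp add: good_sample_def level_def L_def)
  have "real (card spanner) \<le> real (n * heavy_degree M n + n +
     (\<Sum>i<7. card {v \<in> V. level i v} * card {v \<in> V. level 0 v} * (6 * base_weight n i)))"
    using card_spanner by (simp only: of_nat_le_iff)
  also have "\<dots> = real (n * heavy_degree M n) + real n + (\<Sum>i<7. real (card {v \<in> V. level i v}) *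
      real (card {v \<in> V. level 0 v}) * (6 * real (base_weight n i)))"
    by simp
  also have "\<dots> \<le> real M * ?Z + ?Z + (\<Sum>i<(7::nat). 6 * (16 + 4224 * real M) * (8 + 33 * real M) * ?Z)"
  proof (intro add_mono sum_mono heavy_degree_upper)
    have "real n powr 1 * 1 \<le> ?Z"
      using size_ge_2 powr_L_ge_1[of "10/11"] by (intro mult_mono powr_mono) auto
    then show "real n \<le> ?Z" by simp
    show "real (card {v \<in> V. level i v}) * real (card {v \<in> V. level 0 v}) * (6 * real (base_weight n i)) \<le>
        6 * (16 + 4224 * real M) * (8 + 33 * real M) * ?Z" if "i \<in> {..<7}" for i
      using that level[of i] level[of 0] by (intro pairs_upper) auto
  qed
  also have "\<dots> = (real M + 1 + 42 * (16 + 4224 * real M) * (8 + 33 * real M)) * ?Z"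
    by (simp add: algebra_simps)
  also have "\<dots> \<le> (real M + 1 + 42 * (16 + 4224 * real M) * (8 + 33 * real M)) *
      (real n powr (15/11) * (3 * ln (real n) powr (10/11)))"
    using powr_L_le[of "10/11"] by (intro mult_left_mono) auto
  also have "\<dots> = edge_constant M * (real n powr (15/11) * ln (real n) powr (10/11))"
    by (simp add: edge_constant_def)
  finally show ?thesis .
qed

context spanner_run
begin

lemma T_end_upper:
  assumes "2 \<le> n" "\<And>v. v \<in> V \<Longrightarrow> depth v \<le> D" "0 < D"
  shows "real T_end \<le> round_constant M * (real n powr (7/11) * ln (real n) powr (1/11) + real D)"
proof -
  interpret large_n n using assms(1) by unfold_locales
  let ?W = "real n powr (7/11) * ln (real n) powr (1/11)"
  have "Y \<le> real n powr (7/11) * (3 * ln (real n) powr (1/11))"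
    unfolding Y_def using powr_L_le[of "1/11"] by (intro mult_left_mono) auto
  then have Y: "Y \<le> 3 * ?W" by simp
  have "real T_end = 17 * real T0 + 2 + 14 * real (sample_bound M n)"
    by (simp add: T_end_def K_def)
  also have "\<dots> \<le> 17 * (16 * real D) + 2 * Y + 14 * ((12 + 33 * real M) * Y)"
    using T0_le[OF assms(2,3)] sample_bound_upper[of M] Y_ge_1 by (intro add_mono mult_left_mono) auto
  also have "\<dots> = 272 * real D + (2 + 14 * (12 + 33 * real M)) * Y" by (simp add: algebra_simps)
  also have "\<dots> \<le> 272 * real D + (2 + 14 * (12 + 33 * real M)) * (3 * ?W)"
    using Y by (intro add_left_mono mult_left_mono) auto
  also have "\<dots> \<le> round_constant M * real D + round_constant M * ?W"
    by (intro add_mono) (auto simp: round_constant_def algebra_simps)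
  finally show ?thesis by (simp add: algebra_simps)
qed

text \<open>A message has at most three entries, each an identifier, the successor of one, or a
  number polynomial in \<open>n\<close>.\<close>

lemma length_encode_msg:
  assumes n: "2 \<le> n" and t: "t < T_end" and v: "v \<in> V"
    and ids: "\<forall>v\<in>V. floorlog 2 v \<le> a * floorlog 2 n"
  shows "length (encode (msg t v u)) \<le> 3 * (2 * (M + 23 + a) + 1) * floorlog 2 n"
proof -
  let ?L = "floorlog 2 n" and ?A = "(2::nat) ^ floorlog 2 n"
  have L: "1 \<le> ?L" using n by (simp add: floorlog_def)
  have A: "n \<le> ?A" using floorlog_bounds[of n 2] n by simp
  have A2: "2 \<le> ?A" using n A by simp
  have AA: "?A \<le> ?A ^ 2" "1 \<le> ?A ^ 2" by (simp_all add: power2_eq_square)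
  have F: "floorlog 2 x \<le> (M + 23 + a) * ?L" if x: "x \<in> set (msg t v u)" for x
  proof -
    consider "x \<le> n + 1 + (base_weight n 6 + 1) * K" | "x \<in> V" | y where "y \<in> V" "x = Suc y"
      using msg_bounded(2)[OF t v x] by auto
    then show ?thesis
    proof cases
      case 1
      have "base_weight n 6 \<le> 2 ^ (11 * scale n)"
        unfolding base_weight_def by (intro power_increasing) auto
      also have "\<dots> < 2 ^ 11 * n" by (rule scale(2)[OF n])
      also have "\<dots> \<le> 2 ^ 11 * ?A" using A by (rule mult_le_mono2)
      finally have b: "base_weight n 6 + 1 \<le> 2 ^ 12 * ?A" by simp
      have "depth w \<le> n * n" if "w \<in> V" for w
        using nat_dist_le_square[OF leader_in_V that] by (simp add: depth_def)
      then have "T0 \<le> 16 * (n * n)" using n by (intro T0_le) auto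
      also have "n * n \<le> ?A ^ 2" unfolding power2_eq_square by (rule mult_le_mono[OF A A])
      finally have "T0 \<le> 16 * ?A ^ 2" by simp
      moreover have "n div 2 ^ theta n \<le> ?A ^ 2" 
        using div_le_dividend[of n "2 ^ theta n"] A AA(1) by linarith
      moreover have "M * ?L \<le> M * ?A ^ 2"
        using order_trans[OF less_imp_le[OF less_exp[of ?L]] AA(1)] by (rule mult_le_mono2)
      ultimately have "K \<le> 16 * ?A ^ 2 + (4 * ?A ^ 2 + 4 * ?A ^ 2 + M * ?A ^ 2)"
        unfolding K_def sample_bound_def using AA(2) by linarith
      also have "\<dots> = (24 + M) * ?A ^ 2" by (simp add: algebra_simps)
      also have "\<dots> \<le> 2 ^ (M + 5) * ?A ^ 2"
      proof (rule mult_le_mono1)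
        have "2 ^ (M + 5) = 32 * (2::nat) ^ M" by (simp add: power_add)
        then show "24 + M \<le> 2 ^ (M + 5)" using less_exp[of M] by linarith
      qed
      finally have "(base_weight n 6 + 1) * K \<le> 2 ^ 12 * ?A * (2 ^ (M + 5) * ?A ^ 2)"
        using b by (intro mult_le_mono)
      also have "\<dots> = 2 ^ (M + 17) * ?A ^ 3"
        by (simp add: power_add power2_eq_square power3_eq_cube)
      finally have "x \<le> ?A + 1 + 2 ^ (M + 17) * ?A ^ 3" using 1 A by linarith
      also have "\<dots> < 2 ^ (M + 19) * ?A ^ 3"
      proof -
        have "?A * 1 \<le> ?A * ?A ^ 2" using AA by (intro mult_le_mono2)
        then have "?A \<le> ?A ^ 3" by (simp add: power2_eq_square power3_eq_cube)
        moreover have "?A ^ 3 \<le> 2 ^ (M + 17) * ?A ^ 3" by simp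
        moreover have "2 ^ (M + 19) * ?A ^ 3 = 4 * (2 ^ (M + 17) * ?A ^ 3)" by (simp add: power_add)
        ultimately show ?thesis using A2 by linarith
      qed
      \<comment> \<open>As \<open>?A \<ge> 2\<close>, the constant factor becomes a power of
        \<open>?A\<close>, so the exponent of 2 is a multiple of \<open>?L\<close>.\<close>
      also have "\<dots> \<le> ?A ^ (M + 19) * ?A ^ 3"
        using A2 by (intro mult_le_mono1 power_mono) auto
      also have "\<dots> = 2 ^ ((M + 22) * ?L)"
        by (simp add: algebra_simps flip: power_add power_mult)
      finally have "floorlog 2 x \<le> (M + 22) * ?L" by (intro floorlog_leI) auto
      also have "\<dots> \<le> (M + 23 + a) * ?L" by (intro mult_le_mono1) simp
      finally show ?thesis .
    next
      case 2
      have "floorlog 2 x \<le> a * ?L" using ids 2 by blast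
      also have "\<dots> \<le> (M + 23 + a) * ?L" by (intro mult_le_mono1) simp
      finally show ?thesis .
    next
      case (3 y)
      have "y < 2 ^ floorlog 2 y" using floorlog_bounds[of y 2] by (cases "y = 0") auto
      then have "floorlog 2 x \<le> floorlog 2 y + 1" using 3 by (intro floorlog_leI) auto
      also have "\<dots> \<le> a * ?L + ?L" using ids 3 L by (intro add_mono) auto
      also have "\<dots> \<le> (M + 23 + a) * ?L" by (simp add: algebra_simps)
      finally show ?thesis .
    qed
  qed
  have "length (encode (msg t v u)) \<le> (\<Sum>x\<leftarrow>msg t v u. 2 * ((M + 23 + a) * ?L) + 1)"
    unfolding length_encode using F by (intro sum_list_mono) auto
  also have "\<dots> = length (msg t v u) * (2 * ((M + 23 + a) * ?L) + 1)"
    by (simp add: sum_list_triv)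
  also have "\<dots> \<le> 3 * (2 * ((M + 23 + a) * ?L) + ?L)"
    using msg_bounded(1)[OF t v] L by (intro mult_le_mono) auto
  also have "\<dots> = 3 * (2 * (M + 23 + a) + 1) * ?L" by (simp add: algebra_simps)
  finally show ?thesis .
qed

end

lemma (in cgraph) neighbors_nonempty:
  assumes "2 \<le> card V" "v \<in> V"
  shows "neighbors E v \<noteq> {}"
proof -
  have "V \<noteq> {v}" using assms(1) by auto
  then obtain u where u: "u \<in> V" "u \<noteq> v" using assms(2) by blast
  then have "nat_dist E u v \<noteq> 0" using nat_dist_eq_0 assms(2) by blast
  then show ?thesis using nat_dist_pred[OF u(1) assms(2)] not0_implies_Suc by blast
qed

lemma (in cgraph) nat_dist_le_diameter:
  assumes "graph_diameter V E = enat D" "u \<in> V" "v \<in> V"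
  shows "nat_dist E u v \<le> D"
proof -
  have "gdist E u v \<le> (SUP v\<in>V. gdist E u v)" using assms(3) by (rule SUP_upper)
  also have "\<dots> \<le> graph_diameter V E" unfolding graph_diameter_def using assms(2) by (rule SUP_upper)
  finally show ?thesis using assms by (simp add: gdist_nat_dist)
qed

lemma (in cgraph) spanner_algorithm_correct:
  assumes n: "2 \<le> card V" and D: "graph_diameter V E = enat D"
    and ids: "\<forall>v\<in>V. floorlog 2 v \<le> a * floorlog 2 (card V)"
    and M: "6 \<le> M" "3 * c + 18 \<le> real M"
  shows "respects_bandwidth (spanner_algorithm M) V E (3 * (2 * (M + 23 + a) + 1) * floorlog 2 (card V))"
    and "\<exists>T. real T \<le> round_constant M *
             (real (card V) powr (7/11) * ln (real (card V)) powr (1/11) + real D) \<and>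
           1 - real (card V) powr (- c) \<le> measure_pmf.prob (config (spanner_algorithm M) V E T)
             {\<sigma>. \<exists>H. outputs_subgraph (spanner_algorithm M) V \<sigma> H \<and> additive_spanner V E 8 H \<and>
                  real (card H) \<le> edge_constant M *
                    (real (card V) powr (15/11) * ln (real (card V)) powr (10/11))}"
proof -
  let ?T = "spanner_run.T_end V E M"
  have run: "spanner_run V E" by unfold_locales
  have before: "result_at (spanner_result M) (spanner_out M) E X t v = None" if "t < ?T" "v \<in> V" for t v X
    using spanner_run.result_before[OF run that(2) neighbors_nonempty[OF n that(2)] that(1)] .
  have final: "result_at (spanner_result M) (spanner_out M) E X ?T v = Some (spanner_run.kept V E M X v)"
    if "v \<in> V" for v X
    using spanner_run.result_end[OF run that neighbors_nonempty[OF n that]] .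
  show "respects_bandwidth (spanner_algorithm M) V E (3 * (2 * (M + 23 + a) + 1) * floorlog 2 (card V))"
    unfolding spanner_algorithm_def
    by (rule respects_bandwidth_view_algorithm[OF finV neighbors_subset before, of ?T])
       (use final spanner_run.length_encode_msg[OF run n] ids in auto)
  obtain u v where uv: "u \<in> V" "v \<in> neighbors E u"
    using neV neighbors_nonempty[OF n] by blast
  then have "nat_dist E u v \<noteq> 0" using nat_dist_eq_0 not_neighbor_self neighbor_in_V by blast
  moreover have "nat_dist E u v \<le> D" using nat_dist_le_diameter[OF D] uv neighbor_in_V by blast
  ultimately have "0 < D" by simp
  then have T: "real ?T \<le> round_constant M *
      (real (card V) powr (7/11) * ln (real (card V)) powr (1/11) + real D)"
    using nat_dist_le_diameter[OF D leader_in_V]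
    by (intro spanner_run.T_end_upper[OF run n]) (auto simp: depth_def)
  have config: "config (spanner_algorithm M) V E ?T = map_pmf (config_of (spanner_out M) V E ?T) (samples V)"
    unfolding spanner_algorithm_def by (rule config_view_algorithm[OF finV neighbors_subset before])
  let ?G = "{\<sigma>. \<exists>H. outputs_subgraph (spanner_algorithm M) V \<sigma> H \<and> additive_spanner V E 8 H \<and>
      real (card H) \<le> edge_constant M * (real (card V) powr (15/11) * ln (real (card V)) powr (10/11))}"
  have "config_of (spanner_out M) V E ?T X \<in> ?G" if good: "good_sample V E M X" for X
  proof -
    interpret good_run V E M X using good by (simp add: good_sample_def)
    have "outputs_subgraph (spanner_algorithm M) V (config_of (spanner_out M) V E ?T X) spanner"
      unfolding outputs_subgraph_def spanner_algorithm_def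
      by (auto simp: config_of_def result_state_of finite_neighbors final neighbors_spanner)
    then show ?thesis using additive_spanner_spanner card_spanner_upper[OF good] by blast
  qed
  then have "measure_pmf.prob (samples V) {X. good_sample V E M X} \<le>
      measure_pmf.prob (config (spanner_algorithm M) V E ?T) ?G"
    unfolding config measure_map_pmf by (intro measure_pmf.finite_measure_mono) auto
  then have "1 - real (card V) powr (- c) \<le> measure_pmf.prob (config (spanner_algorithm M) V E ?T) ?G"
    using prob_good_sample[OF n M] by linarith
  with T show "\<exists>T. real T \<le> round_constant M *
             (real (card V) powr (7/11) * ln (real (card V)) powr (1/11) + real D) \<and>
           1 - real (card V) powr (- c) \<le> measure_pmf.prob (config (spanner_algorithm M) V E T) ?G"
    by blast
qed

theorem theorem18:
  fixes a :: nat and c :: real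
  assumes "c > 0"
  shows "\<exists>(alg :: nat congest_algorithm) (B :: nat) (C\<^sub>e :: real) (C\<^sub>r :: real).
    \<forall>(V :: nat set) (E :: nat set set) (n :: nat) (D :: nat).
      connected_graph V E \<and> card V = n \<and> graph_diameter V E = enat D \<and>
      (\<forall>v\<in>V. floorlog 2 v \<le> a * floorlog 2 n) \<longrightarrow>
        respects_bandwidth alg V E (B * floorlog 2 n) \<and>
        (\<exists>T :: nat.
           real T \<le> C\<^sub>r * (real n powr (7/11) * ln (real n) powr (1/11) + real D) \<and>
           measure_pmf.prob (config alg V E T)
             {\<sigma>. \<exists>H. outputs_subgraph alg V \<sigma> H \<and> additive_spanner V E 8 H \<and>
                  real (card H) \<le> C\<^sub>e * (real n powr (15/11) * ln (real n) powr (10/11))}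
             \<ge> 1 - real n powr (- c))"
proof -
  \<comment> \<open>\<open>M\<close> depends on \<open>c\<close> alone; \<open>a\<close> enters only
    through the message length.\<close>
  define M where "M = nat \<lceil>3 * c + 18\<rceil>"
  have M: "6 \<le> M" "3 * c + 18 \<le> real M"
    using assms unfolding M_def by linarith+
  have r: "0 \<le> round_constant M" by (simp add: round_constant_def)
  show ?thesis
  proof (rule exI[of _ "spanner_algorithm M"], rule exI[of _ "3 * (2 * (M + 23 + a) + 1)"],
      rule exI[of _ "edge_constant M"], rule exI[of _ "round_constant M"], intro allI impI, elim conjE)
    fix V E n D
    assume conn: "connected_graph V E" and n: "card V = n" and D: "graph_diameter V E = enat D"
      and ids: "\<forall>v\<in>V. floorlog 2 v \<le> a * floorlog 2 n"
    interpret cgraph V E using conn by unfold_locales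
    show "respects_bandwidth (spanner_algorithm M) V E (3 * (2 * (M + 23 + a) + 1) * floorlog 2 n) \<and>
        (\<exists>T :: nat.
           real T \<le> round_constant M * (real n powr (7/11) * ln (real n) powr (1/11) + real D) \<and>
           measure_pmf.prob (config (spanner_algorithm M) V E T)
             {\<sigma>. \<exists>H. outputs_subgraph (spanner_algorithm M) V \<sigma> H \<and> additive_spanner V E 8 H \<and>
                  real (card H) \<le> edge_constant M * (real n powr (15/11) * ln (real n) powr (10/11))}
             \<ge> 1 - real n powr (- c))"
    proof (cases "2 \<le> n")
      case True
      then show ?thesis
        using spanner_algorithm_correct[of D a M c] n D ids M by simp
    next
      case False
      \<comment> \<open>For a single node the required probability is
        \<open>1 - 1 powr (- c) = 0\<close>, so round \<open>0\<close> will do.\<close>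
      then have "n = 1" using n finV neV by (cases n) auto
      then obtain v where V: "V = {v}" using n card_1_singletonE by blast
      have "neighbors E v = {}" using neighbors_subset[of v] not_neighbor_self[of v] V by auto
      then have "respects_bandwidth (spanner_algorithm M) V E (3 * (2 * (M + 23 + a) + 1) * floorlog 2 n)"
        using V by (simp add: respects_bandwidth_def)
      then show ?thesis using \<open>n = 1\<close> r by (intro conjI exI[of _ 0]) auto
    qed
  qed
qed

end
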